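(* Let $d\neq 1$ be a squarefree integer and let $K=\mathbb{Q}(\sqrt d)$, with discriminant $\Delta_K$. Let $p$ and $q$ be two positive primes. Then the quaternion algebra $H_K(p,q)$ is a division algebra if and only if one of the following conditions holds: 1. $p$ and $q$ are odd and distinct, $p$ or $q\equiv 1\pmod 4$, $\left(\frac{p}{q}\right)=-1$, and ($\left(\frac{\Delta_K}{p}\right)=1$ or $\left(\frac{\Delta_K}{q}\right)=1$); 2. $q=2$, ($p\equiv 3\pmod 8$ or $p\equiv 5\pmod 8$), and (either $\left(\frac{\Delta_K}{p}\right)=1$ or $d\equiv 1\pmod 8$); 3. $p$ and $q$ are odd, with $p\equiv q\equiv 3\pmod 4$, and - $\left(\frac{q}{p}\right)\neq 1$ and (either $\left(\frac{\Delta_K}{p}\right)=1$ or $d\equiv 1\pmod 8$), or - $\left(\frac{p}{q}\right)\neq 1$ and (either $\left(\frac{\Delta_K}{q}\right)=1$ or $d\equiv 1\pmod 8$).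
   Context: For a field $K$ of characteristic $\ne 2$ and $\alpha,\beta\in K^*=K\setminus\{0\}$, $H_K(\alpha,\beta)$ is the quaternion $K$-algebra with $K$-basis $1,i,j,k$ and $i^2=\alpha$, $j^2=\beta$, $ij=-ji=k$. The symbol $\left(\frac{a}{p}\right)$, for an odd prime $p$, is the Legendre symbol (equal to $0$ if $p\mid a$).
   Formalization: Condition 2 is also allowed with p and q exchanged (p=2, q≡3 or 5 mod 8, and (Δ_K/q)=1 or d≡1 mod 8); as printed the equivalence fails for p=2, q odd, e.g. p=2, q=3, d=73, where H_K(2,3) is a division algebra but no listed condition holds. *)

theory Defs
  imports
    "HOL-Algebra.Generated_Fields"
    "HOL-Algebra.Algebraic_Closure_Type"
    "HOL-Number_Theory.Residues"
    "HOL-Computational_Algebra.Squarefree"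
    "Jordan_Normal_Form.Determinant"
    Complex_Main
begin

section \<open>Quaternion algebras\<close>

text \<open>
  The element \<open>(a, b, c, d)\<close> stands for \<open>a + b i + c j + d k\<close>.  The product is the
  bilinear extension of \<open>i\<^sup>2 = \<alpha>\<close>, \<open>j\<^sup>2 = \<beta>\<close>, \<open>i j = - j i = k\<close>, which force
  \<open>k\<^sup>2 = - \<alpha> \<beta>\<close>, \<open>i k = - k i = \<alpha> j\<close> and \<open>k j = - j k = \<beta> i\<close>.
\<close>

type_synonym 'a quat = "'a \<times> 'a \<times> 'a \<times> 'a"

definition quaternion_algebra ::
    "('a, 'm) ring_scheme \<Rightarrow> 'a \<Rightarrow> 'a \<Rightarrow> 'a quat ring" where
  "quaternion_algebra R \<alpha> \<beta> =
    \<lparr> carrier = carrier R \<times> carrier R \<times> carrier R \<times> carrier R,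
      monoid.mult = (\<lambda>(a1, b1, c1, d1) (a2, b2, c2, d2).
        (a1 \<otimes>\<^bsub>R\<^esub> a2 \<oplus>\<^bsub>R\<^esub> \<alpha> \<otimes>\<^bsub>R\<^esub> (b1 \<otimes>\<^bsub>R\<^esub> b2)
            \<oplus>\<^bsub>R\<^esub> \<beta> \<otimes>\<^bsub>R\<^esub> (c1 \<otimes>\<^bsub>R\<^esub> c2) \<ominus>\<^bsub>R\<^esub> \<alpha> \<otimes>\<^bsub>R\<^esub> \<beta> \<otimes>\<^bsub>R\<^esub> (d1 \<otimes>\<^bsub>R\<^esub> d2),
         a1 \<otimes>\<^bsub>R\<^esub> b2 \<oplus>\<^bsub>R\<^esub> b1 \<otimes>\<^bsub>R\<^esub> a2
            \<oplus>\<^bsub>R\<^esub> \<beta> \<otimes>\<^bsub>R\<^esub> (d1 \<otimes>\<^bsub>R\<^esub> c2) \<ominus>\<^bsub>R\<^esub> \<beta> \<otimes>\<^bsub>R\<^esub> (c1 \<otimes>\<^bsub>R\<^esub> d2),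
         a1 \<otimes>\<^bsub>R\<^esub> c2 \<oplus>\<^bsub>R\<^esub> c1 \<otimes>\<^bsub>R\<^esub> a2
            \<oplus>\<^bsub>R\<^esub> \<alpha> \<otimes>\<^bsub>R\<^esub> (b1 \<otimes>\<^bsub>R\<^esub> d2) \<ominus>\<^bsub>R\<^esub> \<alpha> \<otimes>\<^bsub>R\<^esub> (d1 \<otimes>\<^bsub>R\<^esub> b2),
         a1 \<otimes>\<^bsub>R\<^esub> d2 \<oplus>\<^bsub>R\<^esub> d1 \<otimes>\<^bsub>R\<^esub> a2
            \<oplus>\<^bsub>R\<^esub> b1 \<otimes>\<^bsub>R\<^esub> c2 \<ominus>\<^bsub>R\<^esub> c1 \<otimes>\<^bsub>R\<^esub> b2)),
      one = (\<one>\<^bsub>R\<^esub>, \<zero>\<^bsub>R\<^esub>, \<zero>\<^bsub>R\<^esub>, \<zero>\<^bsub>R\<^esub>),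
      ring.zero = (\<zero>\<^bsub>R\<^esub>, \<zero>\<^bsub>R\<^esub>, \<zero>\<^bsub>R\<^esub>, \<zero>\<^bsub>R\<^esub>),
      add = (\<lambda>(a1, b1, c1, d1) (a2, b2, c2, d2).
        (a1 \<oplus>\<^bsub>R\<^esub> a2, b1 \<oplus>\<^bsub>R\<^esub> b2, c1 \<oplus>\<^bsub>R\<^esub> c2, d1 \<oplus>\<^bsub>R\<^esub> d2)) \<rparr>"

lemma (in cring) quaternion_algebra_relations:
  assumes "\<alpha> \<in> carrier R" and "\<beta> \<in> carrier R"
  defines "H \<equiv> quaternion_algebra R \<alpha> \<beta>"
    and "qi \<equiv> (\<zero>, \<one>, \<zero>, \<zero>)" and "qj \<equiv> (\<zero>, \<zero>, \<one>, \<zero>)" and "qk \<equiv> (\<zero>, \<zero>, \<zero>, \<one>)"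
  shows "qi \<otimes>\<^bsub>H\<^esub> qi = (\<alpha>, \<zero>, \<zero>, \<zero>)"
    and "qj \<otimes>\<^bsub>H\<^esub> qj = (\<beta>, \<zero>, \<zero>, \<zero>)"
    and "qi \<otimes>\<^bsub>H\<^esub> qj = qk"
    and "qj \<otimes>\<^bsub>H\<^esub> qi = (\<zero>, \<zero>, \<zero>, \<ominus> \<one>)"
  unfolding H_def qi_def qj_def qk_def
  using assms(1,2) by (simp_all add: quaternion_algebra_def minus_eq)

lemma (in cring) ring_quaternion_algebra:
  assumes "\<alpha> \<in> carrier R" and "\<beta> \<in> carrier R"
  shows "ring (quaternion_algebra R \<alpha> \<beta>)"
proof (rule ringI)
  show "abelian_group (quaternion_algebra R \<alpha> \<beta>)"
  proof (rule abelian_groupI)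
    fix x assume "x \<in> carrier (quaternion_algebra R \<alpha> \<beta>)"
    then obtain a b c d where "x = (a, b, c, d)"
      "a \<in> carrier R" "b \<in> carrier R" "c \<in> carrier R" "d \<in> carrier R"
      by (auto simp: quaternion_algebra_def)
    then show "\<exists>y\<in>carrier (quaternion_algebra R \<alpha> \<beta>).
        y \<oplus>\<^bsub>quaternion_algebra R \<alpha> \<beta>\<^esub> x = \<zero>\<^bsub>quaternion_algebra R \<alpha> \<beta>\<^esub>"
      by (intro bexI[of _ "(\<ominus> a, \<ominus> b, \<ominus> c, \<ominus> d)"])
         (auto simp: quaternion_algebra_def l_neg)
  qed (use assms in \<open>auto simp: quaternion_algebra_def a_ac\<close>)
  show "Group.monoid (quaternion_algebra R \<alpha> \<beta>)"
  proof (rule monoidI)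
    fix x y z
    assume "x \<in> carrier (quaternion_algebra R \<alpha> \<beta>)" "y \<in> carrier (quaternion_algebra R \<alpha> \<beta>)"
      "z \<in> carrier (quaternion_algebra R \<alpha> \<beta>)"
    then show "x \<otimes>\<^bsub>quaternion_algebra R \<alpha> \<beta>\<^esub> y \<otimes>\<^bsub>quaternion_algebra R \<alpha> \<beta>\<^esub> z =
        x \<otimes>\<^bsub>quaternion_algebra R \<alpha> \<beta>\<^esub> (y \<otimes>\<^bsub>quaternion_algebra R \<alpha> \<beta>\<^esub> z)"
      using assms
      by (auto simp: quaternion_algebra_def minus_eq minus_add l_distr r_distr l_minus r_minus
          a_ac m_ac)
  qed (use assms in \<open>auto simp: quaternion_algebra_def minus_eq\<close>)
qed (use assms in \<open>auto simp: quaternion_algebra_def minus_eq minus_add l_distr r_distr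
       l_minus r_minus a_ac m_ac\<close>)

definition is_division_algebra :: "('a, 'm) ring_scheme \<Rightarrow> bool" where
  "is_division_algebra D \<longleftrightarrow> ring D \<and> Units D = carrier D - {\<zero>\<^bsub>D\<^esub>}"

section \<open>Number fields\<close>

text \<open>Number fields are represented as subfields of the complex numbers.\<close>

abbreviation complex_field :: "complex ring" where
  "complex_field \<equiv> ring_of_type_algebra"

abbreviation subfield_ring :: "complex set \<Rightarrow> complex ring" where
  "subfield_ring K \<equiv> complex_field \<lparr> carrier := K \<rparr>"

definition quadratic_field :: "int \<Rightarrow> complex set" where
  "quadratic_field d = generate_field complex_field {csqrt (of_int d)}"

definition ring_of_integers :: "complex set \<Rightarrow> complex set" where
  "ring_of_integers K = {x \<in> K. algebraic_int x}"

text \<open>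
  Embeddings are cut off outside \<open>K\<close> so that each field homomorphism is counted once.
  Their number is the degree of \<open>K\<close> over the rationals.
\<close>

definition embeddings :: "complex set \<Rightarrow> (complex \<Rightarrow> complex) set" where
  "embeddings K = Ring.ring_hom (subfield_ring K) complex_field \<inter> extensional K"

definition field_trace :: "complex set \<Rightarrow> complex \<Rightarrow> complex" where
  "field_trace K x = (\<Sum>\<sigma>\<in>embeddings K. \<sigma> x)"

definition integral_basis :: "complex set \<Rightarrow> nat \<Rightarrow> (nat \<Rightarrow> complex) \<Rightarrow> bool" where
  "integral_basis K n \<omega> \<longleftrightarrow>
    (\<forall>i<n. \<omega> i \<in> ring_of_integers K) \<and>
    (\<forall>x\<in>ring_of_integers K. \<exists>!c. c \<in> {..<n} \<rightarrow>\<^sub>E (UNIV :: int set) \<and>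
       x = (\<Sum>i<n. of_int (c i) * \<omega> i))"

definition discriminant :: "complex set \<Rightarrow> int" where
  "discriminant K = (THE D. \<exists>\<omega>. let n = card (embeddings K) in
     integral_basis K n \<omega> \<and>
     of_int D = det (mat n n (\<lambda>(i, j). field_trace K (\<omega> i * \<omega> j))))"

end

theory Submission
  imports
    Defs
    "HOL-Number_Theory.Number_Theory"
    "HOL-Analysis.Infinite_Sum"
    "HOL-Analysis.Summation_Tests"
begin

text \<open>
  Write \<open>G\<^sub>d\<close> for the integral form \<open>p x\<^sup>2 + q y\<^sup>2 - p q z\<^sup>2 - d w\<^sup>2\<close>.  Its first three terms are minus the
  norm on the pure quaternions over the rationals, so \<open>G\<^sub>d\<close> is isotropic when the quaternion algebra
  over the rationals contains a square root of \<open>d\<close> (or is split).  An algebra over \<open>K\<close> with an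
  anisotropic norm is a division algebra, and a zero \<open>u\<^sub>0 + u\<^sub>1 \<surd>d\<close> of the norm over \<open>K\<close> makes
  \<open>u\<^sub>0\<close> times the conjugate of \<open>u\<^sub>1\<close> a pure quaternion that yields a zero of \<open>G\<^sub>d\<close>.  Hence the algebra
  over \<open>K\<close> is a division algebra iff \<open>G\<^sub>d\<close> is anisotropic (\<open>division_algebra_iff_quaternary\<close>).

  The form \<open>G\<^sub>d\<close> is anisotropic iff at some prime \<open>l\<close> the Hilbert symbol of \<open>p\<close> and \<open>q\<close> is \<open>-1\<close> and \<open>d\<close> is
  an \<open>l\<close>-adic square, that is, iff some prime at which the rational algebra ramifies splits in \<open>K\<close>
  (\<open>quaternary_isotropic_iff\<close>).  One direction is an \<open>l\<close>-adic descent.  For the other, the task is to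
  find an integer \<open>a > 0\<close> for which the conics \<open>x\<^sup>2 = p y\<^sup>2 + q a z\<^sup>2\<close> and \<open>u\<^sup>2 = p d v\<^sup>2 + a w\<^sup>2\<close> both have
  rational points; these two points combine to a zero of \<open>G\<^sub>d\<close>.  At each prime of a finite set \<open>T\<close> the local
  condition on \<open>a\<close> can be met because the Hilbert symbol is nondegenerate, and \<open>a\<close> is then chosen as a
  product of primes of \<open>T\<close> with one further prime \<open>r\<close> with prescribed quadratic residue symbols.  The
  product formula settles the symbols at \<open>r\<close>, and Legendre's theorem produces the points.

  The prime \<open>r\<close> exists by Dirichlet's argument (\<open>exists_prime_with_character_values\<close>), restricted to real
  characters, for which \<open>L(1) \<noteq> 0\<close> has a short proof by Lambert series due to Monsky (\<open>L_one_nonzero\<close>).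

  The discriminant of \<open>K\<close> is \<open>d\<close> or \<open>4 d\<close>, so its Legendre symbol at an odd prime is that of \<open>d\<close>, and
  evaluating the Hilbert symbols of \<open>p\<close> and \<open>q\<close> turns the local criterion into the three conditions.
\<close>

section \<open>Summation by parts and divisor sums\<close>

lemma abel_bound:
  fixes f g :: "nat \<Rightarrow> real"
  assumes B: "\<And>N. \<bar>\<Sum>n=m..<N. f n\<bar> \<le> B"
    and dec: "\<And>n. m \<le> n \<Longrightarrow> g (Suc n) \<le> g n"
    and nn: "\<And>n. m \<le> n \<Longrightarrow> 0 \<le> g n"
  shows "\<bar>\<Sum>n=m..<N. f n * g n\<bar> \<le> B * g m"
proof (cases "m \<le> N")
  case True
  define F where "F = (\<lambda>N. \<Sum>n=m..<N. f n)"
  have eq: "(\<Sum>n=m..<N. f n * g n) = F N * g N + (\<Sum>n=m..<N. F (Suc n) * (g n - g (Suc n)))"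
    using True
  proof (induction N rule: dec_induct)
    case (step n)
    then show ?case by (simp add: F_def algebra_simps)
  qed (simp add: F_def)
  have FB: "\<bar>F n\<bar> \<le> B" for n using B by (simp add: F_def)
  have B0: "0 \<le> B" using B[of m] by simp
  have tel: "(\<Sum>n=m..<N. B * (g n - g (Suc n))) = B * g m - B * g N"
    using True by (induction N rule: dec_induct) (auto simp: algebra_simps)
  have "\<bar>\<Sum>n=m..<N. f n * g n\<bar> \<le> \<bar>F N * g N\<bar> + (\<Sum>n=m..<N. \<bar>F (Suc n) * (g n - g (Suc n))\<bar>)"
    unfolding eq by (rule order.trans[OF abs_triangle_ineq]) (simp add: sum_abs)
  also have "\<dots> \<le> B * g N + (\<Sum>n=m..<N. B * (g n - g (Suc n)))"
    using FB B0 nn[OF True] dec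
    by (intro add_mono sum_mono) (auto simp: abs_mult intro!: mult_mono)
  finally show ?thesis using tel by simp
next
  case False
  have "0 \<le> B" using B[of m] by simp
  then show ?thesis using False nn[of m] by simp
qed

text \<open>
  The tails are controlled by \<open>g m\<close> alone.  For Dirichlet series this is uniform in the exponent and
  makes L-series continuous at \<open>1\<close> from the right.
\<close>
lemma dirichlet_test_tail:
  fixes f g :: "nat \<Rightarrow> real"
  assumes B: "\<And>m N. \<bar>\<Sum>n=m..<N. f n\<bar> \<le> B"
    and dec: "\<And>n. k \<le> n \<Longrightarrow> g (Suc n) \<le> g n"
    and lim: "g \<longlonglongrightarrow> 0"
  shows "summable (\<lambda>n. f n * g n)"
    and "k \<le> m \<Longrightarrow> \<bar>(\<Sum>n. f n * g n) - (\<Sum>n<m. f n * g n)\<bar> \<le> B * g m"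
proof -
  have nn: "0 \<le> g n" if "k \<le> n" for n
  proof (rule LIMSEQ_le_const2[OF lim])
    have "g j \<le> g n" if "n \<le> j" for j
      using that \<open>k \<le> n\<close> by (induction j rule: dec_induct) (auto intro: order.trans[OF dec])
    then show "\<exists>N. \<forall>j\<ge>N. g j \<le> g n" by blast
  qed
  have bd: "\<bar>\<Sum>n=m..<N. f n * g n\<bar> \<le> B * g m" if "k \<le> m" for m N
    using that by (intro abel_bound B dec nn) auto
  show sm: "summable (\<lambda>n. f n * g n)"
    unfolding summable_Cauchy
  proof (intro allI impI)
    fix e :: real assume "0 < e"
    have "(\<lambda>m. B * g m) \<longlonglongrightarrow> B * 0" by (intro tendsto_intros lim)
    then have "eventually (\<lambda>m. B * g m < e) sequentially"
      using \<open>0 < e\<close> by (auto elim: order_tendstoD)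
    then obtain N where N: "\<And>m. m \<ge> N \<Longrightarrow> B * g m < e"
      by (auto simp: eventually_sequentially)
    show "\<exists>N. \<forall>m\<ge>N. \<forall>n. norm (\<Sum>i=m..<n. f i * g i) < e"
    proof (intro exI[of _ "max N k"] allI impI)
      fix m n assume "m \<ge> max N k"
      then show "norm (\<Sum>i=m..<n. f i * g i) < e"
        using N[of m] bd[of m n] by simp
    qed
  qed
  assume km: "k \<le> m"
  have "(\<lambda>N. (\<Sum>n<N. f n * g n) - (\<Sum>n<m. f n * g n)) \<longlonglongrightarrow>
          (\<Sum>n. f n * g n) - (\<Sum>n<m. f n * g n)"
    using summable_LIMSEQ[OF sm] by (intro tendsto_intros)
  moreover have "(\<Sum>n<N. f n * g n) - (\<Sum>n<m. f n * g n) = (\<Sum>n=m..<N. f n * g n)" if "m \<le> N" for N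
    using that by (simp add: lessThan_atLeast0 sum_diff_nat_ivl)
  ultimately have "(\<lambda>N. \<Sum>n=m..<N. f n * g n) \<longlonglongrightarrow> (\<Sum>n. f n * g n) - (\<Sum>n<m. f n * g n)"
    by (rule Lim_transform_eventually[OF _ eventually_sequentiallyI[of m]])
  then have "(\<lambda>N. \<bar>\<Sum>n=m..<N. f n * g n\<bar>) \<longlonglongrightarrow> \<bar>(\<Sum>n. f n * g n) - (\<Sum>n<m. f n * g n)\<bar>"
    by (rule tendsto_rabs)
  then show "\<bar>(\<Sum>n. f n * g n) - (\<Sum>n<m. f n * g n)\<bar> \<le> B * g m"
    by (rule LIMSEQ_le_const2) (use bd[OF km] in blast)
qed

text \<open>
  Both the Lambert series below and the product of two Dirichlet series are double sums regrouped
  along the hyperbolas \<open>a b = n\<close>.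
\<close>
lemma has_sum_divisors:
  fixes F :: "nat \<Rightarrow> nat \<Rightarrow> real"
  assumes "((\<lambda>(a, b). F a b) has_sum S) ({1..} \<times> {1..})"
  shows "((\<lambda>n. \<Sum>k | k dvd n. F k (n div k)) has_sum S) {1..}"
proof -
  have bij: "bij_betw (\<lambda>(n, k). (k, n div k)) (SIGMA n:{1..}. {k. k dvd n}) ({1..} \<times> {1..} :: (nat \<times> nat) set)"
  proof (rule bij_betwI[where g = "\<lambda>(a, b). (a * b, a)"], goal_cases)
    case 1
    show ?case by (auto simp: Suc_le_eq dvd_pos_nat div_greater_zero_iff dvd_imp_le)
  next
    case 2
    show ?case by auto
  next
    case (3 z)
    then show ?case by auto
  next
    case (4 z)
    then show ?case by auto
  qed
  have "((\<lambda>(n, k). F k (n div k)) has_sum S) (SIGMA n:{1..}. {k. k dvd n})"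
    using assms has_sum_reindex_bij_betw[OF bij, of "\<lambda>(a, b). F a b" S]
    by (simp add: case_prod_unfold)
  then show ?thesis
    by (rule has_sum_SigmaD) (auto intro!: has_sum_finiteI finite_divisors_nat)
qed

lemma abs_summable_on_times:
  fixes f g :: "'a \<Rightarrow> real"
  assumes "f abs_summable_on A" "g abs_summable_on B"
  shows "(\<lambda>(a, b). f a * g b) abs_summable_on A \<times> B"
  unfolding abs_summable_on_Sigma_iff using assms
  by (auto simp: abs_mult infsum_cmult_right' intro!: summable_on_cmult_right summable_on_cmult_left)

lemma has_sum_times:
  fixes f g :: "'a \<Rightarrow> real"
  assumes "f abs_summable_on A" "g abs_summable_on B"
  shows "((\<lambda>(a, b). f a * g b) has_sum (infsum f A * infsum g B)) (A \<times> B)"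
proof -
  have fs: "f summable_on A" "g summable_on B"
    using assms by (auto intro: abs_summable_summable)
  have "(\<lambda>(a, b). f a * g b) summable_on A \<times> B"
    using abs_summable_on_times[OF assms] by (rule abs_summable_summable)
  then have S: "((\<lambda>(a, b). f a * g b) has_sum (infsum (\<lambda>(a, b). f a * g b) (A \<times> B))) (A \<times> B)"
    by (rule has_sum_infsum)
  have "((\<lambda>a. f a * infsum g B) has_sum (infsum (\<lambda>(a, b). f a * g b) (A \<times> B))) A"
    by (rule has_sum_SigmaD[OF S]) (auto intro!: has_sum_cmult_right has_sum_infsum fs)
  moreover have "((\<lambda>a. f a * infsum g B) has_sum (infsum f A * infsum g B)) A"
    by (intro has_sum_cmult_left has_sum_infsum fs)
  ultimately show ?thesis using S has_sum_unique by metis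
qed

lemma has_sum_from_1_imp_sums:
  fixes f :: "nat \<Rightarrow> real"
  assumes "(f has_sum S) {1..}" "f 0 = 0"
  shows "f sums S"
proof (rule has_sum_imp_sums)
  show "(f has_sum S) UNIV"
    using assms by (subst has_sum_cong_neutral[of "{1..}" _ f f]) (auto simp: Suc_le_eq)
qed

section \<open>Real characters and the non-vanishing of \<open>L(1)\<close>\<close>

locale real_character =
  fixes M :: nat and \<psi> :: "nat \<Rightarrow> real"
  assumes M_gt_1: "M > 1"
    and mult: "\<psi> (m * n) = \<psi> m * \<psi> n"
    and periodic: "\<psi> (n + M) = \<psi> n"
    and zero_iff: "\<psi> n = 0 \<longleftrightarrow> \<not> coprime n M"
    and vals: "\<psi> n \<in> {-1, 0, 1}"
begin

lemma chi_0 [simp]: "\<psi> 0 = 0"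
  using M_gt_1 by (simp add: zero_iff)

lemma chi_1 [simp]: "\<psi> (Suc 0) = 1"
proof -
  have "\<psi> 1 * \<psi> 1 = \<psi> 1" using mult[of 1 1] by simp
  moreover have "\<psi> 1 \<noteq> 0" by (simp add: zero_iff)
  ultimately show ?thesis by simp
qed

lemma chi_power: "\<psi> (n ^ k) = \<psi> n ^ k"
  by (induction k) (auto simp: mult)

lemma abs_le_1: "\<bar>\<psi> n\<bar> \<le> 1"
  using vals[of n] by auto

lemma chi_mod: "\<psi> (n mod M) = \<psi> n"
proof -
  have "\<psi> (a + M * k) = \<psi> a" for a k
  proof (induction k)
    case (Suc k)
    have "\<psi> (a + M * Suc k) = \<psi> ((a + M * k) + M)" by (simp add: algebra_simps)
    then show ?case using Suc by (simp only: periodic)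
  qed simp
  from this[of "n mod M" "n div M"] show ?thesis by simp
qed

definition divisor_sum :: "nat \<Rightarrow> real" where
  "divisor_sum n = (\<Sum>k | k dvd n. \<psi> k)"

lemma divisor_sum_coprime:
  assumes "coprime a b" "a > 0" "b > 0"
  shows "divisor_sum (a * b) = divisor_sum a * divisor_sum b"
proof -
  have bij: "bij_betw (\<lambda>(x, y). x * y) ({k. k dvd a} \<times> {k. k dvd b}) {k. k dvd a * b}"
  proof (rule bij_betwI[where g = "\<lambda>k. (gcd k a, gcd k b)"])
    show "(\<lambda>k. (gcd k a, gcd k b)) \<in> {k. k dvd a * b} \<rightarrow> {k. k dvd a} \<times> {k. k dvd b}" by auto
  next
    fix z assume "z \<in> {k. k dvd a} \<times> {k. k dvd b}"
    then obtain x y where [simp]: "z = (x, y)" and x: "x dvd a" and y: "y dvd b" by auto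
    have "coprime x b" "coprime y a"
      using assms(1) x y by (meson coprime_commute coprime_divisors dvd_refl)+
    then have "gcd (x * y) a = gcd x a" "gcd (x * y) b = gcd y b"
      by (simp_all add: gcd_mult_left_right_cancel gcd_mult_left_left_cancel coprime_commute)
    then show "(\<lambda>k. (gcd k a, gcd k b)) ((\<lambda>(x, y). x * y) z) = z"
      using x y by (simp add: gcd_nat.absorb1)
  next
    fix k assume "k \<in> {k. k dvd a * b}"
    then have k: "k dvd a * b" by simp
    then obtain x y where xy: "k = x * y" and x: "x dvd a" and y: "y dvd b"
      using division_decomp by metis
    have "coprime x b" "coprime y a"
      using assms(1) x y by (meson coprime_commute coprime_divisors dvd_refl)+
    then have "gcd (x * y) a = gcd x a" "gcd (x * y) b = gcd y b"
      by (simp_all add: gcd_mult_left_right_cancel gcd_mult_left_left_cancel coprime_commute)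
    then show "(\<lambda>(x, y). x * y) (gcd k a, gcd k b) = k"
      using x y xy by (simp add: gcd_nat.absorb1)
  qed (auto intro: mult_dvd_mono)
  have "divisor_sum (a * b) = (\<Sum>z\<in>{k. k dvd a} \<times> {k. k dvd b}. \<psi> (fst z * snd z))"
    unfolding divisor_sum_def using sum.reindex_bij_betw[OF bij, of \<psi>]
    by (simp add: case_prod_unfold)
  also have "\<dots> = divisor_sum a * divisor_sum b"
    unfolding divisor_sum_def sum_product sum.cartesian_product by (simp add: mult case_prod_unfold)
  finally show ?thesis .
qed

lemma divisor_sum_prime_power:
  assumes "prime p"
  shows "divisor_sum (p ^ k) = (\<Sum>i\<le>k. \<psi> p ^ i)"
proof -
  have "{d. d dvd p ^ k} = (\<lambda>i. p ^ i) ` {..k}"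
    using assms by (auto simp: divides_primepow_nat)
  moreover have "inj_on (\<lambda>i. p ^ i) {..k}"
    using prime_gt_1_nat[OF assms] by (auto intro: inj_onI)
  ultimately show ?thesis
    unfolding divisor_sum_def by (simp add: sum.reindex chi_power)
qed

lemma divisor_sum_prime_power_ge:
  assumes "prime p"
  shows "divisor_sum (p ^ k) \<ge> 0" and "even k \<Longrightarrow> divisor_sum (p ^ k) \<ge> 1"
proof -
  have *: "(\<Sum>i\<le>k. (-1::real) ^ i) = (if even k then 1 else 0)" for k
    by (induction k) auto
  have **: "(\<Sum>i\<le>k. (0::real) ^ i) = 1" for k
    by (induction k) auto
  have "\<psi> p \<in> {-1, 0, 1}" by (rule vals)
  then show "divisor_sum (p ^ k) \<ge> 0" "even k \<Longrightarrow> divisor_sum (p ^ k) \<ge> 1"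
    using assms by (auto simp: divisor_sum_prime_power * **)
qed

lemma divisor_sum_nonneg: "n > 0 \<Longrightarrow> divisor_sum n \<ge> 0"
proof (induction n rule: less_induct)
  case (less n)
  show ?case
  proof (cases "n = 1")
    case True
    then show ?thesis by (simp add: divisor_sum_def)
  next
    case False
    then obtain p where p: "prime p" "p dvd n" using prime_factor_nat by blast
    then obtain m where m: "n = p ^ multiplicity p n * m" "\<not> p dvd m"
      using less.prems multiplicity_decompose'[of n p] by (metis bot_nat_0.not_eq_extremum not_prime_unit)
    then obtain k where k: "n = p ^ k * m" by blast
    have "k > 0" using k p m(2) by (cases k) auto
    have "m > 0" using k less.prems by (cases m) auto
    have "p ^ k > 1" using prime_gt_1_nat[OF p(1)] \<open>k > 0\<close> by (metis one_less_power)
    then have "m < n" using \<open>m > 0\<close> by (simp add: k)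
    moreover have "coprime (p ^ k) m" using p m(2) by (simp add: prime_imp_coprime)
    ultimately have "divisor_sum n = divisor_sum (p ^ k) * divisor_sum m"
      unfolding k using divisor_sum_coprime[of "p ^ k" m] \<open>m > 0\<close> prime_gt_0_nat[OF p(1)] by simp
    then show ?thesis
      using less.IH[OF \<open>m < n\<close> \<open>m > 0\<close>] divisor_sum_prime_power_ge(1)[OF p(1), of k] by simp
  qed
qed

text \<open>
  At an even power of a prime the sum \<open>1 + \<psi> p + \<psi> p\<^sup>2 + \<dots>\<close> has an odd number of terms, so it is at
  least \<open>1\<close> even if \<open>\<psi> p = -1\<close>; the rest is multiplicativity.
\<close>
lemma divisor_sum_square: "n > 0 \<Longrightarrow> divisor_sum (n\<^sup>2) \<ge> 1"
proof (induction n rule: less_induct)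
  case (less n)
  show ?case
  proof (cases "n = 1")
    case True
    then show ?thesis by (simp add: divisor_sum_def)
  next
    case False
    then obtain p where p: "prime p" "p dvd n" using prime_factor_nat by blast
    then obtain m where m: "n = p ^ multiplicity p n * m" "\<not> p dvd m"
      using less.prems multiplicity_decompose'[of n p] by (metis bot_nat_0.not_eq_extremum not_prime_unit)
    then obtain k where k: "n = p ^ k * m" by blast
    have "k > 0" using k p m(2) by (cases k) auto
    have "m > 0" using k less.prems by (cases m) auto
    have "p ^ k > 1" using prime_gt_1_nat[OF p(1)] \<open>k > 0\<close> by (metis one_less_power)
    then have "m < n" using \<open>m > 0\<close> by (simp add: k)
    have "n\<^sup>2 = (p ^ k * m)\<^sup>2" by (simp only: k)
    then have n2: "n\<^sup>2 = p ^ (2 * k) * m\<^sup>2" by (simp add: power_mult_distrib mult.commute flip: power_mult)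
    have "coprime (p ^ (2 * k)) (m\<^sup>2)" using p m(2) by (simp add: prime_imp_coprime)
    then have "divisor_sum (n\<^sup>2) = divisor_sum (p ^ (2 * k)) * divisor_sum (m\<^sup>2)"
      unfolding n2 using \<open>m > 0\<close> p(1) by (intro divisor_sum_coprime) (auto simp: prime_gt_0_nat)
    moreover have "divisor_sum (m\<^sup>2) \<ge> 1" using less.IH \<open>m < n\<close> \<open>m > 0\<close> by simp
    moreover have "divisor_sum (p ^ (2 * k)) \<ge> 1" using divisor_sum_prime_power_ge(2)[OF p(1)] by simp
    ultimately show ?thesis using mult_mono[of 1 "divisor_sum (p ^ (2 * k))" 1 "divisor_sum (m\<^sup>2)"] by simp
  qed
qed


text \<open>
  Multiplication by \<open>a\<close> permutes the residues modulo \<open>M\<close> and changes the sign of the sum over a period,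
  which therefore vanishes.
\<close>
lemma partial_sum_bound:
  assumes "\<psi> a = -1"
  shows "\<bar>\<Sum>n=m..<N. \<psi> n\<bar> \<le> 2 * real M"
proof -
  define S where "S = (\<lambda>N. \<Sum>n<N. \<psi> n)"
  have "coprime a M" using assms zero_iff[of a] by auto
  have inj: "inj_on (\<lambda>n. a * n mod M) {..<M}"
  proof (rule inj_onI)
    fix x y assume xy: "x \<in> {..<M}" "y \<in> {..<M}" "a * x mod M = a * y mod M"
    then have "[a * x = a * y] (mod M)" by (simp add: cong_def)
    then have "[x = y] (mod M)" using \<open>coprime a M\<close> by (simp add: cong_mult_lcancel_nat)
    then show "x = y" using xy by (simp add: cong_def)
  qed
  have img: "(\<lambda>n. a * n mod M) ` {..<M} = {..<M}"
    using M_gt_1 by (intro endo_inj_surj inj) auto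
  have "S M = (\<Sum>n<M. \<psi> (a * n mod M))"
    unfolding S_def by (subst img[symmetric], subst sum.reindex[OF inj]) simp
  also have "\<dots> = - S M" by (simp add: chi_mod mult assms S_def sum_negf)
  finally have SM: "S M = 0" by simp
  have Sp: "S (N + M) = S N" for N
  proof (induction N)
    case (Suc N)
    then show ?case using periodic[of N] by (simp add: S_def)
  qed (use SM in \<open>simp add: S_def\<close>)
  have Smod: "S (N mod M) = S N" for N
  proof -
    have "S (b + M * k) = S b" for b k
    proof (induction k)
      case (Suc k)
      have "S (b + M * Suc k) = S ((b + M * k) + M)" by (simp add: algebra_simps)
      then show ?case using Suc by (simp only: Sp)
    qed simp
    from this[of "N mod M" "N div M"] show ?thesis by simp
  qed
  have Sb: "\<bar>S N\<bar> \<le> real M" for N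
  proof -
    have "\<bar>S (N mod M)\<bar> \<le> (\<Sum>n<N mod M. \<bar>\<psi> n\<bar>)" unfolding S_def by (rule sum_abs)
    also have "\<dots> \<le> (\<Sum>n<N mod M. 1)" by (intro sum_mono abs_le_1)
    also have "\<dots> \<le> real M" using M_gt_1 by simp
    finally show ?thesis using Smod by simp
  qed
  show ?thesis
  proof (cases "m \<le> N")
    case True
    then have "(\<Sum>n=m..<N. \<psi> n) = S N - S m"
      by (simp add: S_def lessThan_atLeast0 sum_diff_nat_ivl)
    then show ?thesis using Sb[of N] Sb[of m] by linarith
  qed simp
qed

text \<open>
  Expanding each fraction geometrically gives the power series of the divisor sums of \<open>\<psi>\<close>.  Its
  coefficients are nonnegative and at least \<open>1\<close> at squares, so near \<open>t = 1\<close> the sum exceeds any bound.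
\<close>
lemma lambert_series:
  assumes t: "0 < t" "t < 1"
  obtains S where "(\<lambda>n. \<psi> n * (t ^ n / (1 - t ^ n))) sums S" "\<And>V. (\<Sum>x=1..V. t ^ x\<^sup>2) \<le> S"
proof -
  have geo: "(\<lambda>n. t ^ n) abs_summable_on {1..}"
    using has_sum_geometric_from_1[of t] t by (auto simp: summable_on_def)
  have "(\<lambda>(a, b). t ^ a * (t ^ b)) abs_summable_on {1..} \<times> {1..}"
    by (rule abs_summable_on_times[OF geo geo])
  then have "(\<lambda>z. (1 / t) * ((\<lambda>(a, b). t ^ a * (t ^ b)) z)) abs_summable_on {1..} \<times> {1..}"
    by (simp only: norm_mult) (rule summable_on_cmult_right)
  then have "(\<lambda>(a, b). \<psi> a * t ^ (a * b)) abs_summable_on {1..} \<times> {1..}"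
  proof (rule abs_summable_on_comparison_test)
    fix z :: "nat \<times> nat" assume "z \<in> {1..} \<times> {1..}"
    then obtain a b where z: "z = (a, b)" "1 \<le> a" "1 \<le> b" by auto
    then obtain a' b' where ab: "a = Suc a'" "b = Suc b'" by (metis Suc_le_D One_nat_def)
    have "\<bar>\<psi> a\<bar> * t ^ (a * b) \<le> 1 * t ^ (a + b - 1)"
      using t by (intro mult_mono power_decreasing abs_le_1) (auto simp: ab)
    also have "\<dots> = 1 / t * (t ^ a * t ^ b)" using t by (simp add: ab power_add)
    finally show "norm (case z of (a, b) \<Rightarrow> \<psi> a * t ^ (a * b)) \<le>
        norm (1 / t * (case z of (a, b) \<Rightarrow> t ^ a * t ^ b))"
      using t by (simp add: z abs_mult)
  qed
  then have "(\<lambda>(a, b). \<psi> a * t ^ (a * b)) summable_on {1..} \<times> {1..}"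
    by (rule abs_summable_summable)
  then obtain S where S: "((\<lambda>(a, b). \<psi> a * t ^ (a * b)) has_sum S) ({1..} \<times> {1..})"
    by (auto simp: summable_on_def)
  show ?thesis
  proof (rule that)
    have "((\<lambda>a. \<psi> a * (t ^ a / (1 - t ^ a))) has_sum S) {1..}"
    proof (rule has_sum_SigmaD[OF S])
      fix a :: nat assume "a \<in> {1..}"
      then have "t ^ a < 1" "0 < t ^ a" using t by (auto simp: power_less_one_iff)
      then have "((\<lambda>b. (t ^ a) ^ b) has_sum (t ^ a / (1 - t ^ a))) {1..}"
        using has_sum_geometric_from_1[of "t ^ a"] by simp
      then show "((\<lambda>b. case (a, b) of (a, b) \<Rightarrow> \<psi> a * t ^ (a * b)) has_sum
          \<psi> a * (t ^ a / (1 - t ^ a))) {1..}"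
        using has_sum_cmult_right[of _ _ _ "\<psi> a"] by (fastforce simp: power_mult)
    qed
    then show "(\<lambda>n. \<psi> n * (t ^ n / (1 - t ^ n))) sums S"
      by (rule has_sum_from_1_imp_sums) simp
  next
    fix V
    have "((\<lambda>n. \<Sum>k | k dvd n. \<psi> k * t ^ (k * (n div k))) has_sum S) {1..}"
      by (rule has_sum_divisors[OF S])
    then have D: "((\<lambda>n. divisor_sum n * t ^ n) has_sum S) {1..}"
      by (rule has_sum_cong[THEN iffD1, rotated]) (auto simp: divisor_sum_def sum_distrib_right intro!: sum.cong)
    have inj: "inj_on (\<lambda>x::nat. x\<^sup>2) {1..V}" by (auto intro: inj_onI)
    have "(\<Sum>x=1..V. t ^ x\<^sup>2) \<le> (\<Sum>x=1..V. divisor_sum (x\<^sup>2) * t ^ x\<^sup>2)"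
    proof (rule sum_mono)
      fix x assume "x \<in> {1..V}"
      then show "t ^ x\<^sup>2 \<le> divisor_sum (x\<^sup>2) * t ^ x\<^sup>2"
        using mult_right_mono[OF divisor_sum_square[of x], of "t ^ x\<^sup>2"] t by simp
    qed
    also have "\<dots> = (\<Sum>n\<in>(\<lambda>x. x\<^sup>2) ` {1..V}. divisor_sum n * t ^ n)"
      by (subst sum.reindex[OF inj]) simp
    also have "\<dots> \<le> S"
      using t by (intro has_sum_mono_neutral[OF has_sum_finite D])
        (auto intro!: mult_nonneg_nonneg divisor_sum_nonneg)
    finally show "(\<Sum>x=1..V. t ^ x\<^sup>2) \<le> S" .
  qed
qed

text \<open>
  After clearing \<open>1 - t\<close> this says \<open>n (n + 1) t\<^sup>n \<le> (1 + \<dots> + t\<^sup>n\<^sup>-\<^sup>1) (1 + \<dots> + t\<^sup>n)\<close>, which is the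
  inequality of arithmetic and geometric means for both factors.  The square root \<open>u\<close> of \<open>t\<close> avoids
  half-integral powers of \<open>t\<close>.
\<close>
lemma lambert_kernel_mono:
  fixes t :: real
  assumes t: "0 < t" "t < 1" and n: "n \<ge> 1"
  defines "b \<equiv> \<lambda>n. 1 / (real n * (1 - t)) - t ^ n / (1 - t ^ n)"
  shows "b (Suc n) \<le> b n"
proof -
  define u where "u = sqrt t"
  have u: "0 < u" "u < 1" "t = u\<^sup>2" using t by (auto simp: u_def)
  define S where "S = (\<lambda>n. \<Sum>i<n. t ^ i)"
  have Sge: "real n * u ^ (n - 1) \<le> S n" for n
  proof -
    have "2 * S n = (\<Sum>i<n. t ^ i) + (\<Sum>i<n. t ^ (n - Suc i))"
      unfolding S_def by (simp add: sum.nat_diff_reindex)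
    also have "\<dots> = (\<Sum>i<n. t ^ i + t ^ (n - Suc i))" by (simp add: sum.distrib)
    also have "\<dots> \<ge> (\<Sum>i<n. 2 * u ^ (n - 1))"
    proof (rule sum_mono)
      fix i assume "i \<in> {..<n}"
      then have *: "n - 1 = i + (n - Suc i)" by auto
      have "0 \<le> (u ^ i - u ^ (n - Suc i))\<^sup>2" by simp
      then show "2 * u ^ (n - 1) \<le> t ^ i + t ^ (n - Suc i)"
        unfolding * power_add u(3) by (simp add: power2_diff algebra_simps flip: power_mult)
    qed
    finally show ?thesis by simp
  qed
  have S1: "1 - t ^ n = (1 - t) * S n" for n
    unfolding S_def by (rule one_diff_power_eq)
  have Spos: "S n > 0" if "n \<ge> 1" for n
    unfolding S_def using that t by (intro sum_pos) (auto simp: lessThan_empty_iff)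
  have "real n * real (Suc n) * t ^ n \<le> (real n * u ^ (n - 1)) * (real (Suc n) * u ^ n)"
  proof -
    have "t ^ n = u ^ (n + n)" by (simp add: u(3) mult_2 flip: power_mult)
    also have "\<dots> \<le> u ^ (n - 1 + n)" using u by (intro power_decreasing) auto
    finally have "real n * real (Suc n) * t ^ n \<le> real n * real (Suc n) * (u ^ (n - 1 + n))"
      by (intro mult_left_mono) auto
    then show ?thesis by (simp add: power_add algebra_simps)
  qed
  also have "\<dots> \<le> S n * S (Suc n)"
    using Sge[of n] Sge[of "Suc n"] u Spos[OF n] by (intro mult_mono) auto
  finally have key: "real n * real (Suc n) * t ^ n \<le> S n * S (Suc n)" .
  have "(1 - t) * (b n - b (Suc n)) = 1 / (real n * real (Suc n)) - t ^ n / (S n * S (Suc n))"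
  proof -
    have e1: "(1 - t) * b k = 1 / real k - t ^ k / S k" if "k \<ge> 1" for k
    proof -
      define c where "c = 1 - t"
      have "c \<noteq> 0" using t by (simp add: c_def)
      then show ?thesis
        using Spos[OF that] that unfolding b_def S1 c_def[symmetric] by (simp add: right_diff_distrib)
    qed
    have e2: "1 / real n - 1 / real (Suc n) = 1 / (real n * real (Suc n))"
      using n by (simp add: field_simps)
    have "t ^ n * S (Suc n) - t ^ Suc n * S n = t ^ n * (S (Suc n) - t * S n)" by (simp add: algebra_simps)
    also have "S (Suc n) - t * S n = 1"
      unfolding S_def sum.lessThan_Suc_shift by (simp add: sum_distrib_left)
    finally have e3: "t ^ n / S n - t ^ Suc n / S (Suc n) = t ^ n / (S n * S (Suc n))"
      using Spos[OF n] Spos[of "Suc n"] by (simp add: field_simps)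
    show ?thesis using e1[OF n] e1[of "Suc n"] e2 e3 by (simp add: right_diff_distrib)
  qed
  also have "\<dots> \<ge> 0"
  proof -
    have "t ^ n * (real n * real (Suc n)) \<le> 1 * (S n * S (Suc n))" using key by (simp add: algebra_simps)
    then show ?thesis using n Spos[OF n] Spos[of "Suc n"] by (simp add: divide_le_eq le_divide_eq)
  qed
  finally show ?thesis using t by (simp add: zero_le_mult_iff)
qed

text \<open>
  If \<open>L(1)\<close> vanished, the Lambert series at \<open>t\<close> would be minus the sum of \<open>\<psi> n\<close> against the kernel
  \<open>1 / (n (1 - t)) - t\<^sup>n / (1 - t\<^sup>n)\<close>.  The kernel decreases in \<open>n\<close> from the value \<open>1\<close>, so summation by
  parts would bound the series independently of \<open>t\<close>, against the preceding lower bound.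
\<close>
theorem L_one_nonzero:
  assumes "\<psi> a = -1"
  shows "(\<Sum>n. \<psi> n * (1 / real n)) \<noteq> 0"
proof
  assume L0: "(\<Sum>n. \<psi> n * (1 / real n)) = 0"
  have "(\<lambda>n. 1 / real n) \<longlonglongrightarrow> 0" by (rule lim_1_over_n)
  then have sm: "summable (\<lambda>n. \<psi> n * (1 / real n))"
    by (intro dirichlet_test_tail(1)[where B = "2 * real M" and k = 1] partial_sum_bound[OF assms])
       (auto simp: field_simps)
  then have L: "(\<lambda>n. \<psi> n * (1 / real n)) sums 0" using L0 by (simp add: sums_iff)
  have bound: "(\<Sum>x=1..V. t ^ x\<^sup>2) \<le> 2 * real M" if t: "0 < t" "t < 1" for t V
  proof -
    obtain S where S: "(\<lambda>n. \<psi> n * (t ^ n / (1 - t ^ n))) sums S" "\<And>V. (\<Sum>x=1..V. t ^ x\<^sup>2) \<le> S"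
      using lambert_series[OF t] by blast
    define b where "b = (\<lambda>n. 1 / (real n * (1 - t)) - t ^ n / (1 - t ^ n))"
    have "(\<lambda>n. \<psi> n * (1 / real n) * (1 / (1 - t)) - \<psi> n * (t ^ n / (1 - t ^ n))) sums (0 * (1 / (1 - t)) - S)"
      by (intro sums_diff sums_mult2 L S)
    then have bs: "(\<lambda>n. \<psi> n * b n) sums (- S)"
      by (simp add: b_def algebra_simps)
    have b_nonneg: "b n \<ge> 0" if "1 \<le> n" for n
    proof -
      have "real n * t ^ n = (\<Sum>i<n. t ^ n)" by simp
      also have "\<dots> \<le> (\<Sum>i<n. t ^ i)" using t by (intro sum_mono power_decreasing) auto
      finally have "(1 - t) * (real n * t ^ n) \<le> (1 - t) * (\<Sum>i<n. t ^ i)" using t by (intro mult_left_mono) auto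
      then have *: "(1 - t) * (real n * t ^ n) \<le> 1 - t ^ n" by (simp add: one_diff_power_eq)
      have "t ^ n < 1" using t that by (auto simp: power_less_one_iff)
      then show ?thesis using * t that by (simp add: b_def divide_le_eq le_divide_eq algebra_simps)
    qed
    have "\<bar>\<Sum>n=1..<N. \<psi> n * b n\<bar> \<le> 2 * real M * b 1" for N
      using partial_sum_bound[OF assms] b_nonneg lambert_kernel_mono[OF t]
      by (intro abel_bound) (auto simp: b_def)
    moreover have "b 1 = 1" using t by (simp add: b_def field_simps)
    moreover have "(\<Sum>n=1..<N. \<psi> n * b n) = (\<Sum>n<N. \<psi> n * b n)" for N
      by (rule sum.mono_neutral_left) (auto simp: not_less_eq_eq)
    ultimately have "\<bar>\<Sum>n<N. \<psi> n * b n\<bar> \<le> 2 * real M" for N by simp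
    moreover have "(\<lambda>N. \<bar>\<Sum>n<N. \<psi> n * b n\<bar>) \<longlonglongrightarrow> \<bar>- S\<bar>"
      using bs unfolding sums_def by (rule tendsto_rabs)
    ultimately have "\<bar>- S\<bar> \<le> 2 * real M" by (intro LIMSEQ_le_const2) auto
    then show ?thesis using S(2)[of V] by linarith
  qed
  \<comment> \<open>For \<open>t\<close> so close to \<open>1\<close> that all \<open>V\<close> terms are at least \<open>1 / 2\<close>, the sum exceeds \<open>2 M\<close>.\<close>
  define V where "V = 4 * M + 2"
  define t where "t = root (V\<^sup>2) (1 / 2)"
  have V: "V\<^sup>2 > 0" by (simp add: V_def)
  have t: "0 < t" "t < 1" "t ^ V\<^sup>2 = 1 / 2"
    using V by (auto simp: t_def)
  have "real V * (1 / 2) = (\<Sum>x=1..V. t ^ V\<^sup>2)" by (simp add: t)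
  also have "\<dots> \<le> (\<Sum>x=1..V. t ^ x\<^sup>2)"
    using t by (intro sum_mono power_decreasing) (auto intro: power_mono)
  also have "\<dots> \<le> 2 * real M" by (rule bound[OF t(1,2)])
  finally show False by (simp add: V_def)
qed

end

section \<open>Primes with prescribed values of real characters\<close>

lemma summable_on_from_1:
  fixes f :: "nat \<Rightarrow> real"
  assumes "summable f" "\<And>n. 0 \<le> f n"
  shows "f summable_on {1..}"
proof -
  have "f summable_on UNIV" using assms by (simp add: summable_on_UNIV_nonneg_real_iff)
  then show ?thesis by (rule summable_on_subset_banach) simp
qed

lemma powr_summable_on:
  assumes "s > (1::real)"
  shows "(\<lambda>n. real n powr (-s)) summable_on {1..}"
  using assms by (intro summable_on_from_1) (auto simp: summable_real_powr_iff)

lemma ln_powr_summable_on: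
  assumes "s > (1::real)"
  shows "(\<lambda>n. ln (real n) * real n powr (-s)) summable_on {1..}"
proof -
  define e where "e = (s - 1) / 2"
  have e: "e > 0" "s - e > 1" using assms by (auto simp: e_def field_simps)
  have "(\<lambda>n. (1 / e) * real n powr (-(s - e))) summable_on {1..}"
    using e by (intro summable_on_cmult_right powr_summable_on)
  then have "(\<lambda>n. norm (ln (real n) * real n powr (-s))) summable_on {1..}"
  proof (rule abs_summable_on_comparison_test')
    fix n :: nat assume "n \<in> {1..}"
    then have n: "1 \<le> real n" by simp
    have "ln (real n) * real n powr (-s) \<le> (real n powr e / e) * real n powr (-s)"
      using ln_powr_bound[OF n e(1)] by (intro mult_right_mono) auto
    also have "\<dots> = (1 / e) * real n powr (-(s - e))" by (simp flip: powr_add)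
    finally show "norm (ln (real n) * real n powr (-s)) \<le> (1 / e) * real n powr (-(s - e))"
      using n by (simp add: abs_mult)
  qed
  then show ?thesis by (rule abs_summable_summable)
qed

lemma mangoldt_powr_summable_on:
  assumes "s > (1::real)" "\<And>n. \<bar>h n\<bar> \<le> B"
  shows "(\<lambda>n. h n * mangoldt n * real n powr (-s)) abs_summable_on {1..}"
proof -
  have "(\<lambda>n. B * (ln (real n) * real n powr (-s))) summable_on {1..}"
    by (intro summable_on_cmult_right ln_powr_summable_on assms)
  then show ?thesis
  proof (rule abs_summable_on_comparison_test')
    fix n :: nat assume "n \<in> {1..}"
    then have "mangoldt n \<le> ln (real n)" "0 \<le> ln (real n)" by (auto intro: mangoldt_le)
    then have "\<bar>h n\<bar> * (mangoldt n * real n powr (-s)) \<le> B * (ln (real n) * real n powr (-s))"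
      using assms(2)[of n] by (intro mult_mono) (auto intro: mangoldt_nonneg mult_nonneg_nonneg order.trans[OF abs_ge_zero])
    then show "norm (h n * mangoldt n * real n powr (-s)) \<le> B * (ln (real n) * real n powr (-s))"
      by (simp add: abs_mult mult.assoc)
  qed
qed

lemma ln_powr_decreasing:
  assumes "s \<ge> 1" "n \<ge> 3"
  shows "ln (real (Suc n)) * real (Suc n) powr (-s) \<le> ln (real n) * real n powr (-s)"
proof -
  have n: "real n > 0" using assms by simp
  have "exp 1 \<le> real n" using exp_le assms by linarith
  then have ln1: "1 \<le> ln (real n)" using n by (simp add: ln_ge_iff)
  have eq: "real (Suc n) = real n * (1 + 1 / real n)" using n by (simp add: field_simps)
  have pos: "1 + 1 / real n > 0" using n by (intro add_pos_pos) simp_all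
  have "ln (real (Suc n)) = ln (real n) + ln (1 + 1 / real n)"
    unfolding eq using n pos by (rule ln_mult_pos)
  also have "\<dots> \<le> ln (real n) + 1 / real n" using n by (intro add_left_mono ln_add_one_self_le_self) auto
  also have "\<dots> \<le> ln (real n) * (1 + 1 / real n)"
  proof -
    have "1 * (1 / real n) \<le> ln (real n) * (1 / real n)" using ln1 by (intro mult_right_mono) auto
    then show ?thesis by (simp add: algebra_simps)
  qed
  also have "\<dots> \<le> ln (real n) * (1 + 1 / real n) powr s"
    using ln1 n assms powr_mono[of 1 s "1 + 1 / real n"] by (intro mult_left_mono) (auto simp: add_pos_pos)
  finally have "ln (real (Suc n)) * real (Suc n) powr (-s)
      \<le> ln (real n) * ((1 + 1 / real n) powr s * real (Suc n) powr (-s))"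
    by (simp add: mult_right_mono flip: mult.assoc)
  also have "1 + 1 / real n = real (Suc n) / real n" using n by (simp add: field_simps)
  also have "(real (Suc n) / real n) powr s * real (Suc n) powr (-s) = real n powr (-s)"
    using n by (simp add: powr_divide powr_minus field_simps)
  finally show ?thesis .
qed

lemma ln_powr_tendsto_0:
  assumes "s \<ge> (1::real)"
  shows "(\<lambda>n. ln (real n) * real n powr (-s)) \<longlonglongrightarrow> 0"
proof (rule tendsto_sandwich[of "\<lambda>_. 0" _ _ "\<lambda>n. ln (real n) / real n"])
  show "(\<lambda>n. ln (real n) / real n) \<longlonglongrightarrow> 0"
    by (rule filterlim_compose[OF ln_x_over_x_tendsto_0 filterlim_real_sequentially])
  show "\<forall>\<^sub>F n in sequentially. ln (real n) * real n powr - s \<le> ln (real n) / real n"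
  proof (rule eventually_sequentiallyI[of 1])
    fix n :: nat assume n: "1 \<le> n"
    then have "real n powr (-s) \<le> real n powr (-1)" using assms by (intro powr_mono) auto
    then have "ln (real n) * real n powr (-s) \<le> ln (real n) * real n powr (-1)"
      using n by (intro mult_left_mono) auto
    then show "ln (real n) * real n powr - s \<le> ln (real n) / real n" using n by (simp add: powr_minus_divide)
  qed
  show "\<forall>\<^sub>F n in sequentially. 0 \<le> ln (real n) * real n powr - s"
    by (rule eventually_sequentiallyI[of 1]) auto
qed auto

lemma powr_minus_tendsto_at_1:
  "((\<lambda>s. real n powr (-s)) \<longlongrightarrow> real n powr (-1)) (at_right 1)"
proof (cases "n = 0")
  case False
  then show ?thesis by (intro tendsto_powr tendsto_const tendsto_minus tendsto_ident_at) simp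
qed simp

context real_character begin

definition L_series :: "real \<Rightarrow> real" where
  "L_series s = infsum (\<lambda>n. \<psi> n * real n powr (-s)) {1..}"

definition mangoldt_series :: "real \<Rightarrow> real" where
  "mangoldt_series s = infsum (\<lambda>n. \<psi> n * mangoldt n * real n powr (-s)) {1..}"

lemma L_series_abs_summable: "s > 1 \<Longrightarrow> (\<lambda>n. \<psi> n * real n powr (-s)) abs_summable_on {1..}"
  using abs_le_1 by (intro abs_summable_on_comparison_test'[OF powr_summable_on[of s]])
    (auto simp: abs_mult intro!: mult_left_le_one_le)

lemma L_series_sums:
  assumes "s > 1"
  shows "(\<lambda>n. \<psi> n * real n powr (-s)) sums L_series s"
proof (rule has_sum_from_1_imp_sums)
  show "((\<lambda>n. \<psi> n * real n powr (-s)) has_sum L_series s) {1..}"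
    unfolding L_series_def by (rule has_sum_infsum[OF abs_summable_summable[OF L_series_abs_summable[OF assms]]])
qed simp

text \<open>The identity \<open>- L' = L \<cdot> (- L' / L)\<close>, read off from \<open>ln n = (\<Sum>k | k dvd n. \<Lambda> k)\<close>.\<close>
lemma L_series_times_mangoldt_series:
  assumes "s > 1"
  shows "((\<lambda>n. \<psi> n * (ln (real n) * real n powr (-s))) has_sum (mangoldt_series s * L_series s)) {1..}"
proof -
  have "((\<lambda>(a, b). (\<psi> a * mangoldt a * real a powr (-s)) * (\<psi> b * real b powr (-s))) has_sum (mangoldt_series s * L_series s)) ({1..} \<times> {1..})"
    unfolding mangoldt_series_def L_series_def
    by (intro has_sum_times L_series_abs_summable mangoldt_powr_summable_on[where B = 1] assms abs_le_1)
  from has_sum_divisors[OF this]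
  show ?thesis
  proof (rule has_sum_cong[THEN iffD1, rotated])
    fix n :: nat assume "n \<in> {1..}"
    then have n: "n \<noteq> 0" by auto
    have "(\<Sum>k | k dvd n. \<psi> k * mangoldt k * real k powr - s * (\<psi> (n div k) * real (n div k) powr - s))
        = (\<Sum>k | k dvd n. mangoldt k * (\<psi> n * real n powr (-s)))"
    proof (rule sum.cong)
      fix k assume "k \<in> {k. k dvd n}"
      then obtain m where m: "n = k * m" by auto
      then have "n div k = m" using n by auto
      then show "\<psi> k * mangoldt k * real k powr - s * (\<psi> (n div k) * real (n div k) powr - s)
          = mangoldt k * (\<psi> n * real n powr (-s))"
        using n by (simp add: m mult powr_mult)
    qed simp
    also have "\<dots> = ln (real n) * (\<psi> n * real n powr (-s))"
      using mangoldt_sum[OF n, where ?'a = real] by (simp flip: sum_distrib_right)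
    finally show "(\<Sum>k | k dvd n. \<psi> k * mangoldt k * real k powr - s * (\<psi> (n div k) * real (n div k) powr - s))
        = \<psi> n * (ln (real n) * real n powr (-s))" by simp
  qed
qed

lemma L_series_bounded_below:
  assumes "\<psi> a = -1"
  shows "\<exists>c>0. \<forall>\<^sub>F s in at_right 1. c \<le> \<bar>L_series s\<bar>"
proof -
  define L1 where "L1 = (\<Sum>n. \<psi> n * (1 / real n))"
  have L1: "\<bar>L1\<bar> > 0" using L_one_nonzero[OF assms] by (simp add: L1_def)
  \<comment> \<open>The tails at \<open>1\<close> and at \<open>s\<close> and the variation of the partial sum each stay below a quarter of \<open>L1\<close>.\<close>
  obtain m :: nat where m: "m > 0" "2 * real M * (1 / real m) < \<bar>L1\<bar> / 4"
  proof -
    have "(\<lambda>m. 2 * real M * (1 / real m)) \<longlonglongrightarrow> 2 * real M * 0"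
      by (intro tendsto_intros lim_1_over_n)
    then have "\<forall>\<^sub>F m in sequentially. 2 * real M * (1 / real m) < \<bar>L1\<bar> / 4"
      using L1 by (intro order_tendstoD(2)) auto
    then have "\<forall>\<^sub>F m in sequentially. 2 * real M * (1 / real m) < \<bar>L1\<bar> / 4 \<and> m > 0"
      by (intro eventually_conj eventually_gt_at_top)
    then show ?thesis using that eventually_sequentially by (metis (no_types, lifting) order_refl)
  qed
  define P where "P = (\<lambda>s. \<Sum>n<m. \<psi> n * real n powr (-s))"
  have P1: "P 1 = (\<Sum>n<m. \<psi> n * (1 / real n))"
    unfolding P_def by (intro sum.cong) (auto simp: powr_minus_divide)
  have "\<bar>L1 - P 1\<bar> \<le> 2 * real M * (1 / real m)"
    unfolding L1_def P1 using m(1)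
    by (intro dirichlet_test_tail(2)[where k = 1] partial_sum_bound[OF assms] lim_1_over_n)
       (auto simp: field_simps)
  then have d1: "\<bar>L1 - P 1\<bar> < \<bar>L1\<bar> / 4" using m by simp
  have d2: "\<bar>L_series s - P s\<bar> < \<bar>L1\<bar> / 4" if "s > 1" for s
  proof -
    have lim: "(\<lambda>n. real n powr (-s)) \<longlonglongrightarrow> 0"
      using that by (intro tendsto_neg_powr filterlim_real_sequentially) auto
    have "L_series s = (\<Sum>n. \<psi> n * real n powr (-s))" using L_series_sums[OF that] by (simp add: sums_iff)
    also have "\<bar>\<dots> - P s\<bar> \<le> 2 * real M * real m powr (-s)"
      unfolding P_def using m(1) that
      by (intro dirichlet_test_tail(2)[where k = 1] partial_sum_bound[OF assms] lim)
         (auto intro!: powr_mono2')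
    also have "\<dots> \<le> 2 * real M * real m powr (-1)"
      using m(1) that by (intro mult_left_mono powr_mono) auto
    also have "\<dots> < \<bar>L1\<bar> / 4" using m by (simp add: powr_minus_divide)
    finally show ?thesis .
  qed
  have "(P \<longlongrightarrow> P 1) (at_right 1)"
    unfolding P_def
  by (intro tendsto_sum tendsto_mult tendsto_const powr_minus_tendsto_at_1)
  then have "\<forall>\<^sub>F s in at_right 1. dist (P s) (P 1) < \<bar>L1\<bar> / 4"
    using L1 by (intro tendstoD) auto
  moreover have "\<forall>\<^sub>F s in at_right 1. s > (1::real)" by (rule eventually_at_right_less)
  ultimately have "\<forall>\<^sub>F s in at_right 1. \<bar>L1\<bar> / 4 \<le> \<bar>L_series s\<bar>"
  proof eventually_elim
    case (elim s)
    then show ?case using d1 d2[of s] unfolding dist_real_def by linarith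
  qed
  then show ?thesis using L1 by (intro exI[of _ "\<bar>L1\<bar> / 4"]) auto
qed

text \<open>
  The derivative of the L-series stays bounded near \<open>1\<close> by Dirichlet's test, and the L-series itself
  stays away from \<open>0\<close> there.
\<close>
lemma mangoldt_series_bounded:
  assumes "\<psi> a = -1"
  shows "\<exists>C. \<forall>\<^sub>F s in at_right 1. \<bar>mangoldt_series s\<bar> \<le> C"
proof -
  define D where "D = 2 * real M * ln 3 + ln 2"
  have D: "\<bar>mangoldt_series s * L_series s\<bar> \<le> D" if "s > 1" for s
  proof -
    define f where "f = (\<lambda>n. \<psi> n * (ln (real n) * real n powr (-s)))"
    have "f sums (mangoldt_series s * L_series s)"
      unfolding f_def by (intro has_sum_from_1_imp_sums L_series_times_mangoldt_series that) simp
    then have "mangoldt_series s * L_series s = suminf f" by (simp add: sums_iff)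
    moreover have "\<bar>suminf f - (\<Sum>n<3. f n)\<bar> \<le> 2 * real M * (ln (real 3) * real 3 powr (-s))"
      unfolding f_def using that
      by (intro dirichlet_test_tail(2)[where k = 3] partial_sum_bound[OF assms] ln_powr_tendsto_0 ln_powr_decreasing) auto
    moreover have "(3::real) powr (-s) \<le> 1" using that by (simp add: powr_minus_divide ge_one_powr_ge_zero)
    then have "2 * real M * (ln (real 3) * real 3 powr (-s)) \<le> 2 * real M * (ln 3 * 1)"
      by (intro mult_left_mono) auto
    moreover have "\<bar>\<Sum>n<3. f n\<bar> \<le> ln 2"
    proof -
      have "(\<Sum>n<3. f n) = \<psi> 2 * (ln 2 * 2 powr (-s))"
        by (simp add: f_def numeral_3_eq_3 numeral_2_eq_2)
      also have "\<bar>\<dots>\<bar> = \<bar>\<psi> 2\<bar> * (ln 2 * 2 powr (-s))" by (simp add: abs_mult)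
      also have "\<dots> \<le> 1 * (ln 2 * 1)"
        using that by (intro mult_mono abs_le_1) (auto simp: powr_minus_divide ge_one_powr_ge_zero)
      finally show ?thesis by simp
    qed
    ultimately show ?thesis unfolding D_def by linarith
  qed
  obtain c where c: "c > 0" "\<forall>\<^sub>F s in at_right 1. c \<le> \<bar>L_series s\<bar>" using L_series_bounded_below[OF assms] by blast
  have "\<forall>\<^sub>F s in at_right 1. s > (1::real)" by (rule eventually_at_right_less)
  with c(2) have "\<forall>\<^sub>F s in at_right 1. \<bar>mangoldt_series s\<bar> \<le> D / c"
  proof eventually_elim
    case (elim s)
    have "\<bar>mangoldt_series s\<bar> * c \<le> \<bar>mangoldt_series s\<bar> * \<bar>L_series s\<bar>" using elim by (intro mult_left_mono) auto
    also have "\<dots> \<le> D" using D[of s] elim by (simp add: abs_mult)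
    finally show ?case using c by (simp add: field_simps)
  qed
  then show ?thesis by blast
qed

text \<open>
  For the principal character the L-series diverges at \<open>1\<close>, so its mass moves to large \<open>n\<close>, where the
  weight \<open>ln n\<close> exceeds any bound.
\<close>
lemma mangoldt_series_unbounded:
  assumes nonneg: "\<And>n. \<psi> n \<ge> 0"
  shows "\<forall>\<^sub>F s in at_right 1. B \<le> mangoldt_series s"
proof -
  obtain N :: nat where N: "N \<ge> 1" "2 * \<bar>B\<bar> \<le> ln (real N)"
  proof -
    obtain N where "exp (2 * \<bar>B\<bar>) \<le> real N" using real_arch_simple by blast
    moreover then have "real N > 0" using exp_gt_zero by (rule order.strict_trans2[rotated])
    ultimately show ?thesis using that[of N] by (auto simp: ln_ge_iff)
  qed
  have L_ge: "\<forall>\<^sub>F s in at_right 1. K \<le> L_series s" for K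
  proof -
    have unb: "\<exists>V. K + 1 \<le> (\<Sum>n<V. \<psi> n / real n)"
    proof -
      have psi1: "\<psi> (1 + M * j) = 1" for j
      proof -
        have "(1 + M * j) mod M = 1" using M_gt_1 mod_mult_self2[of 1 M j] by simp
        then show ?thesis using chi_mod[of "1 + M * j"] by simp
      qed
      have ge: "(\<Sum>j=1..J. 1 / real j) * (1 / (real M + 1)) \<le> (\<Sum>n<Suc (Suc (M * J)). \<psi> n / real n)" for J
      proof -
        have "(\<Sum>j=1..J. 1 / real j) * (1 / (real M + 1)) = (\<Sum>j=1..J. 1 / (real j * (real M + 1)))"
          by (simp add: sum_divide_distrib)
        also have "\<dots> \<le> (\<Sum>j=1..J. \<psi> (1 + M * j) / real (1 + M * j))"
          unfolding psi1 by (intro sum_mono frac_le) (auto simp: algebra_simps add_pos_nonneg)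
        also have "\<dots> = (\<Sum>n\<in>(\<lambda>j. 1 + M * j) ` {1..J}. \<psi> n / real n)"
          using M_gt_1 by (subst sum.reindex) (auto intro: inj_onI)
        also have "\<dots> \<le> (\<Sum>n<Suc (Suc (M * J)). \<psi> n / real n)"
          using nonneg by (intro sum_mono2) (auto simp: less_Suc_eq_le)
        finally show ?thesis .
      qed
      have "\<not> summable (\<lambda>n. 1 / real n)"
        using summable_real_powr_iff[of "-1"] by (simp add: powr_minus_divide)
      then have "\<not> (\<forall>J. (\<Sum>j<J. 1 / real j) \<le> (K + 1) * (real M + 1))"
        using summableI_nonneg_bounded[of "\<lambda>n. 1 / real n"] by force
      then obtain J where "(K + 1) * (real M + 1) < (\<Sum>j<J. 1 / real j)" by (auto simp: not_le)
      also have "\<dots> \<le> (\<Sum>j=1..J. 1 / real j)"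
      proof -
        have "(\<Sum>j<J. 1 / real j) = (\<Sum>j\<in>{1..<J}. 1 / real j)"
          by (rule sum.mono_neutral_right) (auto simp: not_less_eq_eq)
        also have "\<dots> \<le> (\<Sum>j=1..J. 1 / real j)" by (intro sum_mono2) auto
        finally show ?thesis .
      qed
      finally have "K + 1 \<le> (\<Sum>j=1..J. 1 / real j) * (1 / (real M + 1))"
        by (simp add: field_simps)
      with ge[of J] show ?thesis by (meson order.trans)
    qed
    then obtain V where V: "K + 1 \<le> (\<Sum>n<V. \<psi> n / real n)" by blast
    have "((\<lambda>s. \<Sum>n<V. \<psi> n * real n powr (-s)) \<longlongrightarrow> (\<Sum>n<V. \<psi> n * real n powr (-1))) (at_right 1)"
    by (intro tendsto_sum tendsto_mult tendsto_const powr_minus_tendsto_at_1)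
    moreover have "(\<Sum>n<V. \<psi> n * real n powr (-1)) = (\<Sum>n<V. \<psi> n / real n)"
      by (intro sum.cong) (auto simp: powr_minus_divide)
    ultimately have "\<forall>\<^sub>F s in at_right 1. K < (\<Sum>n<V. \<psi> n * real n powr (-s))"
      using V by (auto elim!: order_tendstoD)
    moreover have "\<forall>\<^sub>F s in at_right 1. s > (1::real)" by (rule eventually_at_right_less)
    ultimately show ?thesis
    proof eventually_elim
      case (elim s)
      have "(\<Sum>n<V. \<psi> n * real n powr (-s)) \<le> L_series s"
        using L_series_sums[OF elim(2)] nonneg sum_le_suminf[of "\<lambda>n. \<psi> n * real n powr (-s)" "{..<V}"]
        by (simp add: sums_iff)
      then show ?case using elim by linarith
    qed
  qed
  have "\<forall>\<^sub>F s in at_right 1. s > (1::real)" by (rule eventually_at_right_less)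
  with L_ge[of "2 * real N + 1"] show ?thesis
  proof eventually_elim
    case (elim s)
    define f where "f = (\<lambda>n. \<psi> n * real n powr (-s))"
    have f: "f sums L_series s" unfolding f_def by (rule L_series_sums[OF elim(2)])
    have lf: "(\<lambda>n. ln (real n) * f n) sums (mangoldt_series s * L_series s)"
      using has_sum_from_1_imp_sums[OF L_series_times_mangoldt_series[OF elim(2)]] by (simp add: f_def algebra_simps)
    have fb: "0 \<le> f n" "f n \<le> 1" for n
    proof -
      show "0 \<le> f n" using nonneg by (simp add: f_def)
      have "real n powr (-s) \<le> 1"
        using elim(2) by (cases "n = 0") (auto simp: powr_minus_divide ge_one_powr_ge_zero)
      then have "\<bar>\<psi> n\<bar> * real n powr (-s) \<le> 1 * 1" by (intro mult_mono abs_le_1) auto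
      then show "f n \<le> 1" using nonneg[of n] by (simp add: f_def)
    qed
    \<comment> \<open>The terms with \<open>n < N\<close> contribute at most \<open>N\<close> to the L-series.\<close>
    define g where "g = (\<lambda>n. if n < N then 1 else (0::real))"
    have g: "g sums real N"
      using sums_If_finite_set[of "{..<N}" "\<lambda>_. 1::real"] by (simp add: g_def)
    have "ln (real N) * (L_series s - real N) \<le> mangoldt_series s * L_series s"
    proof (rule sums_le[OF _ sums_mult[OF sums_diff[OF f g]] lf])
      fix n
      show "ln (real N) * (f n - g n) \<le> ln (real n) * f n"
      proof (cases "n < N")
        case True
        have "ln (real N) * (f n - g n) \<le> 0"
          using True fb[of n] N by (intro mult_nonneg_nonpos) (auto simp: g_def)
        also have "0 \<le> ln (real n) * f n" using fb by (cases "n = 0") auto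
        finally show ?thesis .
      next
        case False
        then have "ln (real N) \<le> ln (real n)" using N by (intro ln_mono) auto
        then show ?thesis using False fb by (auto simp: g_def intro: mult_right_mono)
      qed
    qed
    moreover have "B * L_series s \<le> ln (real N) * (L_series s - real N)"
    proof -
      have "B * L_series s \<le> \<bar>B\<bar> * L_series s" using elim(1) by (intro mult_right_mono) auto
      also have "\<dots> \<le> \<bar>B\<bar> * (2 * (L_series s - real N))" using elim(1) by (intro mult_left_mono) auto
      also have "\<dots> = (2 * \<bar>B\<bar>) * (L_series s - real N)" by simp
      also have "\<dots> \<le> ln (real N) * (L_series s - real N)"
        using N elim(1) by (intro mult_right_mono) auto
      finally show ?thesis .
    qed
    ultimately have "B * L_series s \<le> mangoldt_series s * L_series s" by linarith
    then show ?case using elim(1) by simp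
  qed
qed

end

lemma infsum_ln_over_squares:
  "((\<lambda>m. ln (real m) * real m powr (-2)) summable_on {1..})"
  by (rule ln_powr_summable_on) simp

lemma has_sum_finite_sum:
  fixes f :: "'i \<Rightarrow> 'a \<Rightarrow> real"
  assumes "finite I" "\<And>i. i \<in> I \<Longrightarrow> (f i has_sum S i) A"
  shows "((\<lambda>x. \<Sum>i\<in>I. f i x) has_sum (\<Sum>i\<in>I. S i)) A"
  using assms by (induction I rule: finite_induct) (auto intro: has_sum_add)

text \<open>
  The product of the factors \<open>1 + e\<^sub>i \<psi>\<^sub>i(n)\<close> detects the integers with the prescribed values, and it
  expands into products of the characters over subsets of \<open>I\<close>.  Independence makes all products over
  nonempty subsets nontrivial, so only the empty subset contributes an unbounded term to the sum of
  \<open>\<Lambda>(n) n\<^sup>-\<^sup>s\<close> over the detected integers.  Without a prime of the required kind, only even powers of primes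
  are detected, and their contribution is bounded.
\<close>
theorem exists_prime_with_character_values:
  fixes \<psi> :: "'i \<Rightarrow> nat \<Rightarrow> real" and e :: "'i \<Rightarrow> real"
  assumes fin: "finite I"
    and char: "\<And>i. i \<in> I \<Longrightarrow> real_character M (\<psi> i)"
    and M: "M > 1"
    and indep: "\<And>i. i \<in> I \<Longrightarrow> \<exists>a. \<psi> i a = -1 \<and> (\<forall>j\<in>I - {i}. \<psi> j a = 1)"
    and e: "\<And>i. i \<in> I \<Longrightarrow> e i \<in> {-1, 1}"
  shows "\<exists>r. prime r \<and> coprime r M \<and> (\<forall>i\<in>I. \<psi> i r = e i)"
proof (rule ccontr)
  assume contra: "\<not> ?thesis"
  define \<Psi> where "\<Psi> = (\<lambda>J n. (if coprime n M then \<Prod>j\<in>J. \<psi> j n else 0))"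
  define E where "E = (\<lambda>n. if coprime n M then \<Prod>i\<in>I. 1 + e i * \<psi> i n else 0)"
  have sub_vals: "(\<Prod>j\<in>J. \<psi> j n) \<in> {-1, 1}" if "J \<subseteq> I" "coprime n M" for J n
    using finite_subset[OF that(1) fin] that(1)
  proof (induction J rule: finite_induct)
    case (insert x F)
    then have "\<psi> x n \<in> {-1, 0, 1}" "\<psi> x n \<noteq> 0"
      using that(2) real_character.vals[OF char, of x n] real_character.zero_iff[OF char, of x n] by auto
    then show ?case using insert by auto
  qed simp
  have \<Psi>_char: "real_character M (\<Psi> J)" if J: "J \<subseteq> I" for J
  proof
    show "M > 1" by (rule M)
    show "\<Psi> J (m * n) = \<Psi> J m * \<Psi> J n" for m n
      using J by (auto simp: \<Psi>_def prod.distrib real_character.mult[OF char] subset_iff intro!: prod.cong)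
    show "\<Psi> J (n + M) = \<Psi> J n" for n
    proof -
      have "coprime (n + M) M \<longleftrightarrow> coprime n M" by (simp only: coprime_iff_gcd_eq_1 gcd_add1)
      moreover have "(\<Prod>j\<in>J. \<psi> j (n + M)) = (\<Prod>j\<in>J. \<psi> j n)"
        using J by (intro prod.cong real_character.periodic[OF char]) auto
      ultimately show ?thesis by (simp add: \<Psi>_def)
    qed
    show "\<Psi> J n = 0 \<longleftrightarrow> \<not> coprime n M" for n
      using sub_vals[OF J, of n] by (auto simp: \<Psi>_def)
    show "\<Psi> J n \<in> {-1, 0, 1}" for n
      using sub_vals[OF J, of n] by (auto simp: \<Psi>_def)
  qed
  have nontriv: "\<exists>a. \<Psi> J a = -1" if J: "J \<subseteq> I" "J \<noteq> {}" for J
  proof -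
    obtain i where i: "i \<in> J" using J by blast
    then obtain a where a: "\<psi> i a = -1" "\<forall>j\<in>I - {i}. \<psi> j a = 1" using indep J by blast
    have "coprime a M" using real_character.zero_iff[OF char, of i a] a i J by auto
    moreover have "(\<Prod>j\<in>J. \<psi> j a) = -1"
    proof -
      have "(\<Prod>j\<in>J. \<psi> j a) = \<psi> i a * (\<Prod>j\<in>J - {i}. \<psi> j a)"
        using i finite_subset[OF J(1) fin] by (simp add: prod.remove)
      also have "(\<Prod>j\<in>J - {i}. \<psi> j a) = 1" using a(2) J(1) by (intro prod.neutral) auto
      finally show ?thesis using a(1) by simp
    qed
    ultimately show ?thesis by (auto simp: \<Psi>_def)
  qed
  have E_expand: "E n = (\<Sum>J\<in>Pow I. (\<Prod>j\<in>J. e j) * \<Psi> J n)" for n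
  proof -
    have "(\<Prod>i\<in>I. 1 + e i * \<psi> i n) = (\<Sum>J\<in>Pow I. (\<Prod>j\<in>J. e j * \<psi> j n))"
      using prod_add[OF fin, of "\<lambda>i. e i * \<psi> i n" "\<lambda>_. 1"] by (simp add: add.commute)
    then show ?thesis by (simp add: E_def \<Psi>_def prod.distrib)
  qed
  have E_bound: "0 \<le> E n \<and> E n \<le> 2 ^ card I" for n
  proof (cases "coprime n M")
    case True
    have *: "0 \<le> 1 + e i * \<psi> i n \<and> 1 + e i * \<psi> i n \<le> 2" if "i \<in> I" for i
      using e[OF that] real_character.vals[OF char[OF that], of n] by auto
    then have "(\<Prod>i\<in>I. 1 + e i * \<psi> i n) \<le> (\<Prod>i\<in>I. 2)" by (intro prod_mono) auto
    then show ?thesis using True * by (auto simp: E_def prod_nonneg)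
  qed (simp add: E_def)
  \<comment> \<open>If no prime has the prescribed values, \<open>E\<close> vanishes at all prime powers with odd exponent.\<close>
  have E_zero: "E n * mangoldt n = 0" if "\<not> (\<exists>m. n = m\<^sup>2)" for n
  proof (cases "primepow n")
    case True
    then obtain r k where rk: "prime r" "k > 0" "n = r ^ k" by (auto simp: primepow_def)
    have "odd k" using that rk(3) by (metis power_even_eq dvdE mult.commute)
    then obtain l where l: "k = 2 * l + 1" by (elim oddE)
    show ?thesis
    proof (cases "coprime n M")
      case True
      then have cop: "coprime r M" using rk by simp
      then obtain i where i: "i \<in> I" "\<psi> i r \<noteq> e i" using contra rk by blast
      have v: "\<psi> i r \<in> {-1, 1}"
        using real_character.vals[OF char[OF i(1)], of r] real_character.zero_iff[OF char[OF i(1)], of r] cop by auto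
      have "\<psi> i n = \<psi> i r ^ k" by (simp add: rk real_character.chi_power[OF char[OF i(1)]])
      also have "\<dots> = \<psi> i r" using v by (auto simp: l)
      finally have "1 + e i * \<psi> i n = 0" using v i(2) e[OF i(1)] by auto
      then have "(\<Prod>i\<in>I. 1 + e i * \<psi> i n) = 0" using fin i(1) by (intro prod_zero) auto
      then show ?thesis by (simp add: E_def)
    qed (simp add: E_def)
  qed (simp add: mangoldt_def)
  define W where "W = (\<lambda>s. infsum (\<lambda>n. E n * mangoldt n * real n powr (-s)) {1..})"
  define K where "K = infsum (\<lambda>m. 2 ^ card I * 2 * (ln (real m) * real m powr (-2))) {1..}"
  have W_le: "W s \<le> K" if s: "s > 1" for s
  proof -
    have inj: "inj_on (\<lambda>m::nat. m\<^sup>2) {1..}" by (auto intro: inj_onI)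
    have sm: "(\<lambda>n. E n * mangoldt n * real n powr (-s)) summable_on {1..}"
      using E_bound by (intro abs_summable_summable[OF mangoldt_powr_summable_on[OF s, where B = "2 ^ card I"]]) auto
    have "W s = infsum (\<lambda>n. E n * mangoldt n * real n powr (-s)) ((\<lambda>m. m\<^sup>2) ` {1..})"
      unfolding W_def
    proof (rule infsum_cong_neutral)
      fix n assume n: "n \<in> {1..} - (\<lambda>m::nat. m\<^sup>2) ` {1..}"
      then have "\<not> (\<exists>m. n = m\<^sup>2)" by (auto simp: image_iff Suc_le_eq)
      from E_zero[OF this] show "E n * mangoldt n * real n powr - s = 0" by simp
    qed auto
    also have "\<dots> = infsum (\<lambda>m. E (m\<^sup>2) * mangoldt (m\<^sup>2) * real (m\<^sup>2) powr (-s)) {1..}"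
      by (subst infsum_reindex[OF inj]) (simp add: o_def)
    also have "\<dots> \<le> K"
      unfolding K_def
    proof (rule infsum_mono)
      have "(\<lambda>n. E n * mangoldt n * real n powr (-s)) summable_on ((\<lambda>m. m\<^sup>2) ` {1..})"
        using sm by (rule summable_on_subset_banach) auto
      then show "(\<lambda>m. E (m\<^sup>2) * mangoldt (m\<^sup>2) * real (m\<^sup>2) powr (-s)) summable_on {1..}"
        by (subst (asm) summable_on_reindex[OF inj]) (simp add: o_def)
      show "(\<lambda>m. 2 ^ card I * 2 * (ln (real m) * real m powr (-2))) summable_on {1..}"
        by (intro summable_on_cmult_right infsum_ln_over_squares)
    next
      fix m :: nat assume "m \<in> {1..}"
      then have m: "m \<ge> 1" by simp
      have "mangoldt (m\<^sup>2) \<le> ln (real (m\<^sup>2))" using m by (intro mangoldt_le) simp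
      then have 1: "mangoldt (m\<^sup>2) \<le> 2 * ln (real m)" using m by (simp add: ln_realpow)
      have "real (m\<^sup>2) powr (-s) \<le> real (m\<^sup>2) powr (-1)" using m s by (intro powr_mono) auto
      also have "\<dots> = real m powr (-2)"
        using m by (simp add: powr_minus_divide)
      finally have 2: "real (m\<^sup>2) powr (-s) \<le> real m powr (-2)" .
      have "E (m\<^sup>2) * mangoldt (m\<^sup>2) * real (m\<^sup>2) powr (-s) \<le> 2 ^ card I * (2 * ln (real m)) * real m powr (-2)"
        using E_bound[of "m\<^sup>2"] 1 2 m by (intro mult_mono mult_nonneg_nonneg) (auto intro: mangoldt_nonneg)
      then show "E (m\<^sup>2) * mangoldt (m\<^sup>2) * real (m\<^sup>2) powr (-s) \<le> 2 ^ card I * 2 * (ln (real m) * real m powr (-2))"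
        by (simp add: mult_ac)
    qed
    finally show ?thesis .
  qed
  define Z where "Z = (\<lambda>J. real_character.mangoldt_series (\<Psi> J))"
  have W_eq: "W s = (\<Sum>J\<in>Pow I. (\<Prod>j\<in>J. e j) * Z J s)" if s: "s > 1" for s
  proof -
    have sm: "(\<lambda>n. \<Psi> J n * mangoldt n * real n powr (-s)) summable_on {1..}" if "J \<subseteq> I" for J
      using real_character.abs_le_1[OF \<Psi>_char[OF that]]
      by (intro abs_summable_summable[OF mangoldt_powr_summable_on[OF s, where B = 1]]) auto
    have "((\<lambda>n. \<Sum>J\<in>Pow I. (\<Prod>j\<in>J. e j) * (\<Psi> J n * mangoldt n * real n powr (-s))) has_sum
        (\<Sum>J\<in>Pow I. (\<Prod>j\<in>J. e j) * Z J s)) {1..}"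
    proof (rule has_sum_finite_sum)
      show "finite (Pow I)" using fin by simp
    next
      fix J assume "J \<in> Pow I"
      then have J: "J \<subseteq> I" by simp
      show "((\<lambda>n. (\<Prod>j\<in>J. e j) * (\<Psi> J n * mangoldt n * real n powr (-s))) has_sum (\<Prod>j\<in>J. e j) * Z J s) {1..}"
        unfolding Z_def real_character.mangoldt_series_def[OF \<Psi>_char[OF J]]
        by (rule has_sum_cmult_right[OF has_sum_infsum[OF sm[OF J]]])
    qed
    moreover have "(\<lambda>n. \<Sum>J\<in>Pow I. (\<Prod>j\<in>J. e j) * (\<Psi> J n * mangoldt n * real n powr (-s))) =
        (\<lambda>n. E n * mangoldt n * real n powr (-s))"
      by (auto simp: E_expand sum_distrib_right mult.assoc)
    ultimately show ?thesis unfolding W_def by (simp add: infsumI)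
  qed
  have "\<forall>J\<in>Pow I - {{}}. \<exists>C. \<forall>\<^sub>F s in at_right 1. \<bar>Z J s\<bar> \<le> C"
  proof
    fix J assume "J \<in> Pow I - {{}}"
    then have J: "J \<subseteq> I" "J \<noteq> {}" by auto
    then obtain a where "\<Psi> J a = -1" using nontriv by blast
    then show "\<exists>C. \<forall>\<^sub>F s in at_right 1. \<bar>Z J s\<bar> \<le> C"
      unfolding Z_def by (rule real_character.mangoldt_series_bounded[OF \<Psi>_char[OF J(1)]])
  qed
  then obtain C where C: "\<And>J. J \<in> Pow I - {{}} \<Longrightarrow> \<forall>\<^sub>F s in at_right 1. \<bar>Z J s\<bar> \<le> C J"
    by metis
  have C': "\<forall>\<^sub>F s in at_right 1. \<forall>J\<in>Pow I - {{}}. \<bar>Z J s\<bar> \<le> C J"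
    using fin C by (intro eventually_ball_finite) auto
  have "\<forall>\<^sub>F s in at_right 1. K + 1 + (\<Sum>J\<in>Pow I - {{}}. C J) \<le> Z {} s"
    unfolding Z_def by (rule real_character.mangoldt_series_unbounded[OF \<Psi>_char]) (auto simp: \<Psi>_def)
  moreover note C'
  moreover have "\<forall>\<^sub>F s in at_right 1. s > (1::real)" by (rule eventually_at_right_less)
  ultimately have "\<forall>\<^sub>F s::real in at_right 1. False"
  proof eventually_elim
    case (elim s)
    have "W s = Z {} s + (\<Sum>J\<in>Pow I - {{}}. (\<Prod>j\<in>J. e j) * Z J s)"
      unfolding W_eq[OF elim(3)] using fin by (subst sum.remove[of _ "{}"]) auto
    moreover have "(\<Sum>J\<in>Pow I - {{}}. (\<Prod>j\<in>J. e j) * Z J s) \<ge> (\<Sum>J\<in>Pow I - {{}}. - C J)"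
    proof (rule sum_mono)
      fix J assume J: "J \<in> Pow I - {{}}"
      have "\<bar>\<Prod>j\<in>J. e j\<bar> = (\<Prod>j\<in>J. \<bar>e j\<bar>)" by (rule abs_prod)
      also have "\<dots> = 1" using J e by (intro prod.neutral) force
      finally have "\<bar>(\<Prod>j\<in>J. e j) * Z J s\<bar> \<le> C J" using elim(2) J by (simp add: abs_mult)
      then show "- C J \<le> (\<Prod>j\<in>J. e j) * Z J s" by linarith
    qed
    ultimately show False using W_le[OF elim(3)] elim(1) by (simp add: sum_negf)
  qed
  then show False by simp
qed

section \<open>Legendre symbols and the supplementary laws\<close>

lemma Legendre_values: "Legendre a l \<in> {-1, 0, 1}"
  by (simp add: Legendre_def)

lemma Legendre_eq_0_iff: "Legendre a l = 0 \<longleftrightarrow> l dvd a"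
  by (simp add: Legendre_def cong_0_iff)

lemma Legendre_cong: "[a = b] (mod l) \<Longrightarrow> Legendre a l = Legendre b l"
  by (simp add: Legendre_def QuadRes_def cong_def)

lemma Legendre_mult:
  fixes l :: nat
  assumes "prime l" "2 < l"
  shows "Legendre (a * b) (int l) = Legendre a (int l) * Legendre b (int l)"
proof -
  let ?L = "\<lambda>x. Legendre x (int l)"
  have "[?L (a * b) = (a * b) ^ ((l - 1) div 2)] (mod int l)"
    by (rule euler_criterion[OF assms])
  also have "(a * b) ^ ((l - 1) div 2) = a ^ ((l - 1) div 2) * b ^ ((l - 1) div 2)"
    by (rule power_mult_distrib)
  also have "[\<dots> = ?L a * ?L b] (mod int l)"
    using cong_sym[OF euler_criterion[OF assms, of a]] cong_sym[OF euler_criterion[OF assms, of b]]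
    by (rule cong_mult)
  finally have "int l dvd ?L (a * b) - ?L a * ?L b" by (simp add: cong_iff_dvd_diff)
  moreover have "\<bar>?L (a * b) - ?L a * ?L b\<bar> < int l"
    using Legendre_values[of a l] Legendre_values[of b l] Legendre_values[of "a * b" l] assms by auto
  ultimately have "?L (a * b) - ?L a * ?L b = 0" by (metis dvd_imp_le_int abs_of_nat not_less)
  then show ?thesis by simp
qed

lemma Legendre_1: "prime (l::nat) \<Longrightarrow> Legendre 1 (int l) = 1"
  by (auto simp: Legendre_def QuadRes_def cong_0_iff intro: exI[of _ 1])

text \<open>The nontrivial character modulo \<open>4\<close> and the even primitive character modulo \<open>8\<close>.\<close>
definition chi4 :: "int \<Rightarrow> int" where
  "chi4 u = (if u mod 4 = 1 then 1 else if u mod 4 = 3 then -1 else 0)"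

definition chi8 :: "int \<Rightarrow> int" where
  "chi8 u = (if u mod 8 \<in> {1, 7} then 1 else if u mod 8 \<in> {3, 5} then -1 else 0)"

lemma chi4_mult: "chi4 (a * b) = chi4 a * chi4 b"
proof -
  define x y z where "x = a mod 4" and "y = b mod 4" and "z = (a * b) mod 4"
  have "z = x * y mod 4" unfolding x_def y_def z_def by (simp only: mod_mult_eq)
  moreover have "x = 0 \<or> x = 1 \<or> x = 2 \<or> x = 3" unfolding x_def by presburger
  moreover have "y = 0 \<or> y = 1 \<or> y = 2 \<or> y = 3" unfolding y_def by presburger
  ultimately show ?thesis
    unfolding chi4_def x_def[symmetric] y_def[symmetric] z_def[symmetric] by (elim disjE) simp_all
qed

lemma chi8_mult: "chi8 (a * b) = chi8 a * chi8 b"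
proof -
  define x y z where "x = a mod 8" and "y = b mod 8" and "z = (a * b) mod 8"
  have "z = x * y mod 8" unfolding x_def y_def z_def by (simp only: mod_mult_eq)
  moreover have "x = 0 \<or> x = 1 \<or> x = 2 \<or> x = 3 \<or> x = 4 \<or> x = 5 \<or> x = 6 \<or> x = 7" unfolding x_def by presburger
  moreover have "y = 0 \<or> y = 1 \<or> y = 2 \<or> y = 3 \<or> y = 4 \<or> y = 5 \<or> y = 6 \<or> y = 7" unfolding y_def by presburger
  ultimately show ?thesis
    unfolding chi8_def x_def[symmetric] y_def[symmetric] z_def[symmetric] by (elim disjE) simp_all
qed

lemma Legendre_minus_1:
  assumes "prime (l::nat)" "2 < l"
  shows "Legendre (-1) (int l) = chi4 (int l)"
proof -
  have odd: "odd l" using assms prime_odd_nat by blast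
  let ?m = "(l - 1) div 2"
  have "[Legendre (-1) (int l) = (-1) ^ ?m] (mod int l)" by (rule euler_criterion[OF assms])
  moreover have "(-1::int) ^ ?m = chi4 (int l)"
  proof -
    have "l mod 4 = 1 \<or> l mod 4 = 3" using odd by presburger
    then show ?thesis
    proof
      assume *: "l mod 4 = 1"
      then have "even ?m" by presburger
      moreover have "int l mod 4 = 1" using * by presburger
      ultimately show ?thesis by (simp add: chi4_def)
    next
      assume *: "l mod 4 = 3"
      then have "odd ?m" by presburger
      moreover have "int l mod 4 = 3" using * by presburger
      ultimately show ?thesis by (simp add: chi4_def)
    qed
  qed
  ultimately have "int l dvd Legendre (-1) (int l) - chi4 (int l)" by (simp add: cong_iff_dvd_diff)
  moreover have "\<bar>Legendre (-1) (int l) - chi4 (int l)\<bar> < int l"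
    using Legendre_values[of "-1" l] assms by (auto simp: chi4_def)
  ultimately have "Legendre (-1) (int l) - chi4 (int l) = 0" by (metis dvd_imp_le_int abs_of_nat not_less)
  then show ?thesis by simp
qed

text \<open>
  In Gauss's lemma for the multiplier \<open>2\<close> the multiples \<open>2 x\<close> with \<open>0 < x \<le> m = (l - 1) / 2\<close> are already
  reduced modulo \<open>l\<close>, and those with \<open>x > m / 2\<close> exceed \<open>m\<close>.
\<close>
lemma Legendre_2:
  assumes "prime (l::nat)" "2 < l"
  shows "Legendre 2 (int l) = chi8 (int l)"
proof -
  have odd: "odd l" using assms prime_odd_nat by blast
  interpret GAUSS l 2
    using assms by unfold_locales (auto simp: cong_0_iff dest: zdvd_imp_le)
  define m where "m = (l - 1) div 2"
  have lm: "l = 2 * m + 1" using odd by (auto simp: m_def elim!: oddE)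
  have m: "(int l - 1) div 2 = int m" by (simp add: lm)
  have "E = (\<lambda>x. x * 2) ` {int (m div 2) <.. int m}"
  proof -
    have "C = B" unfolding C_def B_def A_def m by (force simp: lm image_iff)
    then show ?thesis unfolding E_def B_def A_def m by (auto simp: image_iff)
  qed
  then have "card E = m - m div 2"
    by (simp add: card_image inj_on_def)
  then have L: "Legendre 2 (int l) = (-1) ^ (m - m div 2)" using gauss_lemma by simp
  define k where "k = l div 8"
  have k: "l = 8 * k + l mod 8" by (simp add: k_def)
  have "l mod 8 = 1 \<or> l mod 8 = 3 \<or> l mod 8 = 5 \<or> l mod 8 = 7" using odd by presburger
  moreover have "(-1::int) ^ (2 * k) = 1" by simp
  ultimately show ?thesis
  proof (elim disjE)
    assume *: "l mod 8 = 1"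
    then have "m = 4 * k" using k lm by simp
    then have "m - m div 2 = 2 * k" by simp
    moreover have "int l mod 8 = 1" using * by presburger
    ultimately show ?thesis using L by (simp add: chi8_def)
  next
    assume *: "l mod 8 = 3"
    then have "m = 4 * k + 1" using k lm by simp
    then have "m - m div 2 = 2 * k + 1" by simp
    moreover have "int l mod 8 = 3" using * by presburger
    ultimately show ?thesis using L by (simp add: chi8_def)
  next
    assume *: "l mod 8 = 5"
    then have "m = 4 * k + 2" using k lm by simp
    then have "m - m div 2 = 2 * k + 1" by simp
    moreover have "int l mod 8 = 5" using * by presburger
    ultimately show ?thesis using L by (simp add: chi8_def)
  next
    assume *: "l mod 8 = 7"
    then have "m = 4 * k + 3" using k lm by simp
    then have "m - m div 2 = 2 * (k + 1)" by simp
    moreover have "int l mod 8 = 7" using * by presburger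
    ultimately show ?thesis using L by (simp add: chi8_def)
  qed
qed

text \<open>Squaring is not injective modulo \<open>l\<close>, since \<open>1\<close> and \<open>-1\<close> have the same square; so it is not onto.\<close>
lemma exists_nonresidue:
  assumes "prime (l::nat)" "2 < l"
  shows "\<exists>n. 0 < n \<and> Legendre n (int l) = -1"
proof (rule ccontr)
  assume "\<not> ?thesis"
  then have all: "Legendre n (int l) \<noteq> -1" if "0 < n" for n using that by auto
  let ?S = "{0..<int l}"
  have "?S \<subseteq> (\<lambda>y. y\<^sup>2 mod int l) ` ?S"
  proof
    fix n assume n: "n \<in> ?S"
    show "n \<in> (\<lambda>y. y\<^sup>2 mod int l) ` ?S"
    proof (cases "n = 0")
      case True
      then show ?thesis using n by (intro image_eqI[of _ _ 0]) auto
    next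
      case False
      then have "Legendre n (int l) \<noteq> -1" using n all by auto
      moreover have "\<not> int l dvd n" using n False by (auto dest: zdvd_imp_le)
      ultimately have "QuadRes (int l) n" by (auto simp: Legendre_def cong_0_iff split: if_splits)
      then obtain y where "[y\<^sup>2 = n] (mod int l)" by (auto simp: QuadRes_def)
      then have "(y mod int l)\<^sup>2 mod int l = n" using n by (simp add: cong_def power_mod)
      then show ?thesis using assms by (intro image_eqI[of _ _ "y mod int l"]) auto
    qed
  qed
  then have "inj_on (\<lambda>y. y\<^sup>2 mod int l) ?S"
    by (intro finite_surj_inj) auto
  moreover have "(1::int)\<^sup>2 mod int l = (int l - 1)\<^sup>2 mod int l"
  proof -
    have "int l dvd 1\<^sup>2 - (int l - 1)\<^sup>2"
      by (rule dvdI[of _ _ "2 - int l"]) (simp add: power2_eq_square algebra_simps)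
    then show ?thesis by (simp only: cong_iff_dvd_diff[symmetric] cong_def)
  qed
  ultimately have "1 = int l - 1" using assms by (elim inj_onD) auto
  then show False using assms by simp
qed

section \<open>Hilbert symbols\<close>

definition unit_part :: "nat \<Rightarrow> int \<Rightarrow> int" where
  "unit_part l A = A div int l ^ multiplicity (int l) A"

lemma unit_part_decomp:
  "A = int l ^ multiplicity (int l) A * unit_part l A"
  unfolding unit_part_def by (simp add: multiplicity_dvd)

lemma unit_part_unit:
  assumes "prime l" "A \<noteq> 0"
  shows "\<not> int l dvd unit_part l A"
proof -
  have "\<not> is_unit (int l)" using prime_gt_1_nat[OF assms(1)] by simp
  with assms(2) show ?thesis unfolding unit_part_def by (intro multiplicity_decompose)
qed

lemma unit_part_mult:
  assumes "prime l" "A \<noteq> 0" "B \<noteq> 0"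
  shows "unit_part l (A * B) = unit_part l A * unit_part l B"
proof -
  have p: "prime_elem (int l)" using assms by simp
  have m: "multiplicity (int l) (A * B) = multiplicity (int l) A + multiplicity (int l) B"
    using p assms by (simp add: prime_elem_multiplicity_mult_distrib)
  have "unit_part l (A * B) = (int l ^ multiplicity (int l) A * unit_part l A) * (int l ^ multiplicity (int l) B * unit_part l B)
      div (int l ^ multiplicity (int l) A * int l ^ multiplicity (int l) B)"
    by (simp only: unit_part_decomp[symmetric]) (simp add: unit_part_def m power_add)
  also have "\<dots> = (int l ^ multiplicity (int l) A * int l ^ multiplicity (int l) B) * (unit_part l A * unit_part l B)
      div (int l ^ multiplicity (int l) A * int l ^ multiplicity (int l) B)"
    by (simp add: mult_ac)
  also have "\<dots> = unit_part l A * unit_part l B"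
    using prime_gt_0_nat[OF assms(1)] by (intro nonzero_mult_div_cancel_left) auto
  finally show ?thesis .
qed

lemma unit_part_not_dvd: "\<not> int l dvd A \<Longrightarrow> unit_part l A = A"
  by (simp add: unit_part_def not_dvd_imp_multiplicity_0)

text \<open>
  \<open>unit_char\<close> gives the symbol of a unit against the uniformizer \<open>l\<close>, and \<open>unit_pairing\<close> the symbol of
  two units, which is trivial at odd \<open>l\<close>.  With these, one formula for the Hilbert symbol serves
  all primes; at \<open>l = 2\<close> the factor \<open>unit_char l (-1)\<close> is \<open>1\<close>.
\<close>
definition unit_char :: "nat \<Rightarrow> int \<Rightarrow> int" where
  "unit_char l u = (if l = 2 then chi8 u else Legendre u (int l))"

definition unit_pairing :: "nat \<Rightarrow> int \<Rightarrow> int \<Rightarrow> int" where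
  "unit_pairing l u v = (if l = 2 \<and> chi4 u = -1 \<and> chi4 v = -1 then -1 else 1)"

definition hilbert :: "nat \<Rightarrow> int \<Rightarrow> int \<Rightarrow> int" where
  "hilbert l A B = (let \<alpha> = multiplicity (int l) A; \<beta> = multiplicity (int l) B; u = unit_part l A; v = unit_part l B
     in unit_pairing l u v * unit_char l (-1) ^ (\<alpha> * \<beta>) * unit_char l u ^ \<beta> * unit_char l v ^ \<alpha>)"

lemma chi4_odd: "odd u \<Longrightarrow> chi4 u \<in> {-1, 1}"
  unfolding chi4_def by auto presburger

lemma chi8_odd: "odd u \<Longrightarrow> chi8 u \<in> {-1, 1}"
  unfolding chi8_def by auto presburger

lemma unit_char_unit: "prime l \<Longrightarrow> \<not> int l dvd u \<Longrightarrow> unit_char l u \<in> {-1, 1}"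
  using chi8_odd[of u] Legendre_values[of u "int l"] Legendre_eq_0_iff[of u "int l"]
  by (auto simp: unit_char_def)

lemma unit_char_mult: "prime l \<Longrightarrow> unit_char l (u * v) = unit_char l u * unit_char l v"
  using prime_ge_2_nat[of l] by (auto simp: unit_char_def chi8_mult Legendre_mult)

lemma unit_char_minus_1: "prime l \<Longrightarrow> unit_char l (-1) \<in> {-1, 1}"
  by (rule unit_char_unit) auto

lemma hilbert_sym: "hilbert l A B = hilbert l B A"
  by (auto simp: hilbert_def Let_def unit_pairing_def mult_ac)

lemma unit_pairing_mult:
  assumes "l = 2 \<Longrightarrow> odd v" "l = 2 \<Longrightarrow> odd w"
  shows "unit_pairing l u (v * w) = unit_pairing l u v * unit_pairing l u w"
  using assms chi4_odd[of v] chi4_odd[of w] by (auto simp: unit_pairing_def chi4_mult)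

lemma hilbert_mult:
  assumes l: "prime l" and "B \<noteq> 0" "C \<noteq> 0"
  shows "hilbert l A (B * C) = hilbert l A B * hilbert l A C"
proof -
  have m: "multiplicity (int l) (B * C) = multiplicity (int l) B + multiplicity (int l) C"
    using assms by (simp add: prime_elem_multiplicity_mult_distrib)
  have "unit_pairing l (unit_part l A) (unit_part l B * unit_part l C) = unit_pairing l (unit_part l A) (unit_part l B) * unit_pairing l (unit_part l A) (unit_part l C)"
    using unit_part_unit[OF l] assms by (intro unit_pairing_mult) auto
  then show ?thesis
    by (simp add: hilbert_def Let_def m unit_part_mult assms unit_char_mult power_add power_mult_distrib algebra_simps)
qed

lemma hilbert_mult_left:
  assumes "prime l" "A \<noteq> 0" "B \<noteq> 0"
  shows "hilbert l (A * B) C = hilbert l A C * hilbert l B C"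
  using hilbert_mult[OF assms, of C] by (simp add: hilbert_sym[of l _ C])

lemma hilbert_values:
  assumes "prime l" "A \<noteq> 0" "B \<noteq> 0"
  shows "hilbert l A B \<in> {-1, 1}"
proof -
  have pm: "x ^ n \<in> {-1, 1}" if "x \<in> {-1, 1}" for x :: int and n
    using that by (induction n) auto
  have "unit_pairing l (unit_part l A) (unit_part l B) \<in> {-1, 1}" by (simp add: unit_pairing_def)
  then show ?thesis
    using pm[OF unit_char_minus_1, of l "multiplicity (int l) A * multiplicity (int l) B"]
      pm[OF unit_char_unit[OF assms(1) unit_part_unit[OF assms(1,2)]], of "multiplicity (int l) B"]
      pm[OF unit_char_unit[OF assms(1) unit_part_unit[OF assms(1,3)]], of "multiplicity (int l) A"] assms(1)
    by (auto simp: hilbert_def Let_def)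
qed

lemma hilbert_square:
  assumes "prime l" "A \<noteq> 0" "s \<noteq> 0"
  shows "hilbert l A (s\<^sup>2) = 1"
  using hilbert_mult[OF assms(1,3,3), of A] hilbert_values[OF assms] by (auto simp: power2_eq_square)

lemma hilbert_1: "prime l \<Longrightarrow> A \<noteq> 0 \<Longrightarrow> hilbert l A 1 = 1"
  using hilbert_square[of l A 1] by simp

lemma hilbert_units:
  assumes "l \<noteq> 2" "\<not> int l dvd A" "\<not> int l dvd B"
  shows "hilbert l A B = 1"
  using assms by (simp add: hilbert_def unit_pairing_def not_dvd_imp_multiplicity_0)

text \<open>By Hensel's lemma this is the condition for \<open>A\<close> to be a square in the \<open>l\<close>-adic numbers.\<close>
definition local_square :: "nat \<Rightarrow> int \<Rightarrow> bool" where
  "local_square l A \<longleftrightarrow> even (multiplicity (int l) A) \<and>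
     (if l = 2 then unit_part l A mod 8 = 1 else Legendre (unit_part l A) (int l) = 1)"

lemma multiplicity_self_int: "prime l \<Longrightarrow> multiplicity (int l) (int l) = 1"
  by (intro multiplicity_self) auto

lemma unit_part_self: "prime l \<Longrightarrow> unit_part l (int l) = 1"
  using prime_gt_0_nat[of l] by (simp add: unit_part_def multiplicity_self_int)

text \<open>
  If \<open>A\<close> has odd valuation, a unit with nontrivial \<open>unit_char\<close> works (at \<open>2\<close> the unit
  \<open>5\<close>, which pairs trivially with all units).  If the valuation is even, the uniformizer detects the units with
  nontrivial \<open>unit_char\<close>, and at \<open>2\<close> the unit \<open>-1\<close> detects those that are \<open>3\<close> modulo \<open>4\<close>.
\<close>
lemma hilbert_nondegenerate:
  assumes l: "prime l" and A: "A \<noteq> 0" and ns: "\<not> local_square l A"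
  shows "\<exists>B. B \<noteq> 0 \<and> hilbert l A B = -1"
proof (cases "l = 2")
  case True
  have odd: "odd (unit_part l A)" using unit_part_unit[OF l A] True by simp
  show ?thesis
  proof (cases "even (multiplicity (int l) A)")
    case elt: True
    then have "unit_part l A mod 8 \<noteq> 1" using ns True by (simp add: local_square_def)
    then have "unit_part l A mod 8 \<in> {3, 7} \<or> unit_part l A mod 8 = 5" using odd by auto presburger
    then show ?thesis
    proof
      assume "unit_part l A mod 8 \<in> {3, 7}"
      then have "unit_part l A mod 4 = 3" by auto presburger+
      then have "chi4 (unit_part l A) = -1" by (simp add: chi4_def)
      moreover have "chi4 (-1) = -1" "chi8 (-1) = 1" by (simp_all add: chi4_def chi8_def)
      ultimately have "hilbert l A (-1) = -1"
        using True by (simp add: hilbert_def unit_pairing_def unit_char_def unit_part_not_dvd not_dvd_imp_multiplicity_0)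
      then show ?thesis by (intro exI[of _ "-1"]) auto
    next
      assume *: "unit_part l A mod 8 = 5"
      have "chi4 1 = 1" "chi8 1 = 1" "chi8 (-1) = 1" by (simp_all add: chi4_def chi8_def)
      moreover have "chi8 (unit_part l A) = -1" using * by (simp add: chi8_def)
      ultimately have "hilbert l A (int l) = -1"
        unfolding hilbert_def Let_def multiplicity_self_int[OF l] unit_part_self[OF l]
        using True by (simp add: unit_pairing_def unit_char_def)
      then show ?thesis using l by (intro exI[of _ "int l"]) auto
    qed
  next
    case False
    have "chi4 5 = 1" "chi8 5 = -1" by (simp_all add: chi4_def chi8_def)
    moreover have "multiplicity (int l) 5 = 0" "unit_part l 5 = 5"
      using True by (simp_all add: unit_part_not_dvd not_dvd_imp_multiplicity_0)
    ultimately have "hilbert l A 5 = -1"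
      using True False by (simp add: hilbert_def unit_pairing_def unit_char_def)
    then show ?thesis by (intro exI[of _ 5]) auto
  qed
next
  case False
  then have l2: "2 < l" using prime_ge_2_nat[OF l] by simp
  show ?thesis
  proof (cases "even (multiplicity (int l) A)")
    case True
    then have "unit_char l (unit_part l A) \<noteq> 1" using ns False by (simp add: local_square_def unit_char_def)
    then have *: "unit_char l (unit_part l A) = -1" using unit_char_unit[OF l unit_part_unit[OF l A]] by auto
    have "unit_char l (-1) ^ multiplicity (int l) A = 1"
      using True unit_char_minus_1[OF l] by auto
    moreover have "unit_char l 1 = 1" using Legendre_1[OF l] False by (simp add: unit_char_def)
    ultimately have "hilbert l A (int l) = -1"
      unfolding hilbert_def Let_def multiplicity_self_int[OF l] unit_part_self[OF l]
      using False * by (simp add: unit_pairing_def)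
    then show ?thesis using l by (intro exI[of _ "int l"]) auto
  next
    case odd: False
    obtain n where n: "0 < n" "Legendre n (int l) = -1" using exists_nonresidue[OF l l2] by blast
    then have "\<not> int l dvd n" using Legendre_eq_0_iff[of n "int l"] by auto
    then have "hilbert l A n = -1"
      using odd False n by (simp add: hilbert_def unit_pairing_def unit_char_def unit_part_not_dvd not_dvd_imp_multiplicity_0)
    then show ?thesis using n by (intro exI[of _ n]) auto
  qed
qed

text \<open>
  If the symbol of \<open>P\<close> and \<open>Q\<close> is \<open>-1\<close>, bilinearity asks for an \<open>a\<close> that pairs to \<open>-1\<close> with \<open>P\<close> and with
  \<open>D\<close>.  Here \<open>Q\<close> does so with \<open>P\<close>, and some \<open>b\<close> does so with \<open>D\<close>; one of \<open>Q\<close>, \<open>b\<close>, \<open>Q b\<close> does both.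
\<close>
lemma local_common_slot:
  assumes l: "prime l" and nz: "P \<noteq> 0" "Q \<noteq> 0" "D \<noteq> 0"
    and "\<not> (hilbert l P Q = -1 \<and> local_square l D)"
  shows "\<exists>a. a \<noteq> 0 \<and> hilbert l P (Q * a) = 1 \<and> hilbert l (P * D) a = 1"
proof (cases "hilbert l P Q = 1")
  case True
  then show ?thesis using hilbert_1[OF l, of "P * D"] nz by (intro exI[of _ 1]) auto
next
  case False
  then have PQ: "hilbert l P Q = -1" using hilbert_values[OF l nz(1,2)] by auto
  have "\<not> local_square l D" using PQ assms by simp
  then obtain b where b: "b \<noteq> 0" "hilbert l D b = -1" using hilbert_nondegenerate[OF l nz(3)] by blast
  have *: "hilbert l P (Q * a) = - hilbert l P a" "hilbert l (P * D) a = hilbert l P a * hilbert l D a" if "a \<noteq> 0" for a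
    using hilbert_mult[OF l nz(2) that, of P] hilbert_mult_left[OF l nz(1,3), of a] PQ by simp_all
  obtain a where "a \<noteq> 0 \<and> hilbert l P a = -1 \<and> hilbert l D a = -1"
  proof (cases "hilbert l D Q = -1 \<or> hilbert l P b = -1")
    case True
    then show ?thesis using that PQ b nz by blast
  next
    case False
    then have "hilbert l D Q = 1" "hilbert l P b = 1" using hilbert_values[OF l] nz b by auto
    then show ?thesis using PQ b nz hilbert_mult[OF l nz(2) b(1)] by (intro that[of "Q * b"]) auto
  qed
  then show ?thesis using * by (intro exI[of _ a]) simp
qed

section \<open>The product formula\<close>

lemma unit_pairing_1: "unit_pairing l u 1 = 1"
  by (simp add: unit_pairing_def chi4_def)

lemma hilbert_unit_prime:
  assumes "prime l" "\<not> int l dvd A"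
  shows "hilbert l A (int l) = unit_char l A"
  unfolding hilbert_def Let_def multiplicity_self_int[OF assms(1)] unit_part_self[OF assms(1)]
  using assms by (simp add: unit_pairing_1 unit_part_not_dvd not_dvd_imp_multiplicity_0)

lemma hilbert_2_odd: "odd A \<Longrightarrow> odd B \<Longrightarrow> hilbert 2 A B = unit_pairing 2 A B"
  by (simp add: hilbert_def unit_part_not_dvd not_dvd_imp_multiplicity_0)

lemma hilbert_self:
  assumes "prime l"
  shows "hilbert l (int l) (int l) = unit_char l (-1)"
proof -
  have "unit_char l 1 = 1" using Legendre_1[OF assms] by (simp add: unit_char_def chi8_def)
  then show ?thesis
    unfolding hilbert_def Let_def multiplicity_self_int[OF assms(1)] unit_part_self[OF assms(1)]
    by (simp add: unit_pairing_1)
qed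

lemma int_prime_dvd_prime: "prime (l::nat) \<Longrightarrow> prime b \<Longrightarrow> int l dvd int b \<longleftrightarrow> l = b"
  using primes_dvd_imp_eq[of l b] by auto

context
  fixes T :: "nat set"
  assumes fin: "finite T" and T2: "2 \<in> T" and primes: "\<And>l. l \<in> T \<Longrightarrow> prime l"
begin

lemma prod_hilbert_support:
  assumes "S \<subseteq> T" "2 \<in> S" "\<And>l. l \<in> T - S \<Longrightarrow> \<not> int l dvd A \<and> \<not> int l dvd B"
  shows "(\<Prod>l\<in>T. hilbert l A B) = (\<Prod>l\<in>S. hilbert l A B)"
  using fin assms by (intro prod.mono_neutral_right) (auto intro!: hilbert_units)

lemma not_dvd_other: "l \<in> T \<Longrightarrow> b \<in> T \<Longrightarrow> l \<noteq> b \<Longrightarrow> \<not> l dvd b"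
  using primes primes_dvd_imp_eq by blast

text \<open>
  Only the factors at \<open>2\<close>, \<open>b\<close> and \<open>c\<close> can differ from \<open>1\<close>.  For distinct odd primes their product is
  the law of quadratic reciprocity; the other cases are its two supplements.
\<close>
lemma product_formula_primes:
  assumes "b \<in> T" "c \<in> T"
  shows "(\<Prod>l\<in>T. hilbert l (int b) (int c)) = 1"
proof -
  have pb: "prime b" and pc: "prime c" using assms primes by auto
  have "(\<Prod>l\<in>T. hilbert l (int b) (int c)) = (\<Prod>l\<in>{2, b, c}. hilbert l (int b) (int c))"
    using assms T2 not_dvd_other by (intro prod_hilbert_support) auto
  also have "\<dots> = 1"
  proof -
    have h22: "hilbert 2 2 2 = 1" using hilbert_self[of 2] by (simp add: unit_char_def chi8_def)
    have hb2: "hilbert 2 (int b) 2 * hilbert b (int b) 2 = 1" if b: "prime b" "b \<noteq> 2" for b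
    proof -
      have o: "odd b" "2 < b" using that prime_odd_nat prime_ge_2_nat[of b] by (auto simp: le_less)
      have "hilbert 2 (int b) 2 = chi8 (int b)" using hilbert_unit_prime[of 2 "int b"] o by (simp add: unit_char_def)
      moreover have "hilbert b 2 (int b) = Legendre 2 (int b)"
        using hilbert_unit_prime[OF b(1), of 2] int_prime_dvd_prime[OF b(1), of 2] that by (simp add: unit_char_def)
      ultimately show ?thesis
        using Legendre_2[OF b(1) o(2)] chi8_odd[of "int b"] o hilbert_sym[of b 2 "int b"] by auto
    qed
    consider "b = 2" "c = 2" | "b \<noteq> 2" "c = 2" | "b = 2" "c \<noteq> 2" | "b \<noteq> 2" "b = c" | "b \<noteq> 2" "c \<noteq> 2" "b \<noteq> c" by blast
    then show ?thesis
    proof cases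
      case 1
      then show ?thesis using h22 by simp
    next
      case 2
      then show ?thesis using hb2[OF pb] by (simp add: insert_commute mult.commute)
    next
      case 3
      then show ?thesis using hb2[OF pc] hilbert_sym[of _ 2 "int c"] by simp
    next
      case 4
      have o: "odd b" "2 < b" using 4 pb prime_odd_nat prime_ge_2_nat[of b] by (auto simp: le_less)
      have "hilbert b (int b) (int b) = chi4 (int b)"
        using hilbert_self[OF pb] 4 Legendre_minus_1[OF pb o(2)] by (simp add: unit_char_def)
      moreover have "hilbert 2 (int b) (int b) = chi4 (int b)"
        using hilbert_2_odd[of "int b" "int b"] o chi4_odd[of "int b"] by (auto simp: unit_pairing_def)
      ultimately show ?thesis using 4 chi4_odd[of "int b"] o by auto
    next
      case 5
      have b: "odd b" "2 < b" using 5 pb prime_odd_nat prime_ge_2_nat[of b] by (auto simp: le_less)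
      have c: "odd c" "2 < c" using 5 pc prime_odd_nat prime_ge_2_nat[of c] by (auto simp: le_less)
      have "hilbert c (int b) (int c) = Legendre (int b) (int c)"
        using hilbert_unit_prime[OF pc, of "int b"] int_prime_dvd_prime[OF pc pb] 5 by (simp add: unit_char_def)
      moreover have "hilbert b (int b) (int c) = Legendre (int c) (int b)"
        using hilbert_unit_prime[OF pb, of "int c"] int_prime_dvd_prime[OF pb pc] 5 hilbert_sym[of b "int b"] by (simp add: unit_char_def)
      moreover have "Legendre (int b) (int c) * Legendre (int c) (int b) = (-1) ^ ((b - 1) div 2 * ((c - 1) div 2))"
        using Quadratic_Reciprocity[OF pb b(2) pc c(2) 5(3)] by simp
      moreover have "hilbert 2 (int b) (int c) = (-1) ^ ((b - 1) div 2 * ((c - 1) div 2))"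
      proof -
        have par: "odd ((n - 1) div 2) \<longleftrightarrow> chi4 (int n) = -1" if "odd n" for n :: nat
        proof -
          define k where "k = n div 4"
          have "n mod 4 = 1 \<or> n mod 4 = 3" using that by presburger
          then show ?thesis
          proof
            assume n: "n mod 4 = 1"
            then have "n = 4 * k + 1" using k_def by presburger
            moreover then have "int n mod 4 = 1" by presburger
            ultimately show ?thesis by (simp add: chi4_def)
          next
            assume n: "n mod 4 = 3"
            then have "n = 4 * k + 3" using k_def by presburger
            moreover then have "int n mod 4 = 3" by presburger
            ultimately show ?thesis by (simp add: chi4_def)
          qed
        qed
        have "hilbert 2 (int b) (int c) = unit_pairing 2 (int b) (int c)" using b c by (intro hilbert_2_odd) auto
        also have "\<dots> = (-1) ^ ((b - 1) div 2 * ((c - 1) div 2))"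
          using par[OF b(1)] par[OF c(1)] by (auto simp: unit_pairing_def minus_one_power_iff)
        finally show ?thesis .
      qed
      ultimately have "hilbert 2 (int b) (int c) * (hilbert b (int b) (int c) * hilbert c (int b) (int c)) = 1"
        by (simp add: mult.commute flip: power_add)
      then show ?thesis using 5 by (simp add: insert_commute mult_ac)
    qed
  qed
  finally show ?thesis .
qed

lemma product_formula_minus_1:
  assumes "b \<in> T"
  shows "(\<Prod>l\<in>T. hilbert l (-1) (int b)) = 1"
proof -
  have pb: "prime b" using assms primes by auto
  have "(\<Prod>l\<in>T. hilbert l (-1) (int b)) = (\<Prod>l\<in>{2, b}. hilbert l (-1) (int b))"
    using assms T2 not_dvd_other primes[of "Suc 0"] by (intro prod_hilbert_support) auto
  also have "\<dots> = 1"
  proof (cases "b = 2")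
    case True
    then show ?thesis using hilbert_unit_prime[of 2 "-1"] by (simp add: unit_char_def chi8_def)
  next
    case False
    have o: "odd b" "2 < b" using False pb prime_odd_nat prime_ge_2_nat[of b] by (auto simp: le_less)
    have "hilbert b (-1) (int b) = chi4 (int b)"
      using hilbert_unit_prime[OF pb, of "-1"] o False Legendre_minus_1[OF pb o(2)] by (simp add: unit_char_def)
    moreover have "chi4 (-1) = -1" by (simp add: chi4_def)
    then have "hilbert 2 (-1) (int b) = chi4 (int b)"
      using hilbert_2_odd[of "-1" "int b"] o chi4_odd[of "int b"] by (auto simp: unit_pairing_def)
    ultimately show ?thesis using False chi4_odd[of "int b"] o by auto
  qed
  finally show ?thesis .
qed

lemma product_formula_extend:
  assumes "A \<noteq> 0" and base: "\<And>b. b \<in> T \<Longrightarrow> (\<Prod>l\<in>T. hilbert l A (int b)) = 1"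
    and "n > 0" and "\<And>r. prime r \<Longrightarrow> r dvd n \<Longrightarrow> r \<in> T"
  shows "(\<Prod>l\<in>T. hilbert l A (int n)) = 1"
  using assms(3,4)
proof (induction n rule: less_induct)
  case (less n)
  show ?case
  proof (cases "n = 1")
    case True
    then show ?thesis using assms(1) primes by (simp add: hilbert_1)
  next
    case False
    then obtain r where r: "prime r" "r dvd n" using prime_factor_nat by blast
    then obtain m where m: "n = r * m" by auto
    have "m > 0" using m less.prems by (cases m) auto
    have "m < n" using m \<open>m > 0\<close> prime_gt_1_nat[OF r(1)] by simp
    have "(\<Prod>l\<in>T. hilbert l A (int n)) = (\<Prod>l\<in>T. hilbert l A (int r) * hilbert l A (int m))"
      using primes r \<open>m > 0\<close> by (intro prod.cong) (auto simp: m hilbert_mult)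
    also have "\<dots> = 1"
      using base[of r] less.IH[OF \<open>m < n\<close> \<open>m > 0\<close>] less.prems(2) r m by (simp add: prod.distrib)
    finally show ?thesis .
  qed
qed

theorem hilbert_product_formula:
  assumes "A \<noteq> 0" "B > 0"
    and A: "\<And>r. prime r \<Longrightarrow> int r dvd A \<Longrightarrow> r \<in> T" and B: "\<And>r. prime r \<Longrightarrow> int r dvd B \<Longrightarrow> r \<in> T"
  shows "(\<Prod>l\<in>T. hilbert l A B) = 1"
proof -
  define n where "n = nat \<bar>A\<bar>"
  define m where "m = nat B"
  have n: "n > 0" "r dvd n \<longleftrightarrow> int r dvd A" for r using assms(1) by (auto simp: n_def)
  have m: "m > 0" "r dvd m \<longleftrightarrow> int r dvd B" "int m = B" for r using assms(2) by (auto simp: m_def int_dvd_int_iff[symmetric])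
  have sym: "(\<Prod>l\<in>T. hilbert l V Y) = (\<Prod>l\<in>T. hilbert l Y V)" for V Y
    by (intro prod.cong hilbert_sym refl)
  have 1: "(\<Prod>l\<in>T. hilbert l (int b) (int n)) = 1" if "b \<in> T" for b
    using that primes[OF that] n A by (intro product_formula_extend[OF _ product_formula_primes]) auto
  have pos: "(\<Prod>l\<in>T. hilbert l (int n) (int m)) = 1"
  proof (rule product_formula_extend)
    show "(\<Prod>l\<in>T. hilbert l (int n) (int b)) = 1" if "b \<in> T" for b
      using 1[OF that] sym[of "int n" "int b"] by simp
  qed (use n m B in auto)
  have neg: "(\<Prod>l\<in>T. hilbert l (-1) (int m)) = 1"
    using m B by (intro product_formula_extend[OF _ product_formula_minus_1]) auto
  show ?thesis
  proof (cases "A > 0")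
    case True
    then show ?thesis using pos m by (simp add: n_def)
  next
    case False
    then have A': "A = (-1) * int n" using assms(1) by (simp add: n_def)
    have "(\<Prod>l\<in>T. hilbert l A B) = (\<Prod>l\<in>T. hilbert l (-1) B * hilbert l (int n) B)"
      unfolding A' using primes n by (intro prod.cong hilbert_mult_left) auto
    then show ?thesis using pos neg m by (simp add: prod.distrib)
  qed
qed

end

section \<open>Legendre's theorem\<close>

lemma sqrt_mod_squarefree:
  assumes "squarefree (B :: int)" and "\<And>l. prime l \<Longrightarrow> int l dvd B \<Longrightarrow> \<exists>t. int l dvd t\<^sup>2 - A"
  shows "\<exists>t. B dvd t\<^sup>2 - A"
  using assms
proof (induction "nat \<bar>B\<bar>" arbitrary: B rule: less_induct)
  case less
  have B0: "B \<noteq> 0" using less.prems(1) by auto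
  show ?case
  proof (cases "\<bar>B\<bar> = 1")
    case True
    then show ?thesis by (metis abs_dvd_iff one_dvd)
  next
    case False
    then have "nat \<bar>B\<bar> \<noteq> 1" by auto
    then obtain l where l: "prime l" "l dvd nat \<bar>B\<bar>" using prime_factor_nat by blast
    then have lB: "int l dvd B" by auto
    then obtain C where C: "B = int l * C" by auto
    have sf: "squarefree C" using less.prems(1) C by (metis squarefree_mono dvd_triv_right)
    have "coprime (int l) C"
    proof (rule ccontr)
      assume "\<not> coprime (int l) C"
      then have "int l dvd C" using prime_imp_coprime[of "int l" C] l by auto
      then have "(int l)\<^sup>2 dvd B" by (simp add: C power2_eq_square)
      then have "int l dvd 1" using less.prems(1) squarefreeD by blast
      then show False using prime_gt_1_nat[OF l(1)] by simp
    qed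
    have "C \<noteq> 0" using B0 C by auto
    then have "\<bar>C\<bar> < \<bar>B\<bar>" using prime_gt_1_nat[OF l(1)] by (simp add: C abs_mult)
    then have "nat \<bar>C\<bar> < nat \<bar>B\<bar>" by simp
    moreover have "\<exists>t. int r dvd t\<^sup>2 - A" if "prime r" "int r dvd C" for r
      using less.prems(2)[OF that(1)] that(2) by (simp add: C)
    ultimately obtain u where u: "C dvd u\<^sup>2 - A" using less.hyps[of C] sf by blast
    obtain v where v: "int l dvd v\<^sup>2 - A" using less.prems(2)[OF l(1) lB] by blast
    obtain x where x: "[x = v] (mod int l)" "[x = u] (mod C)"
      using binary_chinese_remainder_int[OF \<open>coprime (int l) C\<close>] by blast
    have "[x\<^sup>2 = A] (mod int l)"
      using cong_trans[OF cong_pow[OF x(1), of 2]] v by (simp add: cong_iff_dvd_diff)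
    moreover have "[x\<^sup>2 = A] (mod C)"
      using cong_trans[OF cong_pow[OF x(2), of 2]] u by (simp add: cong_iff_dvd_diff)
    ultimately have "B dvd x\<^sup>2 - A"
      using \<open>coprime (int l) C\<close> unfolding C by (simp add: cong_iff_dvd_diff divides_mult)
    then show ?thesis by blast
  qed
qed

text \<open>Taking the root of least absolute value is what makes the descent below decrease.\<close>
lemma small_sqrt_mod:
  assumes "B \<noteq> 0" "B dvd t\<^sup>2 - (A::int)"
  obtains s where "B dvd s\<^sup>2 - A" "2 * \<bar>s\<bar> \<le> \<bar>B\<bar>"
proof -
  define r where "r = t mod \<bar>B\<bar>"
  have r: "0 \<le> r" "r < \<bar>B\<bar>" using assms(1) by (auto simp: r_def)
  have cong: "B dvd s\<^sup>2 - A" if "B dvd s - t" for s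
  proof -
    have "s\<^sup>2 - A = (s - t) * (s + t) + (t\<^sup>2 - A)" by (simp add: power2_eq_square algebra_simps)
    moreover have "B dvd (s - t) * (s + t)" using that by simp
    ultimately show ?thesis using assms(2) by (metis dvd_add)
  qed
  have Br: "B dvd r - t"
  proof -
    have "r - t = \<bar>B\<bar> * (- (t div \<bar>B\<bar>))" unfolding r_def by (simp add: minus_div_mult_eq_mod[symmetric])
    then show ?thesis by (metis abs_dvd_iff dvd_triv_left)
  qed
  show ?thesis
  proof (cases "2 * r \<le> \<bar>B\<bar>")
    case True
    then show ?thesis using that[of r] cong[OF Br] r by simp
  next
    case False
    have "B dvd (r - \<bar>B\<bar>) - t" 
    proof -
      have "B dvd (r - t) - \<bar>B\<bar>" by (rule dvd_diff[OF Br]) simp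
      then show ?thesis by (simp add: algebra_simps)
    qed
    then show ?thesis using that[of "r - \<bar>B\<bar>"] cong False r by auto
  qed
qed

lemma squarefree_multiplicity_le_1:
  assumes "squarefree A" "prime l"
  shows "multiplicity (int l) A \<le> 1"
proof (rule ccontr)
  assume "\<not> ?thesis"
  then have "2 \<le> multiplicity (int l) A" by simp
  then have "(int l)\<^sup>2 dvd A" by (rule multiplicity_dvd')
  then have "int l dvd 1" by (rule squarefreeD[OF assms(1)])
  then show False using prime_gt_1_nat[OF assms(2)] by simp
qed

lemma squarefree_multiplicity_eq_1:
  assumes "squarefree A" "prime l" "int l dvd A"
  shows "multiplicity (int l) A = 1"
proof -
  have "A \<noteq> 0" using assms(1) by auto
  then have "multiplicity (int l) A > 0" using assms by (simp add: prime_multiplicity_gt_zero_iff)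
  then show ?thesis using squarefree_multiplicity_le_1[OF assms(1,2)] by simp
qed

lemma Legendre_square:
  assumes "\<not> l dvd t" "prime l" "[N = t\<^sup>2] (mod l)"
  shows "Legendre N l = 1"
proof -
  have "\<not> l dvd N" using assms by (metis cong_dvd_iff prime_dvd_power)
  then show ?thesis using cong_sym[OF assms(3)] by (auto simp: Legendre_def QuadRes_def cong_0_iff)
qed

text \<open>
  The integer \<open>t\<^sup>2 - A\<close> is a norm from the field generated by the square root of \<open>A\<close>.  If \<open>l\<close> divides it but not
  \<open>A\<close>, then \<open>A\<close> is a square modulo \<open>l\<close>; if \<open>l\<close> divides \<open>A\<close>, then \<open>t\<^sup>2 - A\<close> is either a unit square modulo
  \<open>l\<close>, or \<open>l\<close> times a unit congruent to \<open>- A / l\<close>.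
\<close>
lemma hilbert_norm:
  assumes l: "prime l" "l \<noteq> 2" and A: "squarefree A" and N0: "t\<^sup>2 - A \<noteq> 0"
  shows "hilbert l A (t\<^sup>2 - A) = 1"
proof -
  define N where "N = t\<^sup>2 - A"
  have A0: "A \<noteq> 0" using A by auto
  have pl: "prime (int l)" using l by simp
  have l2: "2 < l" using l prime_ge_2_nat[of l] by simp
  have "hilbert l A N = 1"
  proof (cases "int l dvd A")
    case False
    then have vA: "multiplicity (int l) A = 0" "unit_part l A = A" by (simp_all add: not_dvd_imp_multiplicity_0 unit_part_not_dvd)
    show ?thesis
    proof (cases "int l dvd N")
      case True
      then have "[A = t\<^sup>2] (mod int l)" by (metis N_def cong_iff_dvd_diff cong_sym)
      moreover have "\<not> int l dvd t"
      proof
        assume "int l dvd t"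
        then have "int l dvd t\<^sup>2" by (simp add: power2_eq_square)
        then have "int l dvd A" using True by (metis N_def dvd_diff_right_iff dvd_diff_commute)
        then show False using False by simp
      qed
      ultimately have "Legendre A (int l) = 1" using pl by (intro Legendre_square) auto
      then show ?thesis using vA l by (simp add: hilbert_def unit_pairing_def unit_char_def)
    next
      case nd: False
      then show ?thesis using False l by (intro hilbert_units) auto
    qed
  next
    case True
    have vA: "multiplicity (int l) A = 1" by (rule squarefree_multiplicity_eq_1[OF A l(1) True])
    define u where "u = unit_part l A"
    have u: "A = int l * u" "\<not> int l dvd u" using unit_part_decomp[of A l] vA unit_part_unit[OF l(1) A0] by (simp_all add: u_def)
    show ?thesis
    proof (cases "int l dvd t")
      case False
      then have nN: "\<not> int l dvd N" using True pl unfolding N_def by (metis dvd_diff_right_iff dvd_diff_commute prime_dvd_power)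
      have "[N = t\<^sup>2] (mod int l)" using True by (simp add: N_def cong_iff_dvd_diff)
      then have "Legendre N (int l) = 1" using False pl by (intro Legendre_square) auto
      then show ?thesis using nN vA l by (simp add: hilbert_def unit_pairing_def unit_char_def not_dvd_imp_multiplicity_0 unit_part_not_dvd)
    next
      case lt: True
      then obtain s where s: "t = int l * s" by auto
      define w where "w = int l * s\<^sup>2 - u"
      have w: "N = int l * w" unfolding N_def w_def s u(1) by (simp add: power2_eq_square algebra_simps)
      have nw: "\<not> int l dvd w" using u(2) unfolding w_def by (metis dvd_diff_right_iff dvd_triv_left)
      have w0: "w \<noteq> 0" using nw by auto
      have vN: "multiplicity (int l) N = 1" unfolding w using w0 nw pl
        by (subst prime_elem_multiplicity_mult_distrib) (auto simp: not_dvd_imp_multiplicity_0 multiplicity_self_int[OF l(1)])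
      have uN: "unit_part l N = w"
        unfolding w using unit_part_mult[OF l(1), of "int l" w] w0 l nw by (simp add: unit_part_self unit_part_not_dvd prime_gt_0_nat)
      have "hilbert l A N = unit_char l (-1) * unit_char l u * unit_char l w"
        unfolding hilbert_def Let_def vA vN uN u_def[symmetric] using l by (simp add: unit_pairing_def)
      also have "\<dots> = unit_char l ((-1) * u * w)" by (simp only: unit_char_mult[OF l(1)])
      also have "\<dots> = Legendre (- (u * w)) (int l)" using l by (simp add: unit_char_def)
      also have "\<dots> = 1"
      proof (rule Legendre_square[OF u(2) pl])
        have "- (u * w) - u\<^sup>2 = int l * (- (u * s\<^sup>2))" by (simp add: w_def power2_eq_square algebra_simps)
        then show "[- (u * w) = u\<^sup>2] (mod int l)" by (simp add: cong_iff_dvd_diff)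
      qed
      finally show ?thesis .
    qed
  qed
  then show ?thesis by (simp add: N_def)
qed

definition conic_solvable :: "int \<Rightarrow> int \<Rightarrow> bool" where
  "conic_solvable A B \<longleftrightarrow> (\<exists>x y z. (x, y, z) \<noteq> (0, 0, 0) \<and> x\<^sup>2 = A * y\<^sup>2 + B * z\<^sup>2)"

lemma conic_solvable_sym: "conic_solvable A B \<longleftrightarrow> conic_solvable B A"
  unfolding conic_solvable_def by (metis add.commute prod.inject)

text \<open>
  Norms are multiplicative: \<open>B B' m\<^sup>2\<close> is the norm of \<open>t + \<surd>A\<close> and \<open>B' z\<^sup>2\<close> that of \<open>x + y \<surd>A\<close>, so
  \<open>B\<close> times a square is the norm of the product.
\<close>
lemma conic_descent:
  assumes "conic_solvable A B'" "t\<^sup>2 - A = B * (B' * m\<^sup>2)" "B' \<noteq> 0" "m \<noteq> 0"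
  shows "conic_solvable A B"
proof -
  obtain x y z where xyz: "(x, y, z) \<noteq> (0, 0, 0)" "x\<^sup>2 = A * y\<^sup>2 + B' * z\<^sup>2"
    using assms(1) by (auto simp: conic_solvable_def)
  show ?thesis
  proof (cases "z = 0")
    case True
    then show ?thesis using xyz unfolding conic_solvable_def by (intro exI[of _ x] exI[of _ y] exI[of _ 0]) auto
  next
    case False
    have "(t * x + A * y)\<^sup>2 - A * (t * y + x)\<^sup>2 = (t\<^sup>2 - A) * (x\<^sup>2 - A * y\<^sup>2)"
      by (simp add: power2_eq_square algebra_simps)
    also have "\<dots> = B * (B' * m\<^sup>2) * (B' * z\<^sup>2)" using xyz(2) by (simp add: assms(2))
    also have "\<dots> = B * (B' * m * z)\<^sup>2" by (simp add: power2_eq_square algebra_simps)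
    finally show ?thesis
      using False assms(3,4) unfolding conic_solvable_def
      by (intro exI[of _ "t * x + A * y"] exI[of _ "t * y + x"] exI[of _ "B' * m * z"]) (auto simp: algebra_simps)
  qed
qed

text \<open>
  Legendre's descent on \<open>\<bar>A\<bar> + \<bar>B\<bar>\<close>.  When \<open>\<bar>A\<bar> \<le> \<bar>B\<bar>\<close>, the symbols make \<open>A\<close> a square modulo \<open>B\<close>, so
  \<open>t\<^sup>2 - A = B B' m\<^sup>2\<close> with \<open>t\<close> small and \<open>\<bar>B'\<bar> < \<bar>B\<bar>\<close>.  By \<open>hilbert_norm\<close> the pair \<open>A\<close>, \<open>B'\<close> has the same
  symbols, and \<open>conic_descent\<close> carries its solution back.  The prime \<open>2\<close> imposes nothing, because every
  integer is a square modulo \<open>2\<close>.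
\<close>
theorem legendre_squarefree:
  assumes "squarefree A" "squarefree B" "\<not> (A < 0 \<and> B < 0)"
    and "\<And>l. prime l \<Longrightarrow> l \<noteq> 2 \<Longrightarrow> hilbert l A B = 1"
  shows "conic_solvable A B"
  using assms
proof (induction "nat (\<bar>A\<bar> + \<bar>B\<bar>)" arbitrary: A B rule: less_induct)
  case less
  have main: "conic_solvable A B"
    if AB: "squarefree A" "squarefree B" "\<not> (A < 0 \<and> B < 0)" "\<bar>A\<bar> \<le> \<bar>B\<bar>"
      and h: "\<And>l. prime l \<Longrightarrow> l \<noteq> 2 \<Longrightarrow> hilbert l A B = 1"
      and IH: "\<And>B'. \<bar>B'\<bar> < \<bar>B\<bar> \<Longrightarrow> squarefree B' \<Longrightarrow> \<not> (A < 0 \<and> B' < 0) \<Longrightarrow>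
        (\<And>l. prime l \<Longrightarrow> l \<noteq> 2 \<Longrightarrow> hilbert l A B' = 1) \<Longrightarrow> conic_solvable A B'" for A B
  proof -
    have nz: "A \<noteq> 0" "B \<noteq> 0" using AB by auto
    show ?thesis
    proof (cases "\<bar>B\<bar> = 1")
      case True
      then have "A = 1 \<or> B = 1" using AB nz by linarith
      then show ?thesis unfolding conic_solvable_def
        by (elim disjE; intro exI[of _ 1] exI[of _ "if A = 1 then 1 else 0"] exI[of _ "if A = 1 then 0 else 1"]) auto
    next
      case False
      then have B2: "\<bar>B\<bar> \<ge> 2" using nz by linarith
      have "\<exists>t. int l dvd t\<^sup>2 - A" if l: "prime l" "int l dvd B" for l
      proof (cases "l = 2 \<or> int l dvd A")
        case True
        then show ?thesis
        proof
          assume "l = 2"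
          then have "int l dvd A\<^sup>2 - A" by (simp add: power2_eq_square)
          then show ?thesis by blast
        next
          assume "int l dvd A"
          then show ?thesis by (intro exI[of _ 0]) simp
        qed
      next
        case False
        have "Legendre A (int l) = 1"
          using h[OF l(1)] False squarefree_multiplicity_eq_1[OF AB(2) l]
          by (simp add: hilbert_def unit_pairing_def unit_char_def not_dvd_imp_multiplicity_0 unit_part_not_dvd)
        then obtain t where "[t\<^sup>2 = A] (mod int l)" by (auto simp: Legendre_def QuadRes_def split: if_splits)
        then show ?thesis by (auto simp: cong_iff_dvd_diff)
      qed
      then obtain t0 where "B dvd t0\<^sup>2 - A" using sqrt_mod_squarefree[OF AB(2)] by blast
      then obtain t where t: "B dvd t\<^sup>2 - A" "2 * \<bar>t\<bar> \<le> \<bar>B\<bar>" by (rule small_sqrt_mod[OF nz(2)])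
      then obtain B1 where B1: "t\<^sup>2 - A = B * B1" by auto
      show ?thesis
      proof (cases "B1 = 0")
        case True
        then show ?thesis using B1 unfolding conic_solvable_def
          by (intro exI[of _ t] exI[of _ 1] exI[of _ 0]) auto
      next
        case B1nz: False
        define B' m where "B' = squarefree_part B1" and "m = square_part B1"
        have B1': "B1 = B' * m\<^sup>2" unfolding B'_def m_def by (rule squarefree_decompose)
        then have nz': "B' \<noteq> 0" "m \<noteq> 0" using B1nz by auto
        have "\<bar>B1\<bar> < \<bar>B\<bar>"
        proof (rule ccontr)
          assume "\<not> ?thesis"
          then have "\<bar>B\<bar> * \<bar>B\<bar> \<le> \<bar>B\<bar> * \<bar>B1\<bar>" by (intro mult_left_mono) auto
          also have "\<dots> = \<bar>t\<^sup>2 - A\<bar>" by (simp add: B1 abs_mult)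
          also have "\<dots> \<le> t\<^sup>2 + \<bar>B\<bar>" using AB(4) zero_le_power2[of t] by linarith
          finally have "4 * (\<bar>B\<bar> * \<bar>B\<bar>) \<le> (2 * \<bar>t\<bar>) * (2 * \<bar>t\<bar>) + 4 * \<bar>B\<bar>" by (simp add: power2_eq_square)
          also have "\<dots> \<le> \<bar>B\<bar> * \<bar>B\<bar> + 4 * \<bar>B\<bar>" using t(2) by (intro add_right_mono mult_mono) auto
          finally have "3 * \<bar>B\<bar> * \<bar>B\<bar> \<le> 4 * \<bar>B\<bar>" by linarith
          then have "3 * \<bar>B\<bar> \<le> 4" using nz(2) by simp
          then show False using B2 by linarith
        qed
        moreover have "\<bar>B'\<bar> \<le> \<bar>B1\<bar>"
          unfolding B1' abs_mult using nz' mult_left_mono[of 1 "\<bar>m\<^sup>2\<bar>" "\<bar>B'\<bar>"]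
          by (simp add: zero_less_power2 int_one_le_iff_zero_less)
        ultimately have "\<bar>B'\<bar> < \<bar>B\<bar>" by linarith
        moreover have "squarefree B'" unfolding B'_def by simp
        moreover have "\<not> (A < 0 \<and> B' < 0)"
        proof
          assume neg: "A < 0 \<and> B' < 0"
          then have "B > 0" using AB(3) nz by linarith
          moreover have "B * B1 > 0" using B1[symmetric] neg zero_le_power2[of t] by linarith
          ultimately have "B' * m\<^sup>2 > 0" using B1' by (simp add: zero_less_mult_iff)
          then show False using neg by (simp add: zero_less_mult_iff not_less[symmetric])
        qed
        moreover have "hilbert l A B' = 1" if l: "prime l" "l \<noteq> 2" for l
        proof -
          have "hilbert l A (B * B1) = 1" using hilbert_norm[OF l AB(1), of t] B1 B1nz nz by simp
          then have "hilbert l A B1 = 1" using hilbert_mult[OF l(1) nz(2) B1nz, of A] h[OF l] by simp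
          then show ?thesis
            using hilbert_mult[OF l(1) nz'(1), of "m\<^sup>2" A] hilbert_square[OF l(1) nz(1) nz'(2)] nz' by (simp add: B1')
        qed
        ultimately have "conic_solvable A B'" by (rule IH)
        then show ?thesis using B1 nz' by (intro conic_descent[of A B' t B m]) (auto simp: B1')
      qed
    qed
  qed
  show ?case
  proof (cases "\<bar>A\<bar> \<le> \<bar>B\<bar>")
    case True
    show ?thesis
    proof (rule main)
      show "conic_solvable A B'" if "\<bar>B'\<bar> < \<bar>B\<bar>" "squarefree B'" "\<not> (A < 0 \<and> B' < 0)"
        "\<And>l. prime l \<Longrightarrow> l \<noteq> 2 \<Longrightarrow> hilbert l A B' = 1" for B'
        using that less.prems by (intro less.hyps) auto
    qed (use less.prems True in auto)
  next
    case False
    have "conic_solvable B A"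
    proof (rule main)
      show "conic_solvable B A'" if "\<bar>A'\<bar> < \<bar>A\<bar>" "squarefree A'" "\<not> (B < 0 \<and> A' < 0)"
        "\<And>l. prime l \<Longrightarrow> l \<noteq> 2 \<Longrightarrow> hilbert l B A' = 1" for A'
        using that less.prems by (intro less.hyps) auto
    qed (use less.prems False hilbert_sym[of _ B A] in auto)
    then show ?thesis by (simp add: conic_solvable_sym)
  qed
qed

theorem legendre_conic:
  assumes nz: "A \<noteq> 0" "B \<noteq> 0" and "\<not> (A < 0 \<and> B < 0)"
    and h: "\<And>l. prime l \<Longrightarrow> l \<noteq> 2 \<Longrightarrow> hilbert l A B = 1"
  shows "conic_solvable A B"
proof -
  define a s b t where "a = squarefree_part A" and "s = square_part A"
    and "b = squarefree_part B" and "t = square_part B"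
  have A: "A = a * s\<^sup>2" and B: "B = b * t\<^sup>2" unfolding a_def s_def b_def t_def by (rule squarefree_decompose)+
  have nz': "a \<noteq> 0" "s \<noteq> 0" "b \<noteq> 0" "t \<noteq> 0" using nz A B by auto
  have "conic_solvable a b"
  proof (rule legendre_squarefree)
    show "squarefree a" "squarefree b" by (simp_all add: a_def b_def)
    show "\<not> (a < 0 \<and> b < 0)"
      using assms(3) nz' by (auto simp: A B mult_less_0_iff)
    fix l :: nat assume l: "prime l" "l \<noteq> 2"
    have "1 = hilbert l (a * s\<^sup>2) (b * t\<^sup>2)" using h[OF l] A B by simp
    also have "\<dots> = hilbert l a b"
      using nz' hilbert_square[OF l(1), of _ s] hilbert_square[OF l(1), of _ t] hilbert_sym[of l "s\<^sup>2"]
      by (simp add: hilbert_mult[OF l(1)] hilbert_mult_left[OF l(1)])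
    finally show "hilbert l a b = 1" by simp
  qed
  then obtain x y z where "(x, y, z) \<noteq> (0, 0, 0)" "x\<^sup>2 = a * y\<^sup>2 + b * z\<^sup>2"
    by (auto simp: conic_solvable_def)
  moreover then have "(x * s * t)\<^sup>2 = A * (y * t)\<^sup>2 + B * (z * s)\<^sup>2"
    by (simp add: A B power_mult_distrib algebra_simps)
  ultimately show ?thesis unfolding conic_solvable_def using nz'
    by (intro exI[of _ "x * s * t"] exI[of _ "y * t"] exI[of _ "z * s"]) auto
qed

section \<open>Solving quaternary forms\<close>

lemma chi4_cong: "a mod 8 = b mod 8 \<Longrightarrow> chi4 a = chi4 b"
proof -
  assume "a mod 8 = b mod 8"
  then have "(a mod 8) mod 4 = (b mod 8) mod 4" by simp
  then have "a mod 4 = b mod 4" by (simp add: mod_mod_cancel)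
  then show ?thesis by (simp add: chi4_def)
qed

lemma chi8_cong: "a mod 8 = b mod 8 \<Longrightarrow> chi8 a = chi8 b"
  by (simp add: chi8_def)

text \<open>
  The characters are indexed by natural numbers: an odd prime \<open>l\<close> stands for the Legendre symbol modulo
  \<open>l\<close>, and the composite indices \<open>4\<close> and \<open>8\<close> for \<open>chi4\<close> and \<open>chi8\<close>.  Independence is the
  Chinese remainder theorem.
\<close>
theorem exists_prime_with_residues:
  fixes T :: "nat set" and e :: "nat \<Rightarrow> int"
  assumes fin: "finite T" and T: "\<And>l. l \<in> T \<Longrightarrow> prime l \<and> l \<noteq> 2"
    and e: "\<And>l. l \<in> T \<Longrightarrow> e l \<in> {-1, 1}" and s: "s4 \<in> {-1, 1 :: int}" "s8 \<in> {-1, 1 :: int}"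
  shows "\<exists>r. prime r \<and> r \<noteq> 2 \<and> r \<notin> T \<and> (\<forall>l\<in>T. Legendre (int r) (int l) = e l)
      \<and> chi4 (int r) = s4 \<and> chi8 (int r) = s8"
proof -
  define M where "M = 8 * \<Prod>T"
  define I where "I = insert 4 (insert 8 T)"
  have np: "4 \<notin> T" "8 \<notin> T"
    using prime_product[of 2 2] prime_product[of 2 4] T[of 4] T[of 8] by auto
  have pos: "\<Prod>T > 0" using T prime_gt_0_nat by (intro prod_pos) auto
  have M1: "M > 1" using pos by (simp add: M_def)
  have cop: "coprime n M \<longleftrightarrow> odd n \<and> (\<forall>l\<in>T. \<not> l dvd n)" for n
  proof
    assume c: "coprime n M"
    have "2 dvd M" by (simp add: M_def)
    moreover have "l dvd M" if "l \<in> T" for l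
      unfolding M_def using fin that by (intro dvd_mult dvd_prodI[where f = id, simplified]) auto
    ultimately show "odd n \<and> (\<forall>l\<in>T. \<not> l dvd n)"
      using c T by (meson coprime_common_divisor_nat not_prime_1 two_is_prime_nat coprime_common_divisor not_prime_unit)
  next
    assume "odd n \<and> (\<forall>l\<in>T. \<not> l dvd n)"
    then have n: "odd n" "\<And>l. l \<in> T \<Longrightarrow> \<not> l dvd n" by auto
    have "coprime n 8" using n(1) coprime_power_right_iff[of n 2 3] by simp
    moreover have "coprime (\<Prod>T) n"
      using T n(2) prod_coprime_left[of T "\<lambda>l. l" n] by (simp add: prime_imp_coprime)
    ultimately show "coprime n M" by (simp add: M_def coprime_commute)
  qed
  define \<psi> where "\<psi> = (\<lambda>i n. if coprime n M then
      real_of_int (if i = 4 then chi4 (int n) else if i = 8 then chi8 (int n) else Legendre (int n) (int i)) else 0)"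
  have \<psi>T: "\<psi> l n = real_of_int (Legendre (int n) (int l))" if "l \<in> T" "coprime n M" for l n
    using that np by (auto simp: \<psi>_def)
  have chr: "real_character M (\<psi> i)" if i: "i \<in> I" for i
  proof
    show "M > 1" by (rule M1)
    show "\<psi> i (m * n) = \<psi> i m * \<psi> i n" for m n
    proof -
      have "Legendre (int m * int n) (int i) = Legendre (int m) (int i) * Legendre (int n) (int i)" if "i \<in> T"
        using T[OF that] prime_ge_2_nat[of i] by (intro Legendre_mult) auto
      then show ?thesis using i by (auto simp: \<psi>_def I_def chi4_mult chi8_mult)
    qed
    show "\<psi> i (n + M) = \<psi> i n" for n
    proof -
      have "coprime (n + M) M \<longleftrightarrow> coprime n M" by (simp only: coprime_iff_gcd_eq_1 gcd_add1)
      moreover have "int (n + M) mod 8 = int n mod 8" by (simp add: M_def)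
      moreover have "Legendre (int (n + M)) (int i) = Legendre (int n) (int i)" if "i \<in> T"
      proof (rule Legendre_cong)
        have "i dvd M" unfolding M_def using fin that by (intro dvd_mult dvd_prodI[where f = id, simplified]) auto
        then show "[int (n + M) = int n] (mod int i)" by (simp add: cong_iff_dvd_diff)
      qed
      ultimately show ?thesis
        using i chi4_cong[of "int (n + M)" "int n"] chi8_cong[of "int (n + M)" "int n"] by (auto simp: \<psi>_def I_def)
    qed
    show "\<psi> i n = 0 \<longleftrightarrow> \<not> coprime n M" for n
    proof (cases "coprime n M")
      case True
      then have n: "odd (int n)" "i \<in> T \<Longrightarrow> \<not> int i dvd int n" using cop by auto
      have "chi4 (int n) \<noteq> 0" "chi8 (int n) \<noteq> 0" using chi4_odd[OF n(1)] chi8_odd[OF n(1)] by auto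
      moreover have "i \<in> T \<Longrightarrow> Legendre (int n) (int i) \<noteq> 0" using n(2) Legendre_eq_0_iff by blast
      ultimately have "\<psi> i n \<noteq> 0"
        using True i unfolding \<psi>_def I_def by (cases "i = 4"; cases "i = 8") simp_all
      then show ?thesis using True by blast
    qed (simp add: \<psi>_def)
    show "\<psi> i n \<in> {-1, 0, 1}" for n
    proof -
      define k where "k = (if i = 4 then chi4 (int n) else if i = 8 then chi8 (int n) else Legendre (int n) (int i))"
      have "chi4 (int n) \<in> {-1, 0, 1}" "chi8 (int n) \<in> {-1, 0, 1}" by (simp_all add: chi4_def chi8_def)
      then have "k \<in> {-1, 0, 1}" using Legendre_values[of "int n" "int i"] by (simp add: k_def)
      moreover have "\<psi> i n = (if coprime n M then real_of_int k else 0)" by (simp only: \<psi>_def k_def)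
      ultimately show ?thesis by (elim insertE) simp_all
    qed
  qed
  have crt: "\<exists>a. [a = u 2] (mod 8) \<and> (\<forall>l\<in>T. [a = u l] (mod l))" for u :: "nat \<Rightarrow> nat"
  proof -
    define m where "m = (\<lambda>l::nat. l ^ (if l = 2 then 3 else 1))"
    have "\<forall>i\<in>insert 2 T. \<forall>j\<in>insert 2 T. i \<noteq> j \<longrightarrow> coprime (m i) (m j)"
    proof (intro ballI impI)
      fix i j assume ij: "i \<in> insert 2 T" "j \<in> insert 2 T" "i \<noteq> j"
      then have "prime i" "prime j" using T by auto
      then have "coprime i j" using ij(3) by (rule primes_coprime)
      then show "coprime (m i) (m j)" unfolding m_def by simp
    qed
    then have "\<exists>a. \<forall>i\<in>insert 2 T. [a = u i] (mod m i)" using fin by (intro chinese_remainder_nat) auto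
    then obtain a where a: "\<And>i. i \<in> insert 2 T \<Longrightarrow> [a = u i] (mod m i)" by blast
    have "[a = u 2] (mod 8)" using a[of 2] by (simp add: m_def)
    moreover have "[a = u l] (mod l)" if "l \<in> T" for l using a[of l] T[OF that] that by (simp add: m_def)
    ultimately show ?thesis by blast
  qed
  have elt: "coprime a M \<and> chi4 (int a) = chi4 (int (u 2)) \<and> chi8 (int a) = chi8 (int (u 2)) \<and>
      (\<forall>l\<in>T. Legendre (int a) (int l) = Legendre (int (u l)) (int l))"
    if a: "[a = u 2] (mod 8)" "\<forall>l\<in>T. [a = u l] (mod l)" and u: "odd (u 2)" "\<forall>l\<in>T. \<not> l dvd u l" for a u
  proof -
    have "[a = u 2] (mod 2)" using a(1) by (rule cong_dvd_modulus_nat) simp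
    then have "odd a" using u(1) by (metis cong_dvd_iff)
    moreover have "\<not> l dvd a" if "l \<in> T" for l using a(2) u(2) that cong_dvd_iff by blast
    moreover have "int a mod 8 = int (u 2) mod 8" using a(1) by (metis cong_def of_nat_mod of_nat_numeral)
    moreover have "Legendre (int a) (int l) = Legendre (int (u l)) (int l)" if "l \<in> T" for l
      using a(2) that by (intro Legendre_cong) (simp add: cong_int_iff)
    ultimately show ?thesis using cop chi4_cong chi8_cong by blast
  qed
  have one: "Legendre 1 (int l) = 1" if "l \<in> T" for l using T that Legendre_1 by blast
  have n1: "\<not> l dvd Suc 0" if "l \<in> T" for l using T[OF that] by auto
  have indep: "\<exists>a. \<psi> i a = -1 \<and> (\<forall>j\<in>I - {i}. \<psi> j a = 1)" if i: "i \<in> I" for i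
  proof -
    consider "i = 4" | "i = 8" | "i \<in> T" using i by (auto simp: I_def)
    then show ?thesis
    proof cases
      case 1
      define u where "u = (\<lambda>l::nat. if l = 2 then 7 else 1 :: nat)"
      obtain a where "[a = u 2] (mod 8)" "\<forall>l\<in>T. [a = u l] (mod l)" using crt[of u] by blast
      then have "coprime a M \<and> chi4 (int a) = -1 \<and> chi8 (int a) = 1 \<and> (\<forall>l\<in>T. Legendre (int a) (int l) = 1)"
        using elt[of a u] T n1 one by (auto simp: u_def chi4_def chi8_def)
      then show ?thesis using 1 np by (intro exI[of _ a]) (auto simp: \<psi>_def I_def)
    next
      case 2
      define u where "u = (\<lambda>l::nat. if l = 2 then 5 else 1 :: nat)"
      obtain a where "[a = u 2] (mod 8)" "\<forall>l\<in>T. [a = u l] (mod l)" using crt[of u] by blast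
      then have "coprime a M \<and> chi4 (int a) = 1 \<and> chi8 (int a) = -1 \<and> (\<forall>l\<in>T. Legendre (int a) (int l) = 1)"
        using elt[of a u] T n1 one by (auto simp: u_def chi4_def chi8_def)
      then show ?thesis using 2 np by (intro exI[of _ a]) (auto simp: \<psi>_def I_def)
    next
      case 3
      then have "prime i" "2 < i" using T prime_ge_2_nat[of i] by (auto simp: le_less)
      then obtain n where n: "0 < n" "Legendre n (int i) = -1" using exists_nonresidue by blast
      define u where "u = (\<lambda>l::nat. if l = i then nat n else 1 :: nat)"
      have "\<not> int i dvd n" using n Legendre_eq_0_iff[of n "int i"] by auto
      then have ni: "\<not> i dvd nat n" using n(1) by (metis int_dvd_int_iff int_nat_eq less_imp_le)
      obtain a where "[a = u 2] (mod 8)" "\<forall>l\<in>T. [a = u l] (mod l)" using crt[of u] by blast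
      then have "coprime a M \<and> chi4 (int a) = chi4 1 \<and> chi8 (int a) = chi8 1 \<and>
          (\<forall>l\<in>T. Legendre (int a) (int l) = Legendre (int (u l)) (int l))"
        using elt[of a u] T[OF 3] n1 ni by (auto simp: u_def)
      moreover have "Legendre (int (u l)) (int l) = (if l = i then -1 else 1)" if "l \<in> T" for l
        using n one[OF that] by (simp add: u_def)
      ultimately have c: "coprime a M" "chi4 (int a) = 1" "chi8 (int a) = 1"
        and L: "\<And>l. l \<in> T \<Longrightarrow> Legendre (int a) (int l) = (if l = i then -1 else 1)"
        by (simp_all add: chi4_def chi8_def)
      have "\<psi> j a = 1" if j: "j \<in> I - {i}" for j
      proof -
        consider "j = 4" | "j = 8" | "j \<in> T" using j by (auto simp: I_def)
        then show ?thesis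
        proof cases
          case 3
          then show ?thesis using \<psi>T[OF 3 c(1)] L[OF 3] j by simp
        qed (simp_all add: \<psi>_def c)
      qed
      moreover have "\<psi> i a = -1" using \<psi>T[OF 3 c(1)] L[OF 3] by simp
      ultimately show ?thesis by blast
    qed
  qed
  define e' where "e' = (\<lambda>i. real_of_int (if i = 4 then s4 else if i = 8 then s8 else e i))"
  have "\<exists>r. prime r \<and> coprime r M \<and> (\<forall>i\<in>I. \<psi> i r = e' i)"
  proof (rule exists_prime_with_character_values[OF _ chr M1 indep])
    show "finite I" using fin by (simp add: I_def)
    show "e' i \<in> {-1, 1}" if "i \<in> I" for i
      using that e[of i] s by (auto simp: e'_def I_def)
  qed auto
  then obtain r where r: "prime r" "coprime r M" "\<forall>i\<in>I. \<psi> i r = e' i" by blast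
  have "Legendre (int r) (int l) = e l" if "l \<in> T" for l
  proof -
    have "l \<noteq> 4" "l \<noteq> 8" using np that by auto
    moreover have "\<psi> l r = e' l" using r(3) that by (simp add: I_def)
    ultimately show ?thesis using \<psi>T[OF that r(2)] by (simp add: e'_def)
  qed
  moreover have "chi4 (int r) = s4" "chi8 (int r) = s8"
    using r(2,3) by (auto simp: I_def e'_def \<psi>_def)
  moreover have "r \<noteq> 2" "r \<notin> T" using cop[of r] r(2) by auto
  ultimately show ?thesis using r(1) by blast
qed

lemma hilbert_class_eq:
  assumes "even (multiplicity (int l) B) \<longleftrightarrow> even (multiplicity (int l) B')" and l: "prime l"
    and nz: "A \<noteq> 0" "B \<noteq> 0" "B' \<noteq> 0"
    and ch: "unit_char l (unit_part l B) = unit_char l (unit_part l B')" "l = 2 \<Longrightarrow> chi4 (unit_part l B) = chi4 (unit_part l B')"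
  shows "hilbert l A B = hilbert l A B'"
proof -
  have par: "x ^ m = x ^ n" if "x \<in> {-1, 1}" "even m \<longleftrightarrow> even n" for x :: int and m n :: nat
    using that by (auto simp: minus_one_power_iff)
  have "unit_char l (-1) ^ (multiplicity (int l) A * multiplicity (int l) B) = unit_char l (-1) ^ (multiplicity (int l) A * multiplicity (int l) B')"
    using assms(1) by (intro par unit_char_minus_1 l) auto
  moreover have "unit_char l (unit_part l A) ^ multiplicity (int l) B = unit_char l (unit_part l A) ^ multiplicity (int l) B'"
    using assms(1) by (intro par unit_char_unit unit_part_unit l nz)
  moreover have "unit_pairing l (unit_part l A) (unit_part l B) = unit_pairing l (unit_part l A) (unit_part l B')"
    using ch(2) by (auto simp: unit_pairing_def)
  ultimately show ?thesis using ch(1) by (simp add: hilbert_def Let_def)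
qed

text \<open>
  The valuations modulo \<open>2\<close> are realised by the product of the primes in \<open>T\<close> at which \<open>b l\<close> has odd
  valuation.  The remaining unit classes are corrected by one prime \<open>r\<close> outside \<open>T\<close>, whose residue symbols
  are the quotients of the wanted ones by those of the product.
\<close>
theorem global_element_with_local_classes:
  fixes T :: "nat set" and b :: "nat \<Rightarrow> int"
  assumes fin: "finite T" and T2: "2 \<in> T" and T: "\<And>l. l \<in> T \<Longrightarrow> prime l" and b: "\<And>l. l \<in> T \<Longrightarrow> b l \<noteq> 0"
  shows "\<exists>a r. a > 0 \<and> prime r \<and> r \<notin> T \<and> (\<forall>l. prime l \<longrightarrow> int l dvd a \<longrightarrow> l \<in> insert r T) \<and>
     (\<forall>l\<in>T. \<forall>V. V \<noteq> 0 \<longrightarrow> hilbert l V a = hilbert l V (b l))"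
proof -
  define C where "C = {l \<in> T. odd (multiplicity (int l) (b l))}"
  have CT: "C \<subseteq> T" and finC: "finite C" using fin by (auto simp: C_def)
  define c where "c = (\<lambda>l. \<Prod>k\<in>C - {l}. int k)"
  have cl: "\<not> int l dvd c l" if "l \<in> T" for l
  proof
    assume "int l dvd c l"
    have pl: "prime (int l)" using T[OF that] by simp
    from \<open>int l dvd c l\<close> obtain k where "k \<in> C - {l}" "int l dvd int k"
      using pl finC unfolding c_def by (subst (asm) prime_dvd_prod_iff) auto
    then show False using T CT that primes_dvd_imp_eq[of l k] by auto
  qed
  define e where "e = (\<lambda>l. unit_char l (c l) * unit_char l (unit_part l (b l)))"
  have u: "\<not> int l dvd unit_part l (b l)" if "l \<in> T" for l using unit_part_unit[OF T[OF that] b[OF that]] .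
  have e: "e l \<in> {-1, 1}" if "l \<in> T" for l
    using unit_char_unit[OF T[OF that] cl[OF that]] unit_char_unit[OF T[OF that] u[OF that]] by (auto simp: e_def)
  define s4 where "s4 = chi4 (c 2) * chi4 (unit_part 2 (b 2))"
  have o2: "odd (c 2)" "odd (unit_part 2 (b 2))" using cl[OF T2] u[OF T2] by auto
  have s4: "s4 \<in> {-1, 1}" using chi4_odd[OF o2(1)] chi4_odd[OF o2(2)] by (auto simp: s4_def)
  obtain r where r: "prime r" "r \<noteq> 2" "r \<notin> T - {2}" "\<forall>l\<in>T - {2}. Legendre (int r) (int l) = e l"
      "chi4 (int r) = s4" "chi8 (int r) = e 2"
    using exists_prime_with_residues[of "T - {2}" e s4 "e 2"] fin T e[OF T2] e s4 by auto
  have rT: "r \<notin> T" using r by auto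
  have lr: "unit_char l (int r) = e l" if "l \<in> T" for l using r that by (auto simp: unit_char_def)
  define a where "a = (\<Prod>k\<in>C. int k) * int r"
  have apos: "a > 0" unfolding a_def using CT T r(1) by (intro mult_pos_pos prod_pos) (auto simp: prime_gt_0_nat)
  have supp: "l \<in> insert r T" if "prime l" "int l dvd a" for l
  proof -
    have pl: "prime (int l)" using that by simp
    from that(2) have "int l dvd (\<Prod>k\<in>C. int k) \<or> int l dvd int r"
      unfolding a_def using pl by (simp add: prime_dvd_mult_iff)
    then show ?thesis
    proof
      assume "int l dvd (\<Prod>k\<in>C. int k)"
      then obtain k where "k \<in> C" "int l dvd int k" using pl finC by (subst (asm) prime_dvd_prod_iff) auto
      then show ?thesis using that(1) T CT primes_dvd_imp_eq[of l k] by auto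
    next
      assume "int l dvd int r"
      then show ?thesis using that(1) r(1) primes_dvd_imp_eq[of l r] by auto
    qed
  qed
  have cls: "hilbert l V a = hilbert l V (b l)" if l: "l \<in> T" and V: "V \<noteq> 0" for l V
  proof -
    have pl: "prime l" using T l by blast
    have nr: "\<not> int l dvd int r" using l rT r(1) pl primes_dvd_imp_eq[of l r] by auto
    have ncr: "\<not> int l dvd c l * int r" using cl[OF l] nr pl by (simp add: prime_dvd_mult_iff)
    have ne: "c l * int r \<noteq> 0" using ncr by (metis dvd_0_right)
    have split: "a = (if l \<in> C then int l * (c l * int r) else c l * int r)"
    proof (cases "l \<in> C")
      case True
      then show ?thesis using finC by (simp add: a_def c_def prod.remove)
    next
      case False
      then show ?thesis by (simp add: a_def c_def)
    qed
    have ua: "unit_part l a = c l * int r"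
    proof (cases "l \<in> C")
      case True
      then have "unit_part l a = unit_part l (int l) * unit_part l (c l * int r)"
        unfolding split using pl ne prime_gt_0_nat[OF pl] prime_gt_0_nat[OF r(1)] by (subst if_P) (auto intro!: unit_part_mult)
      then show ?thesis using pl ncr by (simp add: unit_part_self unit_part_not_dvd)
    next
      case False
      then show ?thesis unfolding split using ncr by (simp add: unit_part_not_dvd)
    qed
    have ma: "multiplicity (int l) a = (if l \<in> C then 1 else 0)"
    proof (cases "l \<in> C")
      case True
      have "multiplicity (int l) (int l * (c l * int r)) = multiplicity (int l) (int l) + multiplicity (int l) (c l * int r)"
        using pl ne prime_gt_0_nat[OF pl] by (intro prime_elem_multiplicity_mult_distrib) auto
      then show ?thesis unfolding split using True ncr pl by (simp add: multiplicity_self_int not_dvd_imp_multiplicity_0)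
    next
      case False
      then show ?thesis unfolding split using ncr by (simp add: not_dvd_imp_multiplicity_0)
    qed
    show ?thesis
    proof (rule hilbert_class_eq[OF _ pl V])
      show "even (multiplicity (int l) a) \<longleftrightarrow> even (multiplicity (int l) (b l))"
        using l by (auto simp: ma C_def)
      show "a \<noteq> 0" "b l \<noteq> 0" using apos b l by auto
      have "unit_char l (c l) * unit_char l (c l) = 1" using unit_char_unit[OF pl cl[OF l]] by auto
      then show "unit_char l (unit_part l a) = unit_char l (unit_part l (b l))"
        unfolding ua using lr[OF l] by (simp add: unit_char_mult[OF pl] e_def flip: mult.assoc)
      have "chi4 (c 2) * chi4 (c 2) = 1" using chi4_odd[OF o2(1)] by auto
      then show "chi4 (unit_part l a) = chi4 (unit_part l (b l))" if "l = 2"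
        unfolding ua using r(5) that by (simp add: chi4_mult s4_def flip: mult.assoc)
    qed
  qed
  show ?thesis using apos r(1) rT supp cls by blast
qed

definition quaternary_isotropic :: "int \<Rightarrow> int \<Rightarrow> int \<Rightarrow> bool" where
  "quaternary_isotropic p q d \<longleftrightarrow> (\<exists>x y z w. (x, y, z, w) \<noteq> (0, 0, 0, 0) \<and>
     p * x\<^sup>2 + q * y\<^sup>2 - p * q * z\<^sup>2 = d * w\<^sup>2)"

lemma prime_not_square:
  assumes "prime (p::nat)" "(x::int)\<^sup>2 = int p * y\<^sup>2"
  shows "y = 0"
proof (rule ccontr)
  assume "y \<noteq> 0"
  then have "x \<noteq> 0" using assms prime_gt_0_nat by fastforce
  have pe: "prime_elem (int p)" using assms(1) by simp
  have "multiplicity (int p) (x\<^sup>2) = 2 * multiplicity (int p) x"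
    using pe \<open>x \<noteq> 0\<close> by (simp add: prime_elem_multiplicity_power_distrib)
  moreover have "multiplicity (int p) (int p * y\<^sup>2) = Suc (2 * multiplicity (int p) y)"
    using pe \<open>y \<noteq> 0\<close> assms(1) prime_gt_0_nat[of p]
    by (simp add: prime_elem_multiplicity_mult_distrib prime_elem_multiplicity_power_distrib multiplicity_self_int)
  ultimately have "2 * multiplicity (int p) x = Suc (2 * multiplicity (int p) y)" using assms(2) by simp
  then show False by presburger
qed

text \<open>
  In terms of algebras: the first conic identifies the quaternion algebras of \<open>(p, q)\<close> and \<open>(p, a)\<close>, the
  second those of \<open>(p, a)\<close> and \<open>(d, a)\<close>, and the last one contains a square root of \<open>d\<close>.
\<close>
lemma isotropic_from_conics:
  fixes p q d a :: int
  assumes "q \<noteq> 0" "a \<noteq> 0" "p \<noteq> 0" "d \<noteq> 0"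
    and "x\<^sup>2 = p * y\<^sup>2 + (q * a) * z\<^sup>2" "z \<noteq> 0"
    and "u\<^sup>2 = (p * d) * v\<^sup>2 + a * w\<^sup>2" "(u, v, w) \<noteq> (0, 0, 0)"
  shows "quaternary_isotropic p q d"
proof -
  have "p * (q * z * u)\<^sup>2 + q * (p * y * w)\<^sup>2 - p * q * (x * w)\<^sup>2 - d * (p * q * z * v)\<^sup>2 =
      p * q * (q * z\<^sup>2 * (u\<^sup>2 - p * d * v\<^sup>2) - w\<^sup>2 * (x\<^sup>2 - p * y\<^sup>2))"
    by (simp add: power2_eq_square algebra_simps)
  also have "\<dots> = 0" unfolding assms(5,7) by (simp add: algebra_simps)
  finally have eq: "p * (q * z * u)\<^sup>2 + q * (p * y * w)\<^sup>2 - p * q * (x * w)\<^sup>2 = d * (p * q * z * v)\<^sup>2" by simp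
  have "q * z * u \<noteq> 0 \<or> p * q * z * v \<noteq> 0"
  proof (rule ccontr)
    assume "\<not> ?thesis"
    then have "u = 0" "v = 0" using assms by auto
    then show False using assms(2,7,8) by auto
  qed
  then show ?thesis unfolding quaternary_isotropic_def using eq
    by (intro exI[of _ "q * z * u"] exI[of _ "p * y * w"] exI[of _ "x * w"] exI[of _ "p * q * z * v"]) auto
qed

text \<open>
  The two conics are governed by the symbols of \<open>p\<close> with \<open>q a\<close> and of \<open>p d\<close> with \<open>a\<close>.  The integer \<open>a\<close> is
  prescribed at all primes that divide \<open>2 p q d\<close>; outside these and the auxiliary prime \<open>r\<close> the entries are units,
  and at \<open>r\<close> the product formula forces the value \<open>1\<close>.
\<close>
theorem quaternary_hasse:
  assumes p: "prime p" and q: "prime q" and d: "d \<noteq> 0"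
    and loc: "\<And>l. prime l \<Longrightarrow> \<not> (hilbert l (int p) (int q) = -1 \<and> local_square l d)"
  shows "quaternary_isotropic (int p) (int q) d"
proof -
  define T where "T = insert 2 (prime_factors (p * q * nat \<bar>d\<bar>))"
  have nz: "p * q * nat \<bar>d\<bar> \<noteq> 0" using p q d prime_gt_0_nat by auto
  have fin: "finite T" and T2: "2 \<in> T" by (auto simp: T_def)
  have T: "prime l" if "l \<in> T" for l using that by (auto simp: T_def)
  have Tmem: "l \<in> T" if "prime l" "int l dvd int p \<or> int l dvd int q \<or> int l dvd d" for l
  proof -
    have "l dvd p * q * nat \<bar>d\<bar>"
    proof -
      have "l dvd p \<or> l dvd q \<or> l dvd nat \<bar>d\<bar>" using that(2) by auto
      then show ?thesis by (elim disjE) (simp_all only: dvd_mult dvd_mult2)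
    qed
    then show ?thesis using that(1) nz by (auto simp: T_def prime_factors_dvd)
  qed
  have p0: "int p \<noteq> 0" and q0: "int q \<noteq> 0" using p q prime_gt_0_nat by auto
  have "\<forall>l\<in>T. \<exists>b. b \<noteq> 0 \<and> hilbert l (int p) (int q * b) = 1 \<and> hilbert l (int p * d) b = 1"
  proof
    fix l assume "l \<in> T"
    then have l: "prime l" by (rule T)
    show "\<exists>b. b \<noteq> 0 \<and> hilbert l (int p) (int q * b) = 1 \<and> hilbert l (int p * d) b = 1"
      by (rule local_common_slot[OF l p0 q0 d loc[OF l]])
  qed
  then obtain b where b: "\<And>l. l \<in> T \<Longrightarrow> b l \<noteq> 0 \<and> hilbert l (int p) (int q * b l) = 1 \<and> hilbert l (int p * d) (b l) = 1"
    by metis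
  obtain a r where a: "a > 0" and r: "prime r" "r \<notin> T"
    and supp: "\<forall>l. prime l \<longrightarrow> int l dvd a \<longrightarrow> l \<in> insert r T"
    and cls: "\<forall>l\<in>T. \<forall>V. V \<noteq> 0 \<longrightarrow> hilbert l V a = hilbert l V (b l)"
    using global_element_with_local_classes[OF fin T2 T, of b] b by auto
  have pd0: "int p * d \<noteq> 0" using p0 d by simp
  have qa0: "int q * a \<noteq> 0" using q0 a by simp
  have everywhere: "hilbert l V Y = 1"
    if V: "V \<noteq> 0" "\<And>l. prime l \<Longrightarrow> int l dvd V \<Longrightarrow> l \<in> T" and Y: "Y > 0" "\<And>l. prime l \<Longrightarrow> int l dvd Y \<Longrightarrow> l \<in> insert r T"
      and XY: "\<And>l. l \<in> T \<Longrightarrow> hilbert l V Y = 1" and l: "prime l" for V Y l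
  proof (cases "l \<in> insert r T")
    case False
    then show ?thesis using V(2)[OF l] Y(2)[OF l] T2 by (intro hilbert_units) auto
  next
    case True
    have "(\<Prod>l\<in>insert r T. hilbert l V Y) = 1"
      using fin T2 T r V Y by (intro hilbert_product_formula) auto
    also have "(\<Prod>l\<in>insert r T. hilbert l V Y) = hilbert r V Y"
      using fin r(2) XY by simp
    finally show ?thesis using True XY by auto
  qed
  have 1: "hilbert l (int p) (int q * a) = 1" if "prime l" for l
  proof (rule everywhere[OF _ _ _ _ _ that])
    show "l \<in> insert r T" if "prime l" "int l dvd int q * a" for l
    proof -
      have "int l dvd int q \<or> int l dvd a" using that by (simp add: prime_dvd_mult_iff)
      then show ?thesis using that Tmem supp by blast
    qed
    show "hilbert l (int p) (int q * a) = 1" if "l \<in> T" for l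
      using b[OF that] cls that p0 a hilbert_mult[OF T[OF that] q0, of "b l" "int p"]
        hilbert_mult[OF T[OF that] q0, of a "int p"] by simp
    show "l \<in> T" if "prime l" "int l dvd int p" for l
      using that Tmem by blast
    show "int q * a > 0" using a prime_gt_0_nat[OF q] by simp
  qed (rule p0)
  have 2: "hilbert l (int p * d) a = 1" if "prime l" for l
  proof (rule everywhere[OF _ _ _ _ _ that])
    show "l \<in> T" if "prime l" "int l dvd int p * d" for l
    proof -
      have "int l dvd int p \<or> int l dvd d" using that by (simp add: prime_dvd_mult_iff)
      then show ?thesis using that Tmem by blast
    qed
    show "hilbert l (int p * d) a = 1" if "l \<in> T" for l
      using b[OF that] cls that pd0 by simp
  qed (use pd0 a supp in auto)
  have "conic_solvable (int p) (int q * a)"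
    using p0 qa0 1 by (intro legendre_conic) auto
  then obtain x y z where xyz: "(x, y, z) \<noteq> (0, 0, 0)" "x\<^sup>2 = int p * y\<^sup>2 + int q * a * z\<^sup>2"
    by (auto simp: conic_solvable_def)
  have "z \<noteq> 0"
  proof
    assume "z = 0"
    then have "x\<^sup>2 = int p * y\<^sup>2" using xyz by simp
    then have "y = 0" by (rule prime_not_square[OF p])
    then show False using xyz \<open>z = 0\<close> by simp
  qed
  moreover have "conic_solvable (int p * d) a"
    using pd0 a 2 by (intro legendre_conic) auto
  then obtain u v w where "(u, v, w) \<noteq> (0, 0, 0)" "u\<^sup>2 = int p * d * v\<^sup>2 + a * w\<^sup>2"
    by (auto simp: conic_solvable_def)
  ultimately show ?thesis using xyz(2) p0 q0 d a by (intro isotropic_from_conics[of "int q" a "int p" d x y z u v w]) auto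
qed

section \<open>Local obstructions\<close>

lemma sum_abs_descent:
  fixes F :: "int \<Rightarrow> int \<Rightarrow> int \<Rightarrow> int \<Rightarrow> bool"
  assumes "l > (1::int)"
    and hom: "\<And>x y z w. F (l * x) (l * y) (l * z) (l * w) \<Longrightarrow> F x y z w"
    and dv: "\<And>x y z w. F x y z w \<Longrightarrow> l dvd x \<and> l dvd y \<and> l dvd z \<and> l dvd w"
    and "F x y z w"
  shows "x = 0 \<and> y = 0 \<and> z = 0 \<and> w = 0"
  using assms(4)
proof (induction "nat (\<bar>x\<bar> + \<bar>y\<bar> + \<bar>z\<bar> + \<bar>w\<bar>)" arbitrary: x y z w rule: less_induct)
  case less
  obtain x' y' z' w' where eq: "x = l * x'" "y = l * y'" "z = l * z'" "w = l * w'"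
    using dv[OF less.prems] by (auto elim!: dvdE)
  have F': "F x' y' z' w'" using less.prems unfolding eq by (rule hom)
  let ?s = "\<bar>x'\<bar> + \<bar>y'\<bar> + \<bar>z'\<bar> + \<bar>w'\<bar>"
  have sum: "\<bar>x\<bar> + \<bar>y\<bar> + \<bar>z\<bar> + \<bar>w\<bar> = l * ?s"
    using assms(1) by (simp add: eq abs_mult algebra_simps)
  show ?case
  proof (cases "?s = 0")
    case True
    then have "x' = 0 \<and> y' = 0 \<and> z' = 0 \<and> w' = 0" by linarith
    then show ?thesis by (simp add: eq)
  next
    case False
    then have "?s > 0" by linarith
    then have "?s < l * ?s" using assms(1) by simp
    then have "nat ?s < nat (\<bar>x\<bar> + \<bar>y\<bar> + \<bar>z\<bar> + \<bar>w\<bar>)"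
      unfolding sum using \<open>?s > 0\<close> by linarith
    from less.hyps[OF this F'] show ?thesis by (simp add: eq)
  qed
qed

lemma quaternary_anisotropicI:
  assumes "l > (1::int)"
    and "\<And>x y z w. p * x\<^sup>2 + q * y\<^sup>2 - p * q * z\<^sup>2 = d * w\<^sup>2 \<Longrightarrow> l dvd x \<and> l dvd y \<and> l dvd z \<and> l dvd w"
  shows "\<not> quaternary_isotropic p q d"
proof -
  have "x = 0 \<and> y = 0 \<and> z = 0 \<and> w = 0" if "p * x\<^sup>2 + q * y\<^sup>2 - p * q * z\<^sup>2 = d * w\<^sup>2" for x y z w
  proof (rule sum_abs_descent[where F = "\<lambda>x y z w. p * x\<^sup>2 + q * y\<^sup>2 - p * q * z\<^sup>2 = d * w\<^sup>2", OF assms(1) _ assms(2) that])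
    fix x y z w
    assume "p * (l * x)\<^sup>2 + q * (l * y)\<^sup>2 - p * q * (l * z)\<^sup>2 = d * (l * w)\<^sup>2"
    then have "l\<^sup>2 * (p * x\<^sup>2 + q * y\<^sup>2 - p * q * z\<^sup>2) = l\<^sup>2 * (d * w\<^sup>2)"
      by (simp add: power_mult_distrib algebra_simps)
    then show "p * x\<^sup>2 + q * y\<^sup>2 - p * q * z\<^sup>2 = d * w\<^sup>2" using assms(1) by simp
  qed
  then show ?thesis unfolding quaternary_isotropic_def by blast
qed

lemma quaternary_isotropic_sym: "quaternary_isotropic p q d \<longleftrightarrow> quaternary_isotropic q p d"
proof -
  have "quaternary_isotropic p q d \<Longrightarrow> quaternary_isotropic q p d" for p q
    unfolding quaternary_isotropic_def
  proof (elim exE conjE)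
    fix x y z w assume "(x, y, z, w) \<noteq> (0, 0, 0, 0)" "p * x\<^sup>2 + q * y\<^sup>2 - p * q * z\<^sup>2 = d * w\<^sup>2"
    then show "\<exists>x y z w. (x, y, z, w) \<noteq> (0, 0, 0, 0) \<and> q * x\<^sup>2 + p * y\<^sup>2 - q * p * z\<^sup>2 = d * w\<^sup>2"
      by (intro exI[of _ y] exI[of _ x] exI[of _ z] exI[of _ w]) (auto simp: algebra_simps)
  qed
  then show ?thesis by blast
qed

text \<open>A zero modulo \<open>l\<close> with \<open>w\<close> invertible would make \<open>a b\<close> the square of \<open>a y / w\<close>.\<close>
lemma binary_anisotropic_mod:
  assumes l: "prime (l::nat)" "l \<noteq> 2" and "Legendre (a * b) (int l) = -1" and dv: "int l dvd a * y\<^sup>2 - b * w\<^sup>2"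
  shows "int l dvd y \<and> int l dvd w"
proof (rule ccontr)
  assume neg: "\<not> ?thesis"
  have pl: "prime (int l)" and l2: "2 < l" using l prime_ge_2_nat[of l] by auto
  have nab: "\<not> int l dvd a" "\<not> int l dvd b"
    using assms(3) Legendre_eq_0_iff[of "a * b" "int l"] by auto
  have "int l dvd y \<longleftrightarrow> int l dvd a * y\<^sup>2" "int l dvd w \<longleftrightarrow> int l dvd b * w\<^sup>2"
    using nab pl by (auto simp: prime_dvd_mult_iff prime_dvd_power_iff)
  moreover have "int l dvd a * y\<^sup>2 \<longleftrightarrow> int l dvd b * w\<^sup>2" using dv by (metis dvd_diff_right_iff dvd_diff_commute)
  ultimately have ny: "\<not> int l dvd y" and nw: "\<not> int l dvd w" using neg by auto
  have "(a * b) * w\<^sup>2 - (a * y)\<^sup>2 = (- a) * (a * y\<^sup>2 - b * w\<^sup>2)" by (simp add: power2_eq_square algebra_simps)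
  then have "[(a * b) * w\<^sup>2 = (a * y)\<^sup>2] (mod int l)" using dv by (simp only: cong_iff_dvd_diff dvd_mult)
  then have "Legendre ((a * b) * w\<^sup>2) (int l) = 1"
    using nab ny pl by (intro Legendre_square[of _ "a * y"]) (auto simp: prime_dvd_mult_iff)
  moreover have "Legendre (w\<^sup>2) (int l) = 1" using nw pl by (intro Legendre_square[of _ w]) auto
  ultimately show False using assms(3) by (simp add: Legendre_mult[OF l(1) l2])
qed

lemma odd_square_mod_8:
  fixes x :: int
  assumes "odd x"
  obtains k where "x\<^sup>2 = 8 * k + 1"
proof -
  obtain m where m: "x = 2 * m + 1" using assms by (elim oddE)
  have "even (m * (m + 1))" by simp
  then obtain k where "m * (m + 1) = 2 * k" by (elim evenE)
  then have "x\<^sup>2 = 8 * k + 1" unfolding m by (simp add: power2_eq_square algebra_simps)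
  then show ?thesis by (rule that)
qed

lemma square_mod_4:
  fixes x :: int
  obtains k where "x\<^sup>2 = 4 * k + of_bool (odd x)"
proof (cases "odd x")
  case True
  then obtain k where "x\<^sup>2 = 8 * k + 1" by (rule odd_square_mod_8)
  then show ?thesis using True by (intro that[of "2 * k"]) simp
next
  case False
  then obtain m where "x = 2 * m" by blast
  then show ?thesis using False by (intro that[of "m\<^sup>2"]) (simp add: power2_eq_square)
qed

text \<open>
  Modulo \<open>4\<close> the equation says that a sum of four squares vanishes, so the variables have equal parity; if all
  are odd, the form is \<open>- (p - 1) (q - 1) - (d - 1)\<close> modulo \<open>8\<close>, which is \<open>4\<close>.
\<close>
lemma anisotropic_both_3_mod_4:
  fixes p q d :: int
  assumes p: "p mod 4 = 3" and q: "q mod 4 = 3" and d: "d mod 8 = 1"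
  shows "\<not> quaternary_isotropic p q d"
proof (rule quaternary_anisotropicI[of 2])
  fix x y z w assume eq: "p * x\<^sup>2 + q * y\<^sup>2 - p * q * z\<^sup>2 = d * w\<^sup>2"
  obtain P where P: "p = 4 * P + 3" using p by (metis mult_div_mod_eq)
  obtain Q where Q: "q = 4 * Q + 3" using q by (metis mult_div_mod_eq)
  obtain D where D: "d = 8 * D + 1" using d by (metis mult_div_mod_eq)
  have "4 * (P * x\<^sup>2 + Q * y\<^sup>2 - (4 * P * Q + 3 * P + 3 * Q + 2) * z\<^sup>2 - 2 * D * w\<^sup>2) + 3 * x\<^sup>2 + 3 * y\<^sup>2 - z\<^sup>2 - w\<^sup>2 = 0"
    using eq unfolding P Q D by (simp add: algebra_simps)
  then obtain A where A: "4 * A + 3 * x\<^sup>2 + 3 * y\<^sup>2 - z\<^sup>2 - w\<^sup>2 = 0" by blast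
  obtain a b c e where abce: "x\<^sup>2 = 4 * a + of_bool (odd x)" "y\<^sup>2 = 4 * b + of_bool (odd y)"
      "z\<^sup>2 = 4 * c + of_bool (odd z)" "w\<^sup>2 = 4 * e + of_bool (odd w)"
    by (metis square_mod_4)
  have "4 * (A + 3 * a + 3 * b - c - e) + 3 * of_bool (odd x) + 3 * of_bool (odd y)
      - of_bool (odd z) - of_bool (odd w) = (0 :: int)"
    using A unfolding abce by simp
  then have "even x \<and> even y \<and> even z \<and> even w \<or> odd x \<and> odd y \<and> odd z \<and> odd w"
    by (cases "odd x"; cases "odd y"; cases "odd z"; cases "odd w"; simp; presburger)
  moreover have False if "odd x" "odd y" "odd z" "odd w"
  proof -
    obtain a where a: "x\<^sup>2 = 8 * a + 1" using odd_square_mod_8[OF \<open>odd x\<close>] .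
    obtain b where b: "y\<^sup>2 = 8 * b + 1" using odd_square_mod_8[OF \<open>odd y\<close>] .
    obtain c where c: "z\<^sup>2 = 8 * c + 1" using odd_square_mod_8[OF \<open>odd z\<close>] .
    obtain e where e: "w\<^sup>2 = 8 * e + 1" using odd_square_mod_8[OF \<open>odd w\<close>] .
    have "8 * (p * a + q * b - p * q * c - d * e - D - 2 * P * Q - P - Q - 1) + 4 = 0"
      using eq unfolding a b c e by (simp add: P Q D algebra_simps)
    then show False by presburger
  qed
  ultimately show "2 dvd x \<and> 2 dvd y \<and> 2 dvd z \<and> 2 dvd w" by blast
qed simp

text \<open>Once \<open>x\<close> and \<open>w\<close> are known to be even, halving the equation allows the same argument for \<open>y\<close> and \<open>z\<close>.\<close>
lemma anisotropic_2:
  fixes p d :: int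
  assumes p: "p mod 8 = 3 \<or> p mod 8 = 5" and d: "d mod 8 = 1"
  shows "\<not> quaternary_isotropic p 2 d"
proof (rule quaternary_anisotropicI[of 2])
  fix x y z w assume eq: "p * x\<^sup>2 + 2 * y\<^sup>2 - p * 2 * z\<^sup>2 = d * w\<^sup>2"
  define c where "c = p mod 8"
  have c: "c = 3 \<or> c = 5" using p by (simp add: c_def)
  obtain P where P: "p = 8 * P + c" unfolding c_def by (metis mult_div_mod_eq)
  obtain D where D: "d = 8 * D + 1" using d by (metis mult_div_mod_eq)
  have "8 * (P * x\<^sup>2 - 2 * P * z\<^sup>2 - D * w\<^sup>2) + c * x\<^sup>2 + 2 * y\<^sup>2 - 2 * c * z\<^sup>2 - w\<^sup>2 = 0"
    using eq unfolding P D by (simp add: algebra_simps)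
  then obtain A where A: "8 * A + c * x\<^sup>2 + 2 * y\<^sup>2 - 2 * c * z\<^sup>2 - w\<^sup>2 = 0" by blast
  have "even (c * x\<^sup>2 - w\<^sup>2)"
  proof -
    have "c * x\<^sup>2 - w\<^sup>2 = 2 * (c * z\<^sup>2 - y\<^sup>2 - 4 * A)" using A by simp
    then show ?thesis by simp
  qed
  then have par: "even x \<longleftrightarrow> even w" using c by auto
  have "even x \<and> even w"
  proof (rule ccontr)
    assume "\<not> ?thesis"
    then have "odd x" "odd w" using par by auto
    obtain a where a: "x\<^sup>2 = 8 * a + 1" using odd_square_mod_8[OF \<open>odd x\<close>] .
    obtain e where e: "w\<^sup>2 = 8 * e + 1" using odd_square_mod_8[OF \<open>odd w\<close>] .
    obtain b i where b: "y\<^sup>2 = 4 * b + i" "i = 0 \<or> i = 1" by (metis square_mod_4 of_bool_eq)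
    obtain f j where f: "z\<^sup>2 = 4 * f + j" "j = 0 \<or> j = 1" by (metis square_mod_4 of_bool_eq)
    from c show False
    proof
      assume "c = 3"
      then have "4 * (A + 3 * a + b - 3 * f - e) + 1 + i - 3 * j = 0"
        using A unfolding a e b f by simp
      then obtain m where "4 * m + 1 + i - 3 * j = 0" by blast
      then show False using b(2) f(2) by (elim disjE; simp; presburger)
    next
      assume "c = 5"
      then have "4 * (A + 5 * a + b - 5 * f - e) + 2 + i - 5 * j = 0"
        using A unfolding a e b f by simp
      then obtain m where "4 * m + 2 + i - 5 * j = 0" by blast
      then show False using b(2) f(2) by (elim disjE; simp; presburger)
    qed
  qed
  then obtain x' w' where xw: "x = 2 * x'" "w = 2 * w'" by (auto elim!: evenE)
  have eq2: "2 * p * x'\<^sup>2 + y\<^sup>2 - p * z\<^sup>2 = 2 * d * w'\<^sup>2"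
    using eq unfolding xw by (simp add: power_mult_distrib)
  have "8 * (2 * P * x'\<^sup>2 - P * z\<^sup>2 - 2 * D * w'\<^sup>2) + 2 * c * x'\<^sup>2 + y\<^sup>2 - c * z\<^sup>2 - 2 * w'\<^sup>2 = 0"
    using eq2 unfolding P D by (simp add: algebra_simps)
  then obtain B where B: "8 * B + 2 * c * x'\<^sup>2 + y\<^sup>2 - c * z\<^sup>2 - 2 * w'\<^sup>2 = 0" by blast
  have "even (y\<^sup>2 - c * z\<^sup>2)"
  proof -
    have "y\<^sup>2 - c * z\<^sup>2 = 2 * (w'\<^sup>2 - c * x'\<^sup>2 - 4 * B)" using B by simp
    then show ?thesis by simp
  qed
  then have par: "even y \<longleftrightarrow> even z" using c by auto
  have "even y \<and> even z"
  proof (rule ccontr)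
    assume "\<not> ?thesis"
    then have "odd y" "odd z" using par by auto
    obtain b where b: "y\<^sup>2 = 8 * b + 1" using odd_square_mod_8[OF \<open>odd y\<close>] .
    obtain f where f: "z\<^sup>2 = 8 * f + 1" using odd_square_mod_8[OF \<open>odd z\<close>] .
    obtain a i where a: "x'\<^sup>2 = 4 * a + i" "i = 0 \<or> i = 1" by (metis square_mod_4 of_bool_eq)
    obtain e j where e: "w'\<^sup>2 = 4 * e + j" "j = 0 \<or> j = 1" by (metis square_mod_4 of_bool_eq)
    from c show False
    proof
      assume "c = 3"
      then have "4 * (B + 3 * a + b - 3 * f - e) + 3 * i - 1 - j = 0"
        using B unfolding a e b f by simp
      then obtain m where "4 * m + 3 * i - 1 - j = 0" by blast
      then show False using a(2) e(2) by (elim disjE; simp; presburger)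
    next
      assume "c = 5"
      then have "4 * (B + 5 * a + b - 5 * f - e) + 5 * i - 2 - j = 0"
        using B unfolding a e b f by simp
      then obtain m where "4 * m + 5 * i - 2 - j = 0" by blast
      then show False using a(2) e(2) by (elim disjE; simp; presburger)
    qed
  qed
  then show "2 dvd x \<and> 2 dvd y \<and> 2 dvd z \<and> 2 dvd w" using xw by simp
qed simp

lemma anisotropic_odd_ramified:
  assumes l: "prime l" "l \<noteq> 2" and h: "Legendre q (int l) = -1" and d: "Legendre d (int l) = 1"
  shows "\<not> quaternary_isotropic (int l) q d"
proof (rule quaternary_anisotropicI[of "int l"])
  have l2: "2 < l" using l prime_ge_2_nat[of l] by simp
  fix x y z w assume eq: "int l * x\<^sup>2 + q * y\<^sup>2 - int l * q * z\<^sup>2 = d * w\<^sup>2"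
  then have "q * y\<^sup>2 - d * w\<^sup>2 = int l * (q * z\<^sup>2 - x\<^sup>2)" by (simp add: algebra_simps)
  then have "int l dvd q * y\<^sup>2 - d * w\<^sup>2" by simp
  then have yw: "int l dvd y \<and> int l dvd w"
    using h d by (intro binary_anisotropic_mod[OF l, of q d]) (simp_all add: Legendre_mult[OF l(1) l2])
  then obtain y' w' where "y = int l * y'" "w = int l * w'" by (auto elim!: dvdE)
  then have "int l * (x\<^sup>2 + int l * q * y'\<^sup>2 - q * z\<^sup>2) = int l * (int l * d * w'\<^sup>2)"
    using eq by (simp add: power2_eq_square algebra_simps)
  then have "x\<^sup>2 + int l * q * y'\<^sup>2 - q * z\<^sup>2 = int l * d * w'\<^sup>2" using l2 by simp
  then have "1 * x\<^sup>2 - q * z\<^sup>2 = int l * (d * w'\<^sup>2 - q * y'\<^sup>2)" by (simp add: algebra_simps)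
  then have "int l dvd 1 * x\<^sup>2 - q * z\<^sup>2" by simp
  then have "int l dvd x \<and> int l dvd z"
    using h by (intro binary_anisotropic_mod[OF l, of 1 q]) simp_all
  then show "int l dvd x \<and> int l dvd y \<and> int l dvd z \<and> int l dvd w" using yw by simp
qed (use prime_gt_1_nat[OF l(1)] in simp)

lemma anisotropic_equal_primes:
  assumes l: "prime l" "l \<noteq> 2" and h: "Legendre (-1) (int l) = -1" and d: "Legendre d (int l) = 1"
  shows "\<not> quaternary_isotropic (int l) (int l) d"
proof (rule quaternary_anisotropicI[of "int l"])
  have l2: "2 < l" using l prime_ge_2_nat[of l] by simp
  have pl: "prime (int l)" using l by simp
  have nd: "\<not> int l dvd d" using d Legendre_eq_0_iff[of d "int l"] by auto
  fix x y z w assume eq: "int l * x\<^sup>2 + int l * y\<^sup>2 - int l * int l * z\<^sup>2 = d * w\<^sup>2"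
  then have "d * w\<^sup>2 = int l * (x\<^sup>2 + y\<^sup>2 - int l * z\<^sup>2)" by (simp add: algebra_simps)
  then have "int l dvd d * w\<^sup>2" by simp
  then have "int l dvd w" using nd pl by (simp add: prime_dvd_mult_iff prime_dvd_power_iff)
  then obtain w' where w: "w = int l * w'" by (elim dvdE)
  have "int l * (x\<^sup>2 + y\<^sup>2 - int l * z\<^sup>2) = int l * (int l * d * w'\<^sup>2)"
    using eq unfolding w by (simp add: power2_eq_square algebra_simps)
  then have e1: "x\<^sup>2 + y\<^sup>2 - int l * z\<^sup>2 = int l * d * w'\<^sup>2" using l2 by simp
  then have "1 * x\<^sup>2 - (-1) * y\<^sup>2 = int l * (d * w'\<^sup>2 + z\<^sup>2)" by (simp add: algebra_simps)
  then have "int l dvd 1 * x\<^sup>2 - (-1) * y\<^sup>2" by simp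
  then have xy: "int l dvd x \<and> int l dvd y"
    using h by (intro binary_anisotropic_mod[OF l, of 1 "-1"]) simp_all
  then obtain x' y' where "x = int l * x'" "y = int l * y'" by (auto elim!: dvdE)
  then have "int l * (int l * x'\<^sup>2 + int l * y'\<^sup>2 - z\<^sup>2) = int l * (d * w'\<^sup>2)"
    using e1 by (simp add: power2_eq_square algebra_simps)
  then have "int l * x'\<^sup>2 + int l * y'\<^sup>2 - z\<^sup>2 = d * w'\<^sup>2" using l2 by simp
  then have "1 * z\<^sup>2 - (- 1 * d) * w'\<^sup>2 = int l * (x'\<^sup>2 + y'\<^sup>2)" by (simp add: algebra_simps)
  then have "int l dvd 1 * z\<^sup>2 - (- 1 * d) * w'\<^sup>2" by simp
  moreover have "Legendre (1 * (- 1 * d)) (int l) = -1"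
    using h d Legendre_mult[OF l(1) l2, of "-1" d] by simp
  ultimately have "int l dvd z" using binary_anisotropic_mod[OF l, of 1 "- 1 * d" z w'] by blast
  then show "int l dvd x \<and> int l dvd y \<and> int l dvd z \<and> int l dvd w" using xy w by simp
qed (use prime_gt_1_nat[OF l(1)] in simp)

lemma local_square_squarefree:
  assumes "prime l" "squarefree d"
  shows "local_square l d \<longleftrightarrow> (if l = 2 then d mod 8 = 1 else Legendre d (int l) = 1)"
proof (cases "int l dvd d")
  case True
  then have "multiplicity (int l) d = 1" using assms by (intro squarefree_multiplicity_eq_1)
  moreover have "d mod 8 \<noteq> 1" if "l = 2" using True that by simp presburger
  moreover have "Legendre d (int l) = 0" using True by (simp add: Legendre_eq_0_iff)
  ultimately show ?thesis by (auto simp: local_square_def)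
next
  case False
  then have "unit_part l d = d" "multiplicity (int l) d = 0" by (auto intro: unit_part_not_dvd not_dvd_imp_multiplicity_0)
  then show ?thesis unfolding local_square_def by (cases "l = 2") auto
qed

lemma hilbert_primes_other:
  assumes "prime l" "prime p" "prime q" "l \<noteq> 2" "l \<noteq> p" "l \<noteq> q"
  shows "hilbert l (int p) (int q) = 1"
  using assms by (intro hilbert_units) (auto simp only: int_prime_dvd_prime)

lemma hilbert_primes_left:
  assumes "prime p" "prime q" "p \<noteq> q" "p \<noteq> 2"
  shows "hilbert p (int p) (int q) = Legendre (int q) (int p)"
  using hilbert_unit_prime[of p "int q"] assms hilbert_sym[of p "int p" "int q"] int_prime_dvd_prime[of p q] by (simp add: unit_char_def)

lemma hilbert_primes_equal:
  assumes "prime p" "p \<noteq> 2"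
  shows "hilbert p (int p) (int p) = chi4 (int p)"
  using hilbert_self[OF assms(1)] assms Legendre_minus_1[OF assms(1)] prime_ge_2_nat[OF assms(1)] by (simp add: unit_char_def)

lemma hilbert_2_primes:
  assumes "prime p" "prime q" "p \<noteq> 2" "q \<noteq> 2"
  shows "hilbert 2 (int p) (int q) = (if chi4 (int p) = -1 \<and> chi4 (int q) = -1 then -1 else 1)"
  using hilbert_2_odd[of "int p" "int q"] assms prime_odd_nat prime_ge_2_nat[of p] prime_ge_2_nat[of q]
  by (auto simp: unit_pairing_def le_less)

lemma hilbert_2_prime_2:
  assumes "prime p" "p \<noteq> 2"
  shows "hilbert 2 (int p) 2 = chi8 (int p)"
proof -
  have "odd p" using assms prime_odd_nat prime_ge_2_nat[of p] by (auto simp: le_less)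
  then show ?thesis using hilbert_unit_prime[of 2 "int p"] by (simp add: unit_char_def)
qed

theorem ramified_split_anisotropic:
  assumes p: "prime p" and q: "prime q" and d: "squarefree d" and l: "prime l"
    and h: "hilbert l (int p) (int q) = -1" and ds: "local_square l d"
  shows "\<not> quaternary_isotropic (int p) (int q) d"
proof (cases "l = 2")
  case True
  have d8: "d mod 8 = 1" using ds local_square_squarefree[OF l d] True by simp
  have c8: "int n mod 8 = 3 \<or> int n mod 8 = 5" if "chi8 (int n) = -1" for n :: nat
    using that by (auto simp: chi8_def split: if_splits)
  have c4: "int n mod 4 = 3" if "chi4 (int n) = -1" for n :: nat
    using that by (auto simp: chi4_def split: if_splits)
  consider "p = 2" "q = 2" | "p = 2" "q \<noteq> 2" | "p \<noteq> 2" "q = 2" | "p \<noteq> 2" "q \<noteq> 2" by blast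
  then show ?thesis
  proof cases
    case 1
    then show ?thesis using h True hilbert_self[of 2] by (simp add: unit_char_def chi8_def)
  next
    case 2
    then have "chi8 (int q) = -1" using h True hilbert_2_prime_2[OF q] hilbert_sym[of 2 2 "int q"] by simp
    then show ?thesis using anisotropic_2[OF c8 d8, of q] 2 by (simp add: quaternary_isotropic_sym)
  next
    case 3
    then have "chi8 (int p) = -1" using h True hilbert_2_prime_2[OF p] by simp
    then show ?thesis using anisotropic_2[OF c8 d8, of p] 3 by simp
  next
    case 4
    then have "chi4 (int p) = -1" "chi4 (int q) = -1"
      using h True hilbert_2_primes[OF p q] by (auto split: if_splits)
    then show ?thesis by (intro anisotropic_both_3_mod_4 c4 d8)
  qed
next
  case False
  have dl: "Legendre d (int l) = 1" using ds local_square_squarefree[OF l d] False by simp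
  have "l = p \<or> l = q" using hilbert_primes_other[OF l p q] h False by force
  then consider "l = p" "p = q" | "l = p" "p \<noteq> q" | "l = q" "p \<noteq> q" by blast
  then show ?thesis
  proof cases
    case 1
    then have "Legendre (-1) (int l) = -1"
      using h False hilbert_primes_equal[OF p] Legendre_minus_1[OF p] prime_ge_2_nat[OF p] by simp
    then show ?thesis using anisotropic_equal_primes[OF l False _ dl] 1 by simp
  next
    case 2
    then have "Legendre (int q) (int l) = -1" using h False hilbert_primes_left[OF p q] by simp
    then show ?thesis using anisotropic_odd_ramified[OF l False _ dl] 2 by simp
  next
    case 3
    then have "Legendre (int p) (int l) = -1"
      using h False hilbert_primes_left[OF q p] hilbert_sym[of q "int p" "int q"] by simp
    then have "\<not> quaternary_isotropic (int q) (int p) d" using anisotropic_odd_ramified[OF l False _ dl] 3 by simp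
    then show ?thesis by (simp add: quaternary_isotropic_sym)
  qed
qed

theorem quaternary_isotropic_iff:
  assumes "prime p" "prime q" "squarefree d"
  shows "quaternary_isotropic (int p) (int q) d \<longleftrightarrow>
    (\<forall>l. prime l \<longrightarrow> \<not> (hilbert l (int p) (int q) = -1 \<and> local_square l d))"
proof -
  have "d \<noteq> 0" using assms(3) by auto
  then show ?thesis using ramified_split_anisotropic[OF assms] quaternary_hasse[OF assms(1,2)] by blast
qed

section \<open>The local criterion as congruences\<close>

text \<open>
  The algebra can ramify only at \<open>2\<close>, \<open>p\<close> and \<open>q\<close>.  In the last case, where \<open>p\<close> and \<open>q\<close> are distinct and odd,
  the product formula for these three symbols decides whether the two Legendre symbols agree.
\<close>
theorem ramified_split_conditions:
  fixes D :: int
  assumes p: "prime p" and q: "prime q" and d: "squarefree d"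
    and D: "\<And>l. prime l \<Longrightarrow> l \<noteq> 2 \<Longrightarrow> Legendre D (int l) = Legendre d (int l)"
  shows "(\<exists>l. prime l \<and> hilbert l (int p) (int q) = -1 \<and> local_square l d) \<longleftrightarrow>
      (odd p \<and> odd q \<and> p \<noteq> q \<and> ([p = 1] (mod 4) \<or> [q = 1] (mod 4)) \<and>
        Legendre (int p) (int q) = -1 \<and>
        (Legendre D (int p) = 1 \<or> Legendre D (int q) = 1))
    \<or> (q = 2 \<and> ([p = 3] (mod 8) \<or> [p = 5] (mod 8)) \<and>
        (Legendre D (int p) = 1 \<or> [d = 1] (mod 8)))
    \<or> (p = 2 \<and> ([q = 3] (mod 8) \<or> [q = 5] (mod 8)) \<and>
        (Legendre D (int q) = 1 \<or> [d = 1] (mod 8)))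
    \<or> (odd p \<and> odd q \<and> [p = 3] (mod 4) \<and> [q = 3] (mod 4) \<and>
        ((Legendre (int q) (int p) \<noteq> 1 \<and>
            (Legendre D (int p) = 1 \<or> [d = 1] (mod 8))) \<or>
         (Legendre (int p) (int q) \<noteq> 1 \<and>
            (Legendre D (int q) = 1 \<or> [d = 1] (mod 8)))))"
    (is "?L \<longleftrightarrow> ?R")
proof -
  have split: "?L \<longleftrightarrow> (hilbert 2 (int p) (int q) = -1 \<and> [d = 1] (mod 8))
      \<or> (p \<noteq> 2 \<and> hilbert p (int p) (int q) = -1 \<and> Legendre D (int p) = 1)
      \<or> (q \<noteq> 2 \<and> hilbert q (int p) (int q) = -1 \<and> Legendre D (int q) = 1)"
  proof
    assume ?L
    then obtain l where l: "prime l" "hilbert l (int p) (int q) = -1" "local_square l d" by blast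
    then have "l = 2 \<or> l = p \<or> l = q" using hilbert_primes_other[OF l(1) p q] by force
    then show "(hilbert 2 (int p) (int q) = -1 \<and> [d = 1] (mod 8))
      \<or> (p \<noteq> 2 \<and> hilbert p (int p) (int q) = -1 \<and> Legendre D (int p) = 1)
      \<or> (q \<noteq> 2 \<and> hilbert q (int p) (int q) = -1 \<and> Legendre D (int q) = 1)"
      using l local_square_squarefree[OF l(1) d] D[OF l(1)] by (cases "l = 2") (auto simp: cong_def)
  next
    assume "(hilbert 2 (int p) (int q) = -1 \<and> [d = 1] (mod 8))
      \<or> (p \<noteq> 2 \<and> hilbert p (int p) (int q) = -1 \<and> Legendre D (int p) = 1)
      \<or> (q \<noteq> 2 \<and> hilbert q (int p) (int q) = -1 \<and> Legendre D (int q) = 1)"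
    then show ?L
    proof (elim disjE conjE)
      assume "hilbert 2 (int p) (int q) = -1" "[d = 1] (mod 8)"
      then show ?L using local_square_squarefree[OF two_is_prime_nat d] by (intro exI[of _ 2]) (simp add: cong_def)
    next
      assume "p \<noteq> 2" "hilbert p (int p) (int q) = -1" "Legendre D (int p) = 1"
      then show ?L using local_square_squarefree[OF p d] D[OF p] p by (intro exI[of _ p]) simp
    next
      assume "q \<noteq> 2" "hilbert q (int p) (int q) = -1" "Legendre D (int q) = 1"
      then show ?L using local_square_squarefree[OF q d] D[OF q] q by (intro exI[of _ q]) simp
    qed
  qed
  have odd: "odd n" if "prime n" "n \<noteq> 2" for n :: nat
    using that prime_odd_nat prime_ge_2_nat[of n] by (auto simp: le_less)
  have c4: "chi4 (int n) = -1 \<longleftrightarrow> [n = 3] (mod 4)" "chi4 (int n) = 1 \<longleftrightarrow> [n = 1] (mod 4)" for n :: nat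
  proof -
    have "int n mod 4 = int (n mod 4)" by (simp add: zmod_int)
    then show "chi4 (int n) = -1 \<longleftrightarrow> [n = 3] (mod 4)" "chi4 (int n) = 1 \<longleftrightarrow> [n = 1] (mod 4)"
      by (auto simp: chi4_def cong_def)
  qed
  have c8: "chi8 (int n) = -1 \<longleftrightarrow> [n = 3] (mod 8) \<or> [n = 5] (mod 8)" for n :: nat
  proof -
    have "int n mod 8 = int (n mod 8)" by (simp add: zmod_int)
    then show ?thesis by (auto simp: chi8_def cong_def)
  qed
  have n2: "\<not> [2 = 3] (mod (8::nat))" "\<not> [2 = 5] (mod (8::nat))" by (simp_all add: cong_def)
  consider "p = 2" "q = 2" | "p = 2" "q \<noteq> 2" | "p \<noteq> 2" "q = 2" | "p \<noteq> 2" "p = q" | "p \<noteq> 2" "q \<noteq> 2" "p \<noteq> q" by blast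
  then show ?thesis
  proof cases
    case 1
    then show ?thesis unfolding split using n2 hilbert_self[of 2] by (simp add: unit_char_def chi8_def)
  next
    case 2
    have "hilbert 2 (int p) (int q) = chi8 (int q)" using 2 hilbert_2_prime_2[OF q] hilbert_sym[of 2 2 "int q"] by simp
    moreover have "hilbert q (int p) (int q) = chi8 (int q)"
      using 2 hilbert_primes_left[OF q p] hilbert_sym[of q "int p"] Legendre_2[OF q] prime_ge_2_nat[OF q] by simp
    ultimately show ?thesis unfolding split using 2 c8[of q] by auto
  next
    case 3
    have "hilbert 2 (int p) (int q) = chi8 (int p)" using 3 hilbert_2_prime_2[OF p] by simp
    moreover have "hilbert p (int p) (int q) = chi8 (int p)"
      using 3 hilbert_primes_left[OF p q] Legendre_2[OF p] prime_ge_2_nat[OF p] by simp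
    ultimately show ?thesis unfolding split using 3 c8[of p] by auto
  next
    case 4
    have "hilbert 2 (int p) (int q) = chi4 (int p)"
      using 4 hilbert_2_primes[OF p q] chi4_odd[of "int p"] odd[OF p] by auto
    moreover have "hilbert p (int p) (int q) = chi4 (int p)" using 4 hilbert_primes_equal[OF p] by simp
    moreover have "Legendre (int p) (int p) = 0" by (simp add: Legendre_eq_0_iff)
    ultimately show ?thesis unfolding split using 4 c4[of p] odd[OF p] by auto
  next
    case 5
    have o: "odd p" "odd q" using 5 odd p q by auto
    have g: "2 < p" "2 < q" using 5 prime_ge_2_nat[OF p] prime_ge_2_nat[OF q] by auto
    have h2: "hilbert 2 (int p) (int q) = (if [p = 3] (mod 4) \<and> [q = 3] (mod 4) then -1 else 1)"
      using hilbert_2_primes[OF p q] 5 c4 by simp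
    have hp: "hilbert p (int p) (int q) = Legendre (int q) (int p)" using hilbert_primes_left[OF p q] 5 by simp
    have hq: "hilbert q (int p) (int q) = Legendre (int p) (int q)"
      using hilbert_primes_left[OF q p] 5 hilbert_sym[of q "int p"] by simp
    have "(\<Prod>l\<in>{2, p, q}. hilbert l (int p) (int q)) = 1"
      using p q by (intro hilbert_product_formula) (auto simp: prime_gt_0_nat dest: primes_dvd_imp_eq)
    then have prod: "hilbert 2 (int p) (int q) * (Legendre (int q) (int p) * Legendre (int p) (int q)) = 1"
      using 5 hp hq by simp
    have one: "[n = 1] (mod 4) \<longleftrightarrow> \<not> [n = 3] (mod 4)" if "odd n" for n :: nat
      using chi4_odd[of "int n"] that c4[of n] by auto
    have v: "Legendre (int q) (int p) \<in> {-1, 1}" "Legendre (int p) (int q) \<in> {-1, 1}"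
      using prod Legendre_values[of "int q" "int p"] Legendre_values[of "int p" "int q"] by auto
    show ?thesis
    proof (cases "[p = 3] (mod 4) \<and> [q = 3] (mod 4)")
      case True
      then have n: "\<not> [p = 1] (mod 4)" "\<not> [q = 1] (mod 4)" using one o by auto
      have "Legendre (int q) (int p) = -1 \<and> Legendre (int p) (int q) = 1
          \<or> Legendre (int q) (int p) = 1 \<and> Legendre (int p) (int q) = -1"
        using True v prod h2 by auto
      then show ?thesis
        unfolding split hp hq using True n 5 o h2 by (elim disjE conjE) (simp_all, blast+)
    next
      case False
      then have n: "[p = 1] (mod 4) \<or> [q = 1] (mod 4)" using one o by auto
      have "hilbert 2 (int p) (int q) = 1" using False h2 by (simp only: if_False)
      moreover then have "Legendre (int q) (int p) = Legendre (int p) (int q)"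
        using v prod by auto
      moreover have "\<not> ([p = 3] (mod 4) \<and> [q = 3] (mod 4) \<and> V)" for V using False by blast
      ultimately show ?thesis
        unfolding split hp hq using n 5 o by (simp; use False in blast)
    qed
  qed
qed

section \<open>The quadratic field and its quaternion algebra\<close>

lemma field_complex_field: "field complex_field"
  by (rule field_from_type_algebra)

lemma complex_field_a_inv: "\<ominus>\<^bsub>complex_field\<^esub> x = - x"
proof -
  interpret field complex_field by (rule field_complex_field)
  show ?thesis by (rule minus_equality) (simp_all add: ring_of_type_algebra_def)
qed

lemma complex_field_m_inv: "x \<noteq> 0 \<Longrightarrow> inv\<^bsub>complex_field\<^esub> x = inverse x"
proof -
  assume "x \<noteq> 0"
  interpret field complex_field by (rule field_complex_field)
  show ?thesis by (rule inv_unique'[symmetric]) (use \<open>x \<noteq> 0\<close> in \<open>simp_all add: ring_of_type_algebra_def\<close>)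
qed

lemma int_square_eq_squarefree_mult:
  fixes x y d :: int
  assumes "squarefree d" "d \<noteq> 1" "x\<^sup>2 = d * y\<^sup>2"
  shows "y = 0"
proof (rule ccontr)
  assume y: "y \<noteq> 0"
  have "y\<^sup>2 dvd x\<^sup>2" using assms(3) by simp
  then have "y dvd x" by (simp add: pow_divides_pow_iff)
  then obtain k where k: "x = y * k" by auto
  have "k\<^sup>2 * y\<^sup>2 = d * y\<^sup>2" using assms(3) by (simp add: k power_mult_distrib mult.commute)
  then have d: "k\<^sup>2 = d" using y by simp
  then have "k dvd 1" using squarefreeD[OF assms(1), of k] by simp
  then have "k\<^sup>2 = 1" by (auto simp: zdvd1_eq power2_eq_1_iff)
  then show False using d assms(2) by simp
qed

lemma rat_as_fraction:
  fixes r :: rat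
  obtains a b :: int where "b > 0" "coprime a b" "r = of_int a / of_int b"
  by (metis quotient_of_coprime quotient_of_denom_pos quotient_of_div surj_pair)

lemma rat_square_eq_squarefree_mult:
  fixes x y :: rat
  assumes "squarefree d" "d \<noteq> 1" "x\<^sup>2 = of_int d * y\<^sup>2"
  shows "x = 0 \<and> y = 0"
proof -
  obtain a b where ab: "b > 0" "x = of_int a / of_int b" by (rule rat_as_fraction)
  obtain u v where uv: "v > 0" "y = of_int u / of_int v" by (rule rat_as_fraction)
  have "of_int ((a * v)\<^sup>2) = (of_int (d * (u * b)\<^sup>2) :: rat)"
    using assms(3) ab uv by (simp add: field_simps)
  then have "(a * v)\<^sup>2 = d * (u * b)\<^sup>2" using of_int_eq_iff by blast
  then have "u * b = 0" by (rule int_square_eq_squarefree_mult[OF assms(1,2)])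
  then have "y = 0" using ab uv by simp
  then show ?thesis using assms(3) by simp
qed

lemma quaternary_isotropic_rat:
  fixes x y z w :: rat
  assumes "of_int p * x\<^sup>2 + of_int q * y\<^sup>2 - of_int p * of_int q * z\<^sup>2 = of_int d * w\<^sup>2"
    and "(x, y, z, w) \<noteq> (0, 0, 0, 0)"
  shows "quaternary_isotropic p q d"
proof -
  obtain a1 b1 where 1: "b1 > 0" "x = of_int a1 / of_int b1" by (rule rat_as_fraction)
  obtain a2 b2 where 2: "b2 > 0" "y = of_int a2 / of_int b2" by (rule rat_as_fraction)
  obtain a3 b3 where 3: "b3 > 0" "z = of_int a3 / of_int b3" by (rule rat_as_fraction)
  obtain a4 b4 where 4: "b4 > 0" "w = of_int a4 / of_int b4" by (rule rat_as_fraction)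
  define N where "N = b1 * b2 * b3 * b4"
  define x' y' z' w' where "x' = a1 * b2 * b3 * b4" and "y' = a2 * b1 * b3 * b4"
    and "z' = a3 * b1 * b2 * b4" and "w' = a4 * b1 * b2 * b3"
  have eqs: "of_int x' = of_int N * x" "of_int y' = of_int N * y" "of_int z' = of_int N * z" "of_int w' = of_int N * w"
    using 1 2 3 4 by (simp_all add: x'_def y'_def z'_def w'_def N_def)
  have "of_int (p * x'\<^sup>2 + q * y'\<^sup>2 - p * q * z'\<^sup>2) =
      (of_int N)\<^sup>2 * (of_int p * x\<^sup>2 + of_int q * y\<^sup>2 - of_int p * of_int q * z\<^sup>2)"
    by (simp add: eqs power_mult_distrib algebra_simps)
  also have "\<dots> = of_int (d * w'\<^sup>2)" unfolding assms(1) by (simp add: eqs power_mult_distrib)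
  finally have "p * x'\<^sup>2 + q * y'\<^sup>2 - p * q * z'\<^sup>2 = d * w'\<^sup>2" using of_int_eq_iff by blast
  moreover have "(x', y', z', w') \<noteq> (0, 0, 0, 0)"
    using assms(2) 1 2 3 4 by (auto simp: x'_def y'_def z'_def w'_def)
  ultimately show ?thesis unfolding quaternary_isotropic_def by blast
qed

locale quadratic =
  fixes d :: int
  assumes sf: "squarefree d" and d1: "d \<noteq> 1"
begin

abbreviation s :: complex where "s \<equiv> csqrt (of_int d)"

abbreviation K :: "complex set" where "K \<equiv> quadratic_field d"

abbreviation elt :: "rat \<Rightarrow> rat \<Rightarrow> complex" where "elt a b \<equiv> of_rat a + of_rat b * s"

lemma s_square: "s * s = of_int d"
  by (metis power2_csqrt power2_eq_square)

lemma elt_mult: "elt a b * elt a' b' = elt (a * a' + of_int d * b * b') (a * b' + b * a')"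
proof -
  have "elt a b * elt a' b' = of_rat a * of_rat a' + of_rat b * of_rat b' * (s * s)
      + (of_rat a * of_rat b' + of_rat b * of_rat a') * s" by (simp add: algebra_simps)
  then show ?thesis by (simp add: s_square of_rat_add of_rat_mult algebra_simps)
qed

lemma elt_eq_0_iff: "elt a b = 0 \<longleftrightarrow> a = 0 \<and> b = 0"
proof
  assume "elt a b = 0"
  then have "of_rat a = - (of_rat b * s)" by (simp add: eq_neg_iff_add_eq_0)
  then have "of_rat a * of_rat a = of_rat b * of_rat b * (s * s)" by (simp add: algebra_simps)
  then have "(of_rat (a\<^sup>2) :: complex) = of_rat (of_int d * b\<^sup>2)"
    by (simp add: s_square of_rat_mult power2_eq_square algebra_simps)
  then have "a\<^sup>2 = of_int d * b\<^sup>2" by (simp only: of_rat_eq_iff)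
  then show "a = 0 \<and> b = 0" by (rule rat_square_eq_squarefree_mult[OF sf d1])
qed auto

lemma elt_eq_iff: "elt a b = elt a' b' \<longleftrightarrow> a = a' \<and> b = b'"
proof -
  have "elt a b = elt a' b' \<longleftrightarrow> elt (a - a') (b - b') = 0"
    by (simp add: of_rat_diff algebra_simps)
  then show ?thesis by (simp only: elt_eq_0_iff) auto
qed

lemma K_eq: "K = {elt a b |a b. True}"
proof
  show "K \<subseteq> {elt a b |a b. True}"
  proof
    fix x assume "x \<in> K"
    then have "x \<in> generate_field complex_field {s}" by (simp add: quadratic_field_def)
    then show "x \<in> {elt a b |a b. True}"
    proof (induction rule: generate_field.induct)
      case one
      have "\<one>\<^bsub>complex_field\<^esub> = elt 1 0" by (simp add: ring_of_type_algebra_def)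
      then show ?case by blast
    next
      case (incl h)
      then have "h = elt 0 1" by simp
      then show ?case by blast
    next
      case (a_inv h)
      then obtain a b where "h = elt a b" by blast
      then have "\<ominus>\<^bsub>complex_field\<^esub> h = elt (- a) (- b)"
        by (simp add: complex_field_a_inv of_rat_minus)
      then show ?case by blast
    next
      case (m_inv h)
      then obtain a b where h: "h = elt a b" by blast
      have h0: "h \<noteq> 0" using m_inv by (simp add: ring_of_type_algebra_def)
      define N where "N = a\<^sup>2 - of_int d * b\<^sup>2"
      have N0: "N \<noteq> 0" using rat_square_eq_squarefree_mult[OF sf d1, of a b] h0 h by (auto simp: N_def)
      have "h * elt (a / N) (- b / N) = elt (a * (a / N) + of_int d * b * (- b / N)) (a * (- b / N) + b * (a / N))"
        unfolding h by (rule elt_mult)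
      also have "a * (a / N) + of_int d * b * (- b / N) = (a * a - of_int d * b * b) / N"
        by (simp add: diff_divide_distrib)
      also have "a * a - of_int d * b * b = N" by (simp add: N_def power2_eq_square)
      also have "a * (- b / N) + b * (a / N) = 0" by simp
      finally have "h * elt (a / N) (- b / N) = 1" using N0 by simp
      then have "inverse h = elt (a / N) (- b / N)" by (rule inverse_unique)
      then have "inv\<^bsub>complex_field\<^esub> h = elt (a / N) (- b / N)"
        using complex_field_m_inv[OF h0] by simp
      then show ?case by blast
    next
      case (eng_add h1 h2)
      then obtain a b a' b' where "h1 = elt a b" "h2 = elt a' b'" by blast
      then have "h1 \<oplus>\<^bsub>complex_field\<^esub> h2 = elt (a + a') (b + b')" by (simp add: ring_of_type_algebra_def of_rat_add algebra_simps)
      then show ?case by blast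
    next
      case (eng_mult h1 h2)
      then obtain a b a' b' where h: "h1 = elt a b" "h2 = elt a' b'" by blast
      have "h1 \<otimes>\<^bsub>complex_field\<^esub> h2 = elt (a * a' + of_int d * b * b') (a * b' + b * a')"
        using elt_mult[of a b a' b'] by (simp add: ring_of_type_algebra_def h)
      then show ?case by blast
    qed
  qed
  let ?G = "generate_field complex_field {s}"
  have add: "x + y \<in> ?G" if "x \<in> ?G" "y \<in> ?G" for x y
    using generate_field.eng_add[OF that] by (simp add: ring_of_type_algebra_def)
  have mult: "x * y \<in> ?G" if "x \<in> ?G" "y \<in> ?G" for x y
    using generate_field.eng_mult[OF that] by (simp add: ring_of_type_algebra_def)
  have minus: "- x \<in> ?G" if "x \<in> ?G" for x
    using generate_field.a_inv[OF that] by (simp add: complex_field_a_inv)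
  have inv: "inverse x \<in> ?G" if "x \<in> ?G" "x \<noteq> 0" for x
    using generate_field.m_inv[OF that(1)] that(2) complex_field_m_inv[OF that(2)] by (simp add: ring_of_type_algebra_def)
  have one: "1 \<in> ?G" using generate_field.one[of complex_field "{s}"] by (simp add: ring_of_type_algebra_def)
  have zero: "0 \<in> ?G" using add[OF one minus[OF one]] by simp
  have nat: "of_nat n \<in> ?G" for n
    by (induction n) (auto intro: zero add one)
  have int: "of_int k \<in> ?G" for k
    by (cases k rule: int_cases2) (auto intro: nat minus)
  have rat: "of_rat r \<in> ?G" for r
  proof -
    obtain a b where ab: "b > 0" "r = of_int a / of_int b" by (rule rat_as_fraction)
    have "of_rat r = of_int a * inverse (of_int b :: complex)"
      using ab by (simp add: divide_inverse of_rat_mult of_rat_inverse)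
    then show ?thesis using ab by (auto intro!: mult int inv)
  qed
  have "s \<in> ?G" by (intro generate_field.incl) simp
  then show "{elt a b |a b. True} \<subseteq> K"
    unfolding quadratic_field_def by (auto intro!: add mult rat)
qed

lemma elt_in_K [simp]: "elt a b \<in> K"
  by (auto simp: K_eq)

lemma K_obtain:
  assumes "x \<in> K"
  obtains a b where "x = elt a b"
  using assms by (auto simp: K_eq)

lemma of_int_in_K: "of_int n \<in> K"
  using elt_in_K[of "of_int n" 0] by (simp del: elt_in_K)

lemma K_add: "x \<in> K \<Longrightarrow> y \<in> K \<Longrightarrow> x + y \<in> K"
proof -
  assume "x \<in> K" "y \<in> K"
  then obtain a b a' b' where h: "x = elt a b" "y = elt a' b'" by (metis K_obtain)
  have "x + y = elt (a + a') (b + b')" by (simp add: h of_rat_add algebra_simps)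
  then show ?thesis using elt_in_K by metis
qed

lemma K_minus: "x \<in> K \<Longrightarrow> - x \<in> K"
proof -
  assume "x \<in> K"
  then obtain a b where h: "x = elt a b" by (metis K_obtain)
  have "- x = elt (- a) (- b)" by (simp add: h of_rat_minus)
  then show ?thesis using elt_in_K by metis
qed

lemma K_mult: "x \<in> K \<Longrightarrow> y \<in> K \<Longrightarrow> x * y \<in> K"
  by (metis K_obtain elt_mult elt_in_K)

lemma K_diff: "x \<in> K \<Longrightarrow> y \<in> K \<Longrightarrow> x - y \<in> K"
  using K_add[of x "- y"] K_minus[of y] by simp

lemma field_K: "field (subfield_ring K)"
  unfolding quadratic_field_def
  by (rule field.generate_field_is_field[OF field_complex_field]) (simp add: ring_of_type_algebra_def)

lemma K_a_minus:
  assumes "x \<in> K" "y \<in> K"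
  shows "x \<ominus>\<^bsub>subfield_ring K\<^esub> y = x - y"
proof -
  interpret field "subfield_ring K" by (rule field_K)
  have "\<ominus>\<^bsub>subfield_ring K\<^esub> y = - y"
    by (rule minus_equality) (use assms K_minus in \<open>simp_all add: ring_of_type_algebra_def\<close>)
  then show ?thesis by (simp add: a_minus_def ring_of_type_algebra_def)
qed

lemma K_inverse: "x \<in> K \<Longrightarrow> inverse x \<in> K"
proof (cases "x = 0")
  case False
  assume x: "x \<in> K"
  have "inv\<^bsub>complex_field\<^esub> x \<in> generate_field complex_field {s}"
    using x False by (intro generate_field.m_inv) (auto simp: quadratic_field_def ring_of_type_algebra_def)
  then show ?thesis using complex_field_m_inv[OF False] by (simp add: quadratic_field_def)
qed simp

context
  fixes \<alpha> \<beta> :: complex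
  assumes ab: "\<alpha> \<in> K" "\<beta> \<in> K"
begin

abbreviation H :: "complex quat ring" where
  "H \<equiv> quaternion_algebra (subfield_ring K) \<alpha> \<beta>"

definition quat_norm :: "complex quat \<Rightarrow> complex" where
  "quat_norm = (\<lambda>(a, b, c, e). a\<^sup>2 - \<alpha> * b\<^sup>2 - \<beta> * c\<^sup>2 + \<alpha> * \<beta> * e\<^sup>2)"

lemma ring_H: "ring H"
proof -
  interpret field "subfield_ring K" by (rule field_K)
  show ?thesis by (rule ring_quaternion_algebra) (use ab in simp_all)
qed

lemma carrier_H: "carrier H = K \<times> K \<times> K \<times> K"
  by (simp add: quaternion_algebra_def)

lemma one_H: "\<one>\<^bsub>H\<^esub> = (1, 0, 0, 0)"
  by (simp add: quaternion_algebra_def ring_of_type_algebra_def)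

lemma zero_H: "\<zero>\<^bsub>H\<^esub> = (0, 0, 0, 0)"
  by (simp add: quaternion_algebra_def ring_of_type_algebra_def)

lemma mult_H:
  assumes "a1 \<in> K" "b1 \<in> K" "c1 \<in> K" "e1 \<in> K" "a2 \<in> K" "b2 \<in> K" "c2 \<in> K" "e2 \<in> K"
  shows "(a1, b1, c1, e1) \<otimes>\<^bsub>H\<^esub> (a2, b2, c2, e2) =
    (a1 * a2 + \<alpha> * (b1 * b2) + \<beta> * (c1 * c2) - \<alpha> * \<beta> * (e1 * e2),
     a1 * b2 + b1 * a2 + \<beta> * (e1 * c2) - \<beta> * (c1 * e2),
     a1 * c2 + c1 * a2 + \<alpha> * (b1 * e2) - \<alpha> * (e1 * b2),
     a1 * e2 + e1 * a2 + b1 * c2 - c1 * b2)"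
proof -
  have [simp]: "\<And>x y. x \<oplus>\<^bsub>complex_field\<^esub> y = x + y" "\<And>x y. x \<otimes>\<^bsub>complex_field\<^esub> y = x * y"
    by (simp_all add: ring_of_type_algebra_def)
  show ?thesis
    by (simp add: quaternion_algebra_def K_a_minus K_add K_mult assms ab)
qed

text \<open>
  A quaternion times its conjugate is its norm.  So a nonzero norm gives an inverse, and a unit
  of norm \<open>0\<close> would have conjugate \<open>0\<close>.
\<close>
lemma division_algebra_iff_anisotropic:
  "is_division_algebra H \<longleftrightarrow> (\<forall>x\<in>carrier H. quat_norm x = 0 \<longrightarrow> x = \<zero>\<^bsub>H\<^esub>)"
proof -
  interpret H: ring H by (rule ring_H)
  define conjugate :: "complex quat \<Rightarrow> complex quat" where "conjugate = (\<lambda>(a, b, c, e). (a, - b, - c, - e))"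
  have conjugate_in: "conjugate x \<in> carrier H" if "x \<in> carrier H" for x
    using that by (auto simp: carrier_H conjugate_def K_minus)
  have conjugate_mult: "conjugate x \<otimes>\<^bsub>H\<^esub> x = (quat_norm x, 0, 0, 0)" "x \<otimes>\<^bsub>H\<^esub> conjugate x = (quat_norm x, 0, 0, 0)" if "x \<in> carrier H" for x
    using that by (auto simp: carrier_H conjugate_def mult_H K_minus quat_norm_def power2_eq_square algebra_simps)
  show ?thesis
  proof
    assume div: "is_division_algebra H"
    show "\<forall>x\<in>carrier H. quat_norm x = 0 \<longrightarrow> x = \<zero>\<^bsub>H\<^esub>"
    proof (intro ballI impI, rule ccontr)
      fix x assume x: "x \<in> carrier H" "quat_norm x = 0" "x \<noteq> \<zero>\<^bsub>H\<^esub>"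
      then have "x \<in> Units H" using div by (auto simp: is_division_algebra_def)
      then obtain y where y: "y \<in> carrier H" "x \<otimes>\<^bsub>H\<^esub> y = \<one>\<^bsub>H\<^esub>" by (auto simp: Units_def)
      have "conjugate x = conjugate x \<otimes>\<^bsub>H\<^esub> (x \<otimes>\<^bsub>H\<^esub> y)" using conjugate_in[OF x(1)] y by simp
      also have "\<dots> = (conjugate x \<otimes>\<^bsub>H\<^esub> x) \<otimes>\<^bsub>H\<^esub> y" using conjugate_in[OF x(1)] x(1) y(1) by (simp add: H.m_assoc)
      also have "conjugate x \<otimes>\<^bsub>H\<^esub> x = \<zero>\<^bsub>H\<^esub>" using conjugate_mult[OF x(1)] x(2) by (simp add: zero_H)
      finally have "conjugate x = \<zero>\<^bsub>H\<^esub>" using y(1) by simp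
      then have "x = \<zero>\<^bsub>H\<^esub>" by (cases x) (simp add: conjugate_def zero_H)
      then show False using x by simp
    qed
  next
    assume an: "\<forall>x\<in>carrier H. quat_norm x = 0 \<longrightarrow> x = \<zero>\<^bsub>H\<^esub>"
    have "x \<in> Units H" if x: "x \<in> carrier H" "x \<noteq> \<zero>\<^bsub>H\<^esub>" for x
    proof -
      define n where "n = inverse (quat_norm x)"
      have n0: "quat_norm x \<noteq> 0" using an x by auto
      have "quat_norm x \<in> K"
        using x(1) ab by (auto simp: carrier_H quat_norm_def power2_eq_square intro!: K_add K_diff K_mult)
      then have "n \<in> K" unfolding n_def by (rule K_inverse)
      have zK: "0 \<in> K" using of_int_in_K[of 0] by simp
      define y where "y = (n, 0, 0, 0) \<otimes>\<^bsub>H\<^esub> conjugate x"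
      have nH: "(n, 0, 0, 0) \<in> carrier H" "(quat_norm x, 0, 0, 0) \<in> carrier H"
        using \<open>n \<in> K\<close> \<open>quat_norm x \<in> K\<close> zK by (simp_all add: carrier_H)
      have y: "y \<in> carrier H" unfolding y_def using nH conjugate_in[OF x(1)] by simp
      have nn: "(n, 0, 0, 0) \<otimes>\<^bsub>H\<^esub> (quat_norm x, 0, 0, 0) = \<one>\<^bsub>H\<^esub>"
        using \<open>n \<in> K\<close> \<open>quat_norm x \<in> K\<close> zK n0 by (simp add: mult_H one_H n_def)
      have "y \<otimes>\<^bsub>H\<^esub> x = (n, 0, 0, 0) \<otimes>\<^bsub>H\<^esub> (conjugate x \<otimes>\<^bsub>H\<^esub> x)"
        unfolding y_def using nH conjugate_in[OF x(1)] x(1) by (simp add: H.m_assoc)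
      then have 1: "y \<otimes>\<^bsub>H\<^esub> x = \<one>\<^bsub>H\<^esub>" using conjugate_mult[OF x(1)] nn by simp
      have comm: "x \<otimes>\<^bsub>H\<^esub> (n, 0, 0, 0) = (n, 0, 0, 0) \<otimes>\<^bsub>H\<^esub> x"
        using x(1) \<open>n \<in> K\<close> zK by (auto simp: carrier_H mult_H mult.commute)
      have "x \<otimes>\<^bsub>H\<^esub> y = (x \<otimes>\<^bsub>H\<^esub> (n, 0, 0, 0)) \<otimes>\<^bsub>H\<^esub> conjugate x"
        unfolding y_def using nH conjugate_in[OF x(1)] x(1) by (simp add: H.m_assoc)
      also have "\<dots> = (n, 0, 0, 0) \<otimes>\<^bsub>H\<^esub> (x \<otimes>\<^bsub>H\<^esub> conjugate x)"
        unfolding comm using nH conjugate_in[OF x(1)] x(1) by (simp add: H.m_assoc)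
      finally have "x \<otimes>\<^bsub>H\<^esub> y = \<one>\<^bsub>H\<^esub>" using conjugate_mult[OF x(1)] nn by simp
      with 1 show ?thesis using x(1) y by (auto simp: Units_def)
    qed
    moreover have "\<zero>\<^bsub>H\<^esub> \<notin> Units H"
    proof
      assume "\<zero>\<^bsub>H\<^esub> \<in> Units H"
      then obtain y where "y \<in> carrier H" "y \<otimes>\<^bsub>H\<^esub> \<zero>\<^bsub>H\<^esub> = \<one>\<^bsub>H\<^esub>" by (auto simp: Units_def)
      then have "\<zero>\<^bsub>H\<^esub> = \<one>\<^bsub>H\<^esub>" by simp
      then show False by (simp add: zero_H one_H)
    qed
    moreover have "Units H \<subseteq> carrier H" by (auto simp: Units_def)
    ultimately have "Units H = carrier H - {\<zero>\<^bsub>H\<^esub>}" by blast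
    then show "is_division_algebra H" using ring_H by (simp add: is_division_algebra_def)
  qed
qed

end

text \<open>
  Write the zero as \<open>u\<^sub>0 + u\<^sub>1 \<surd>d\<close> with rational quaternions.  Comparing coordinates gives
  \<open>N u\<^sub>0 = - d N u\<^sub>1\<close> and says that the product \<open>v\<close> of \<open>u\<^sub>0\<close> with the conjugate of \<open>u\<^sub>1\<close> is pure; its norm is
  \<open>- d (N u\<^sub>1)\<^sup>2\<close>.  If \<open>N u\<^sub>1 = 0\<close> this is void, but then \<open>u\<^sub>0\<close> and \<open>u\<^sub>1\<close> both have norm \<open>0\<close> and one of them
  is nonzero, which is the second alternative.
\<close>
lemma norm_form_over_K_isotropic:
  fixes p q :: int
  assumes "a \<in> K" "b \<in> K" "c \<in> K" "e \<in> K" and nz: "(a, b, c, e) \<noteq> (0, 0, 0, 0)"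
    and "a\<^sup>2 - of_int p * b\<^sup>2 - of_int q * c\<^sup>2 + of_int p * of_int q * e\<^sup>2 = 0"
  shows "quaternary_isotropic p q d \<or> quaternary_isotropic p q 1"
proof -
  obtain a0 a1 where a: "a = elt a0 a1" using assms(1) by (rule K_obtain)
  obtain b0 b1 where b: "b = elt b0 b1" using assms(2) by (rule K_obtain)
  obtain c0 c1 where c: "c = elt c0 c1" using assms(3) by (rule K_obtain)
  obtain e0 e1 where e: "e = elt e0 e1" using assms(4) by (rule K_obtain)
  define P Q D :: rat where "P = of_int p" and "Q = of_int q" and "D = of_int d"
  define N where "N = (\<lambda>a b c e. a\<^sup>2 - P * b\<^sup>2 - Q * c\<^sup>2 + P * Q * e\<^sup>2)"
  define T where "T = a0 * a1 - P * b0 * b1 - Q * c0 * c1 + P * Q * e0 * e1"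
  have sq: "(elt u v)\<^sup>2 = elt (u\<^sup>2 + D * v\<^sup>2) (2 * u * v)" for u v
    using elt_mult[of u v u v] by (simp add: power2_eq_square D_def algebra_simps)
  have "elt (N a0 b0 c0 e0 + D * N a1 b1 c1 e1) (2 * T) =
      a\<^sup>2 - of_int p * b\<^sup>2 - of_int q * c\<^sup>2 + of_int p * of_int q * e\<^sup>2"
    unfolding a b c e sq
    by (simp add: N_def T_def P_def Q_def of_rat_add of_rat_diff of_rat_mult of_rat_power algebra_simps)
  then have "elt (N a0 b0 c0 e0 + D * N a1 b1 c1 e1) (2 * T) = 0" using assms(6) by simp
  then have n0: "N a0 b0 c0 e0 = - D * N a1 b1 c1 e1" and T0: "T = 0"
    unfolding elt_eq_0_iff by auto
  define x' y' z' where "x' = b0 * a1 - a0 * b1 - Q * e0 * c1 + Q * c0 * e1"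
    and "y' = c0 * a1 - a0 * c1 - P * b0 * e1 + P * e0 * b1"
    and "z' = e0 * a1 - a0 * e1 - b0 * c1 + c0 * b1"
  \<comment> \<open>Coordinates of \<open>u\<^sub>0\<close> times the conjugate of \<open>u\<^sub>1\<close>; the real part is \<open>T\<close>.\<close>
  have "T\<^sup>2 - P * x'\<^sup>2 - Q * y'\<^sup>2 + P * Q * z'\<^sup>2 = N a0 b0 c0 e0 * N a1 b1 c1 e1"
    unfolding T_def x'_def y'_def z'_def N_def by (simp add: power2_eq_square algebra_simps)
  then have G: "P * x'\<^sup>2 + Q * y'\<^sup>2 - P * Q * z'\<^sup>2 = D * (N a1 b1 c1 e1)\<^sup>2"
    unfolding T0 n0 by (simp add: power2_eq_square algebra_simps)
  show ?thesis
  proof (cases "N a1 b1 c1 e1 = 0")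
    case False
    then show ?thesis
      using quaternary_isotropic_rat[of p x' q y' z' d "N a1 b1 c1 e1"] G by (auto simp: P_def Q_def D_def)
  next
    case True
    have iso: "quaternary_isotropic p q 1" if "N u v w x = 0" "(u, v, w, x) \<noteq> (0, 0, 0, 0)" for u v w x
      using that by (intro quaternary_isotropic_rat[of p v q w x 1 u]) (auto simp: N_def P_def Q_def)
    have "N a0 b0 c0 e0 = 0" using n0 True by simp
    moreover have "(a0, b0, c0, e0) \<noteq> (0, 0, 0, 0) \<or> (a1, b1, c1, e1) \<noteq> (0, 0, 0, 0)"
      using nz by (auto simp: a b c e)
    ultimately show ?thesis using iso True by blast
  qed
qed

text \<open>
  Conversely, a zero \<open>(x, y, z, w)\<close> of the quaternary form is the quaternion
  \<open>w \<surd>d + x i + y j + z k\<close> of norm \<open>0\<close>.  The alternative \<open>d = 1\<close> of the previous lemma is absorbed by the local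
  criterion: \<open>1\<close> is a square everywhere, so an obstruction for \<open>d\<close> is one for \<open>1\<close>.
\<close>
theorem division_algebra_iff_quaternary:
  assumes p: "prime p" and q: "prime q"
  shows "is_division_algebra (quaternion_algebra (subfield_ring K) (of_nat p) (of_nat q)) \<longleftrightarrow>
    \<not> quaternary_isotropic (int p) (int q) d"
proof -
  let ?H = "quaternion_algebra (subfield_ring K) (of_nat p) (of_nat q)"
  have pq: "of_nat p \<in> K" "of_nat q \<in> K" using of_int_in_K[of "int p"] of_int_in_K[of "int q"] by simp_all
  have "\<not> is_division_algebra ?H \<longleftrightarrow> (\<exists>x\<in>carrier ?H. quat_norm (of_nat p) (of_nat q) x = 0 \<and> x \<noteq> \<zero>\<^bsub>?H\<^esub>)"
    using division_algebra_iff_anisotropic[OF pq] by blast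
  also have "\<dots> \<longleftrightarrow> quaternary_isotropic (int p) (int q) d"
  proof
    assume "\<exists>x\<in>carrier ?H. quat_norm (of_nat p) (of_nat q) x = 0 \<and> x \<noteq> \<zero>\<^bsub>?H\<^esub>"
    then obtain a b c e where x: "a \<in> K" "b \<in> K" "c \<in> K" "e \<in> K" "quat_norm (of_nat p) (of_nat q) (a, b, c, e) = 0"
        "(a, b, c, e) \<noteq> (0, 0, 0, 0)"
      unfolding carrier_H[OF pq] zero_H[OF pq] by auto
    then have "quaternary_isotropic (int p) (int q) d \<or> quaternary_isotropic (int p) (int q) 1"
      by (intro norm_form_over_K_isotropic[of a b c e]) (auto simp: quat_norm_def[OF pq])
    moreover have "quaternary_isotropic (int p) (int q) d" if "quaternary_isotropic (int p) (int q) 1"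
    proof -
      have "local_square l 1" if "prime l" for l
        using local_square_squarefree[OF that, of 1] Legendre_1[OF that] by simp
      then show ?thesis
        using that quaternary_isotropic_iff[OF p q sf] quaternary_isotropic_iff[OF p q, of 1] by auto
    qed
    ultimately show "quaternary_isotropic (int p) (int q) d" by blast
  next
    assume "quaternary_isotropic (int p) (int q) d"
    then obtain x y z w where eq: "int p * x\<^sup>2 + int q * y\<^sup>2 - int p * int q * z\<^sup>2 = d * w\<^sup>2"
      and nz: "(x, y, z, w) \<noteq> (0, 0, 0, 0)" unfolding quaternary_isotropic_def by blast
    let ?x = "(of_int w * s, of_int x, of_int y, of_int z) :: complex quat"
    have "s \<noteq> 0" using elt_eq_0_iff[of 0 1] by simp
    have "s \<in> K" using elt_in_K[of 0 1] by (simp del: elt_in_K)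
    have "?x \<in> carrier ?H" unfolding carrier_H[OF pq] using \<open>s \<in> K\<close> by (auto intro: K_mult of_int_in_K)
    moreover have "quat_norm (of_nat p) (of_nat q) ?x = 0"
    proof -
      have "quat_norm (of_nat p) (of_nat q) ?x = of_int (d * w\<^sup>2 - (int p * x\<^sup>2 + int q * y\<^sup>2 - int p * int q * z\<^sup>2))"
        by (simp add: quat_norm_def[OF pq] power_mult_distrib)
      then show ?thesis by (simp add: eq)
    qed
    moreover have "?x \<noteq> \<zero>\<^bsub>?H\<^esub>" unfolding zero_H[OF pq] using nz \<open>s \<noteq> 0\<close> by auto
    ultimately show "\<exists>x\<in>carrier ?H. quat_norm (of_nat p) (of_nat q) x = 0 \<and> x \<noteq> \<zero>\<^bsub>?H\<^esub>" by blast
  qed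
  finally show ?thesis by blast
qed

end

section \<open>Embeddings and trace\<close>

lemma det_2x2:
  fixes f :: "nat \<times> nat \<Rightarrow> 'a :: comm_ring_1"
  shows "Determinant.det (Matrix.mat 2 2 f) = f (0, 0) * f (1, 1) - f (0, 1) * f (1, 0)"
proof -
  have A: "Matrix.mat 2 2 f \<in> carrier_mat 2 2" by simp
  have d: "Determinant.det (mat_delete (Matrix.mat 2 2 f) i j) = mat_delete (Matrix.mat 2 2 f) i j $$ (0, 0)" for i j
    by (rule det_single) (use mat_delete_carrier[OF A] in simp)
  have "Determinant.det (Matrix.mat 2 2 f) = (\<Sum>j<2. Matrix.mat 2 2 f $$ (0, j) * cofactor (Matrix.mat 2 2 f) 0 j)"
    by (rule laplace_expansion_row[OF A]) simp
  also have "\<dots> = f (0, 0) * f (1, 1) - f (0, 1) * f (1, 0)"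
    by (simp add: numeral_2_eq_2 cofactor_def d[unfolded numeral_2_eq_2]) (simp add: mat_delete_def)
  finally show ?thesis .
qed

text \<open>The denominator of \<open>r\<^sup>k\<close> is the \<open>k\<close>-th power of that of \<open>r\<close>.\<close>
lemma rat_int_if_bounded_powers:
  fixes r :: rat and M :: int
  assumes "M > 0" and "\<And>k. \<exists>z::int. of_int M * r ^ k = of_int z"
  shows "\<exists>n::int. r = of_int n"
proof -
  obtain a b where ab: "b > 0" "coprime a b" "r = of_int a / of_int b" by (rule rat_as_fraction)
  have dv: "b ^ k dvd M" for k
  proof -
    obtain z where "of_int M * r ^ k = of_int z" using assms(2) by blast
    then have "of_int (M * a ^ k) = (of_int (z * b ^ k) :: rat)"
      using ab by (simp add: power_divide field_simps)
    then have "M * a ^ k = z * b ^ k" using of_int_eq_iff by blast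
    then have "b ^ k dvd M * a ^ k" by simp
    moreover have "coprime (b ^ k) (a ^ k)" using ab(2) by (simp add: coprime_commute)
    ultimately show ?thesis by (simp add: coprime_dvd_mult_left_iff)
  qed
  have "b = 1"
  proof (rule ccontr)
    assume "b \<noteq> 1"
    then have "2 \<le> b" using ab by simp
    have "int (nat M) < 2 ^ nat M" by (metis of_nat_less_two_power of_nat_numeral)
    also have "(2::int) ^ nat M \<le> b ^ nat M" using \<open>2 \<le> b\<close> by (intro power_mono) auto
    also have "\<dots> \<le> M" using dv assms(1) by (intro zdvd_imp_le) auto
    finally show False using assms(1) by simp
  qed
  then show ?thesis using ab by auto
qed

context quadratic begin

text \<open>The choice is unique by \<open>elt_eq_iff\<close>.\<close>
definition conjugate :: "complex \<Rightarrow> complex" where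
  "conjugate x = (SOME y. \<exists>a b. x = elt a b \<and> y = elt a (- b))"

lemma conjugate_elt: "conjugate (elt a b) = elt a (- b)"
proof -
  have "\<exists>a' b'. elt a b = elt a' b' \<and> conjugate (elt a b) = elt a' (- b')"
    unfolding conjugate_def by (rule someI_ex) blast
  then obtain a' b' where "elt a b = elt a' b'" "conjugate (elt a b) = elt a' (- b')" by blast
  then show ?thesis by (metis elt_eq_iff)
qed

lemma conjugate_add: "x \<in> K \<Longrightarrow> y \<in> K \<Longrightarrow> conjugate (x + y) = conjugate x + conjugate y"
proof -
  assume "x \<in> K" "y \<in> K"
  then obtain a b a' b' where h: "x = elt a b" "y = elt a' b'" by (metis K_obtain)
  have "x + y = elt (a + a') (b + b')" by (simp add: h of_rat_add algebra_simps)
  then have "conjugate (x + y) = elt (a + a') (- (b + b'))" by (simp only: conjugate_elt)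
  also have "\<dots> = elt a (- b) + elt a' (- b')"
    by (simp add: of_rat_add of_rat_minus of_rat_diff algebra_simps)
  finally show ?thesis unfolding h conjugate_elt .
qed

lemma conjugate_mult: "x \<in> K \<Longrightarrow> y \<in> K \<Longrightarrow> conjugate (x * y) = conjugate x * conjugate y"
proof -
  assume "x \<in> K" "y \<in> K"
  then obtain a b a' b' where h: "x = elt a b" "y = elt a' b'" by (metis K_obtain)
  show ?thesis unfolding h elt_mult conjugate_elt by (simp add: algebra_simps)
qed

lemma conjugate_of_int: "conjugate (of_int n) = of_int n"
  using conjugate_elt[of "of_int n" 0] by simp

lemma conjugate_s: "conjugate s = - s"
  using conjugate_elt[of 0 1] by (simp add: of_rat_minus)

lemma conjugate_int_combination:
  assumes "x \<in> K" "y \<in> K"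
  shows "conjugate (of_int m * x + of_int n * y) = of_int m * conjugate x + of_int n * conjugate y"
  using assms by (simp add: conjugate_add conjugate_mult conjugate_of_int K_mult of_int_in_K)

lemma s_in_K: "s \<in> K"
  using elt_in_K[of 0 1] by (simp del: elt_in_K)

lemma s_nonzero: "s \<noteq> 0"
  using elt_eq_0_iff[of 0 1] by simp

lemma embeddings_K: "embeddings K = {restrict (\<lambda>x. x) K, restrict conjugate K}"
proof
  show "{restrict (\<lambda>x. x) K, restrict conjugate K} \<subseteq> embeddings K"
    using conjugate_of_int[of 1] of_int_in_K[of 1]
    by (auto simp: embeddings_def Ring.ring_hom_def ring_of_type_algebra_def K_add K_mult conjugate_add conjugate_mult)
  show "embeddings K \<subseteq> {restrict (\<lambda>x. x) K, restrict conjugate K}"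
  proof
    fix \<sigma> assume "\<sigma> \<in> embeddings K"
    then have ext: "\<sigma> \<in> extensional K" and one: "\<sigma> 1 = 1"
      and mult: "\<And>x y. x \<in> K \<Longrightarrow> y \<in> K \<Longrightarrow> \<sigma> (x * y) = \<sigma> x * \<sigma> y"
      and add: "\<And>x y. x \<in> K \<Longrightarrow> y \<in> K \<Longrightarrow> \<sigma> (x + y) = \<sigma> x + \<sigma> y"
      by (auto simp: embeddings_def Ring.ring_hom_def ring_of_type_algebra_def)
    have inK: "of_int n \<in> K" "of_nat m \<in> K" "of_rat r \<in> K" for n m r
      using of_int_in_K[of n] of_int_in_K[of "int m"] elt_in_K[of r 0] by (simp_all del: elt_in_K)
    have zero: "\<sigma> 0 = 0" using add[of 0 0] inK(1)[of 0] by simp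
    have nat: "\<sigma> (of_nat n) = of_nat n" for n
      using inK(1)[of 1] inK(2) by (induction n) (simp_all add: zero one add)
    have minus: "\<sigma> (- x) = - \<sigma> x" if "x \<in> K" for x
      using add[OF that K_minus[OF that]] zero by (simp add: eq_neg_iff_add_eq_0 add.commute)
    have int: "\<sigma> (of_int n) = of_int n" for n
      by (cases n rule: int_cases2) (simp_all add: nat minus inK)
    have rat: "\<sigma> (of_rat r) = of_rat r" for r
    proof -
      obtain a b where ab: "b > 0" "r = of_int a / of_int b" by (rule rat_as_fraction)
      have e: "of_rat r * of_int b = (of_int a :: complex)" using ab by (simp add: of_rat_divide)
      then have "\<sigma> (of_rat r) * of_int b = of_int a" using mult[OF inK(3) inK(1), of r b] by (simp add: int)
      then have "\<sigma> (of_rat r) * of_int b = of_rat r * of_int b" using e by simp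
      then show ?thesis using ab by simp
    qed
    have "\<sigma> s * \<sigma> s = s * s" using mult[OF s_in_K s_in_K] by (simp add: s_square int)
    then have "\<sigma> s = s \<or> \<sigma> s = - s" by (simp add: square_eq_iff)
    have elt: "\<sigma> (elt a b) = of_rat a + of_rat b * \<sigma> s" for a b
      by (simp add: add mult inK s_in_K K_mult rat)
    from \<open>\<sigma> s = s \<or> \<sigma> s = - s\<close> show "\<sigma> \<in> {restrict (\<lambda>x. x) K, restrict conjugate K}"
    proof
      assume "\<sigma> s = s"
      then have "\<sigma> x = x" if "x \<in> K" for x using that elt by (metis K_obtain)
      then have "\<sigma> = restrict (\<lambda>x. x) K" using ext by (intro extensionalityI[of _ K]) auto
      then show ?thesis by simp
    next
      assume "\<sigma> s = - s"
      then have "\<sigma> (elt a b) = conjugate (elt a b)" for a b unfolding elt conjugate_elt by (simp add: of_rat_minus)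
      then have "\<sigma> x = conjugate x" if "x \<in> K" for x using that by (metis K_obtain)
      then have "\<sigma> = restrict conjugate K" using ext by (intro extensionalityI[of _ K]) auto
      then show ?thesis by simp
    qed
  qed
qed

lemma embeddings_distinct: "restrict (\<lambda>x. x) K \<noteq> restrict conjugate K"
proof
  assume "restrict (\<lambda>x. x) K = restrict conjugate K"
  then have "restrict (\<lambda>x. x) K s = restrict conjugate K s" by simp
  then have "s = - s" by (simp add: s_in_K conjugate_s)
  then show False using s_nonzero by simp
qed

lemma card_embeddings: "card (embeddings K) = 2"
  using embeddings_distinct by (simp add: embeddings_K)

lemma field_trace_K: "x \<in> K \<Longrightarrow> field_trace K x = x + conjugate x"
  using embeddings_distinct by (simp add: field_trace_def embeddings_K)

lemma discriminant_matrix: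
  assumes "\<omega> 0 \<in> K" "\<omega> 1 \<in> K"
  shows "Determinant.det (Matrix.mat 2 2 (\<lambda>(i, j). field_trace K (\<omega> i * \<omega> j))) = (\<omega> 0 * conjugate (\<omega> 1) - \<omega> 1 * conjugate (\<omega> 0))\<^sup>2"
  using assms by (simp add: det_2x2 field_trace_K conjugate_mult K_mult power2_eq_square algebra_simps)

section \<open>Integers of the quadratic field\<close>

text \<open>The ring generated by the square root of \<open>d\<close> over the integers.\<close>
definition root_order :: "complex set" where
  "root_order = {elt (of_int u) (of_int v) |u v. True}"

lemma root_order_add: "x \<in> root_order \<Longrightarrow> y \<in> root_order \<Longrightarrow> x + y \<in> root_order"
proof -
  assume "x \<in> root_order" "y \<in> root_order"
  then obtain a b a' b' :: int where h: "x = elt (of_int a) (of_int b)" "y = elt (of_int a') (of_int b')"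
    unfolding root_order_def by blast
  have "x + y = elt (of_int (a + a')) (of_int (b + b'))" by (simp add: h of_rat_add algebra_simps)
  then show ?thesis unfolding root_order_def by blast
qed

lemma root_order_int_mult: "x \<in> root_order \<Longrightarrow> of_int n * x \<in> root_order"
proof -
  assume "x \<in> root_order"
  then obtain a b :: int where h: "x = elt (of_int a) (of_int b)"
    unfolding root_order_def by blast
  have "of_int n * x = elt (of_int (n * a)) (of_int (n * b))" by (simp add: h of_rat_mult algebra_simps)
  then show ?thesis unfolding root_order_def by blast
qed

lemma root_order_sum: "(\<And>i. i \<in> A \<Longrightarrow> f i \<in> root_order) \<Longrightarrow> sum f A \<in> root_order"
proof (induction A rule: infinite_finite_induct)
  case (insert x F)
  then show ?case by (simp add: root_order_add)
next
  case empty
  have "0 = elt (of_int 0) (of_int 0)" by simp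
  then show ?case unfolding root_order_def by (simp del: of_int_0) blast
next
  case (infinite A)
  have "0 = elt (of_int 0) (of_int 0)" by simp
  then show ?case using infinite unfolding root_order_def by (simp del: of_int_0) blast
qed

text \<open>
  Integrality in the form that is convenient here: the powers of \<open>x\<close> have a common denominator.  It passes to
  norms by multiplicativity, and from \<open>x\<close> to \<open>x + 1\<close>, without sums of arbitrary algebraic integers.
\<close>
definition bounded_powers :: "complex \<Rightarrow> bool" where
  "bounded_powers x \<longleftrightarrow> (\<exists>N::int. N > 0 \<and> (\<forall>k. of_int N * x ^ k \<in> root_order))"

lemma common_denominator:
  fixes m :: nat
  assumes "\<And>i. f i \<in> K"
  shows "\<exists>N::int. N > 0 \<and> (\<forall>i<m. of_int N * f i \<in> root_order)"
proof (induction m)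
  case 0
  show ?case by (intro exI[of _ 1]) simp
next
  case (Suc m)
  then obtain N :: int where N: "N > 0" "\<forall>i<m. of_int N * f i \<in> root_order" by blast
  obtain a b where ab: "f m = elt a b" using assms K_obtain by metis
  obtain a1 a2 where a: "a2 > 0" "a = of_int a1 / of_int a2" by (rule rat_as_fraction)
  obtain b1 b2 where b: "b2 > 0" "b = of_int b1 / of_int b2" by (rule rat_as_fraction)
  define N' where "N' = N * (a2 * b2)"
  have "of_int (a2 * b2) * f m = elt (of_int (a1 * b2)) (of_int (b1 * a2))"
    using a b by (simp add: ab of_rat_divide of_rat_mult algebra_simps)
  then have "of_int (a2 * b2) * f m \<in> root_order" unfolding root_order_def by blast
  from root_order_int_mult[OF this, of N] have "of_int N' * f m \<in> root_order" by (simp add: N'_def algebra_simps)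
  moreover have "of_int N' * f i \<in> root_order" if "i < m" for i
    using root_order_int_mult[of "of_int N * f i" "a2 * b2"] N(2) that by (simp add: N'_def algebra_simps)
  ultimately show ?case using N a b by (intro exI[of _ N']) (auto simp: N'_def less_Suc_eq)
qed

text \<open>
  A monic equation of degree \<open>m\<close> writes each power as an integral combination of the first \<open>m\<close> powers,
  so a common denominator of those serves all.
\<close>
lemma algebraic_int_bounded_powers:
  assumes "x \<in> K" "algebraic_int x"
  shows "bounded_powers x"
proof -
  obtain p where p: "Polynomial.lead_coeff p = 1" "\<forall>i. Polynomial.coeff p i \<in> \<int>" "poly p x = 0"
    using assms(2) by (auto elim: algebraic_int.cases)
  define m where "m = Polynomial.degree p"
  define c where "c = (\<lambda>i. SOME z. Polynomial.coeff p i = of_int z)"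
  have c: "Polynomial.coeff p i = of_int (c i)" for i
  proof -
    have "\<exists>z::int. Polynomial.coeff p i = of_int z" using p(2) by (auto elim: Ints_cases)
    then show ?thesis unfolding c_def by (rule someI_ex)
  qed
  have "(\<Sum>i\<le>m. of_int (c i) * x ^ i) = 0" using p(3) by (simp add: poly_altdef m_def c)
  then have "(\<Sum>i<m. of_int (c i) * x ^ i) + x ^ m = 0"
    using p(1) by (simp add: c m_def flip: lessThan_Suc_atMost)
  then have xm: "x ^ m = (\<Sum>i<m. of_int (- c i) * x ^ i)"
    by (simp add: eq_neg_iff_add_eq_0 add.commute sum_negf)
  have "x ^ i \<in> K" for i
    using of_int_in_K[of 1] assms(1) by (induction i) (auto intro: K_mult)
  then obtain N :: int where N: "N > 0" "\<forall>i<m. of_int N * x ^ i \<in> root_order"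
    using common_denominator[of "\<lambda>i. x ^ i" m] by blast
  have "of_int N * x ^ k \<in> root_order" for k
  proof (induction k rule: less_induct)
    case (less k)
    show ?case
    proof (cases "k < m")
      case True
      then show ?thesis using N by blast
    next
      case False
      then have "x ^ k = x ^ (k - m) * x ^ m" by (simp flip: power_add)
      also have "\<dots> = (\<Sum>i<m. of_int (- c i) * x ^ (k - m + i))"
        unfolding xm sum_distrib_left by (intro sum.cong) (simp_all add: power_add mult_ac)
      finally have "of_int N * x ^ k = (\<Sum>i<m. of_int (- c i) * (of_int N * x ^ (k - m + i)))"
        by (simp add: sum_distrib_left mult_ac)
      moreover have "of_int (- c i) * (of_int N * x ^ (k - m + i)) \<in> root_order" if "i < m" for i
        using False that by (intro root_order_int_mult less.IH) auto
      ultimately show ?thesis by (simp only:) (rule root_order_sum, simp)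
    qed
  qed
  then show ?thesis using N(1) unfolding bounded_powers_def by blast
qed

lemma bounded_powers_shift:
  assumes "bounded_powers x"
  shows "bounded_powers (x + 1)"
proof -
  obtain N :: int where N: "N > 0" "\<And>k. of_int N * x ^ k \<in> root_order"
    using assms unfolding bounded_powers_def by blast
  have "of_int N * (x + 1) ^ k \<in> root_order" for k
  proof -
    have "of_int N * (x + 1) ^ k = (\<Sum>i\<le>k. of_int (int (k choose i)) * (of_int N * x ^ i))"
      by (simp add: binomial_ring sum_distrib_left mult_ac)
    then show ?thesis by (simp only:) (intro root_order_sum root_order_int_mult N)
  qed
  then show ?thesis using N(1) unfolding bounded_powers_def by blast
qed

lemma bounded_powers_norm_int:
  assumes "bounded_powers (elt a b)"
  shows "\<exists>n::int. a\<^sup>2 - of_int d * b\<^sup>2 = of_int n"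
proof -
  obtain N :: int where N: "N > 0" "\<And>k. of_int N * (elt a b) ^ k \<in> root_order"
    using assms unfolding bounded_powers_def by blast
  have pw: "\<exists>A B. (elt a b) ^ k = elt A B \<and> (a\<^sup>2 - of_int d * b\<^sup>2) ^ k = A\<^sup>2 - of_int d * B\<^sup>2" for k
  proof (induction k)
    case 0
    show ?case by (intro exI[of _ 1] exI[of _ 0]) simp
  next
    case (Suc k)
    then obtain A B where AB: "(elt a b) ^ k = elt A B" "(a\<^sup>2 - of_int d * b\<^sup>2) ^ k = A\<^sup>2 - of_int d * B\<^sup>2" by blast
    have "(elt a b) ^ Suc k = elt (a * A + of_int d * b * B) (a * B + b * A)"
      unfolding power_Suc AB(1) by (rule elt_mult)
    moreover have "(a\<^sup>2 - of_int d * b\<^sup>2) ^ Suc k = (a * A + of_int d * b * B)\<^sup>2 - of_int d * (a * B + b * A)\<^sup>2"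
      unfolding power_Suc AB(2) by (simp add: power2_eq_square algebra_simps)
    ultimately show ?case by blast
  qed
  show ?thesis
  proof (rule rat_int_if_bounded_powers)
    show "N * N > 0" using N(1) by simp
    fix k
    obtain A B where AB: "(elt a b) ^ k = elt A B" "(a\<^sup>2 - of_int d * b\<^sup>2) ^ k = A\<^sup>2 - of_int d * B\<^sup>2" using pw by blast
    obtain u v :: int where "of_int N * (elt a b) ^ k = elt (of_int u) (of_int v)"
      using N(2)[of k] unfolding root_order_def by blast
    then have "elt (of_int N * A) (of_int N * B) = elt (of_int u) (of_int v)"
      unfolding AB(1) by (simp add: of_rat_mult algebra_simps)
    then have uv: "of_int N * A = of_int u" "of_int N * B = of_int v" unfolding elt_eq_iff by auto
    have "of_int (N * N) * (a\<^sup>2 - of_int d * b\<^sup>2) ^ k = (of_int N * A)\<^sup>2 - of_int d * (of_int N * B)\<^sup>2"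
      unfolding AB(2) by (simp add: power2_eq_square algebra_simps)
    also have "\<dots> = of_int (u\<^sup>2 - d * v\<^sup>2)" unfolding uv by simp
    finally show "\<exists>z::int. of_int (N * N) * (a\<^sup>2 - of_int d * b\<^sup>2) ^ k = of_int z" by blast
  qed
qed

text \<open>
  The norms of \<open>x\<close> and of \<open>x + 1\<close> are integers, and they differ by the trace plus \<open>1\<close>.  Given trace and norm,
  \<open>d (2 b)\<^sup>2\<close> is an integer, and since \<open>d\<close> is squarefree so is \<open>2 b\<close>.
\<close>
lemma algebraic_int_half_integers:
  assumes "algebraic_int (elt a b)"
  shows "\<exists>t u :: int. 2 * a = of_int t \<and> 2 * b = of_int u \<and> 4 dvd t\<^sup>2 - d * u\<^sup>2"
proof -
  have bd: "bounded_powers (elt a b)" by (rule algebraic_int_bounded_powers[OF elt_in_K assms])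
  obtain n :: int where n: "a\<^sup>2 - of_int d * b\<^sup>2 = of_int n" using bounded_powers_norm_int[OF bd] by blast
  have e1: "elt a b + 1 = elt (a + 1) b" by (simp add: of_rat_add)
  have "bounded_powers (elt (a + 1) b)" using bounded_powers_shift[OF bd] unfolding e1 .
  then obtain n' :: int where n': "(a + 1)\<^sup>2 - of_int d * b\<^sup>2 = of_int n'" using bounded_powers_norm_int by blast
  define t where "t = n' - n - 1"
  have t: "2 * a = of_int t" using n n' by (simp add: t_def power2_eq_square algebra_simps)
  obtain u v where uv: "v > 0" "coprime u v" "2 * b = of_int u / of_int v" by (rule rat_as_fraction)
  have "of_int d * (2 * b)\<^sup>2 = (2 * a)\<^sup>2 - 4 * (a\<^sup>2 - of_int d * b\<^sup>2)" by (simp add: power2_eq_square algebra_simps)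
  also have "\<dots> = of_int (t\<^sup>2 - 4 * n)" unfolding t n by simp
  finally have e: "of_int d * (2 * b)\<^sup>2 = of_int (t\<^sup>2 - 4 * n)" .
  have "(of_int (d * u\<^sup>2) :: rat) = (of_int d * (of_int u / of_int v)\<^sup>2) * (of_int v)\<^sup>2"
    using uv(1) by (simp add: power_divide)
  also have "\<dots> = (of_int ((t\<^sup>2 - 4 * n) * v\<^sup>2) :: rat)" using e unfolding uv(3) by simp
  finally have "d * u\<^sup>2 = (t\<^sup>2 - 4 * n) * v\<^sup>2" using of_int_eq_iff by blast
  then have "v\<^sup>2 dvd d * u\<^sup>2" by simp
  moreover have "coprime (v\<^sup>2) (u\<^sup>2)" using uv(2) by (simp add: coprime_commute)
  ultimately have "v\<^sup>2 dvd d" by (simp add: coprime_dvd_mult_left_iff)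
  then have "v dvd 1" by (rule squarefreeD[OF sf])
  then have "v = 1" using uv(1) by (simp add: zdvd1_eq)
  then have u: "2 * b = of_int u" using uv by simp
  have "of_int (d * u\<^sup>2) = (of_int (t\<^sup>2 - 4 * n) :: rat)" using e unfolding u by simp
  then have "d * u\<^sup>2 = t\<^sup>2 - 4 * n" using of_int_eq_iff by blast
  then have "t\<^sup>2 - d * u\<^sup>2 = 4 * n" by simp
  then show ?thesis using t u by (metis dvd_triv_left)
qed

definition \<theta> :: complex where
  "\<theta> = (if d mod 4 = 1 then (1 + s) / 2 else s)"

lemma theta_elt: "\<theta> = (if d mod 4 = 1 then elt (1 / 2) (1 / 2) else elt 0 1)"
  by (simp add: \<theta>_def of_rat_divide field_simps)

lemma theta_in_K: "\<theta> \<in> K"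
proof (cases "d mod 4 = 1")
  case True
  show ?thesis unfolding theta_elt if_P[OF True] by (rule elt_in_K)
next
  case False
  show ?thesis unfolding theta_elt if_not_P[OF False] by (rule elt_in_K)
qed

lemma algebraic_int_theta: "algebraic_int \<theta>"
proof (cases "d mod 4 = 1")
  case True
  define D where "D = d div 4"
  have dD: "d = 4 * D + 1" unfolding D_def using True by presburger
  let ?p = "[:- of_int D, -1, 1:] :: complex poly"
  show ?thesis
  proof (rule algebraic_int.intros[of ?p])
    show "Polynomial.lead_coeff ?p = 1" by simp
    show "\<forall>i. Polynomial.coeff ?p i \<in> \<int>" by (auto simp: coeff_pCons split: nat.splits)
    have ss: "s * s = 4 * of_int D + 1" unfolding s_square by (simp add: dD)
    have "\<theta> = (1 + s) / 2" using True by (simp add: \<theta>_def)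
    then have two: "2 * \<theta> = 1 + s" by (simp only:) simp
    have "4 * poly ?p \<theta> = (2 * \<theta>) * (2 * \<theta>) - 2 * (2 * \<theta>) - 4 * of_int D" by (simp add: algebra_simps)
    also have "\<dots> = s * s - 1 - 4 * of_int D" unfolding two by (simp add: algebra_simps)
    finally have "4 * poly ?p \<theta> = s * s - 1 - 4 * of_int D" .
    then show "poly ?p \<theta> = 0" unfolding ss by simp
  qed
next
  case False
  then show ?thesis by (auto simp: \<theta>_def intro: int_imp_algebraic_int)
qed

lemma squarefree_mod_4: "d mod 4 \<noteq> 0"
proof
  assume "d mod 4 = 0"
  then have "2\<^sup>2 dvd d" by auto
  then have "(2::int) dvd 1" by (rule squarefreeD[OF sf])
  then show False by simp
qed

lemma integer_representation:
  assumes "x \<in> K" "algebraic_int x"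
  shows "\<exists>m n :: int. x = of_int m + of_int n * \<theta>"
proof -
  obtain a b where x: "x = elt a b" using assms(1) by (rule K_obtain)
  obtain t u :: int where tu: "2 * a = of_int t" "2 * b = of_int u" "4 dvd t\<^sup>2 - d * u\<^sup>2"
    using algebraic_int_half_integers assms(2) unfolding x by blast
  then have ab: "a = of_int t / 2" "b = of_int u / 2" by simp_all
  obtain z where z: "t\<^sup>2 - d * u\<^sup>2 = 4 * z" using tu(3) by auto
  have x2: "x = of_int t / 2 + of_int u / 2 * s" by (simp add: x ab of_rat_divide)
  show ?thesis
  proof (cases "d mod 4 = 1")
    case True
    then have "odd d" by presburger
    moreover have "even (t\<^sup>2 - d * u\<^sup>2)" using z by simp
    ultimately have "even (t - u)" by auto
    then obtain m where m: "t - u = 2 * m" by blast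
    then have t: "t = u + 2 * m" by simp
    have "x = of_int m + of_int u * \<theta>"
    proof -
      have "(U + 2 * V) / 2 + U / 2 * S = V + U * ((1 + S) / 2)" for U V S :: complex
        by (simp add: add_divide_distrib distrib_left)
      from this[of "of_int u" "of_int m" s] show ?thesis
        unfolding x2 t \<theta>_def if_P[OF True] by (simp only: of_int_add of_int_mult of_int_numeral)
    qed
    then show ?thesis by blast
  next
    case False
    obtain k i where k: "t\<^sup>2 = 4 * k + i" "i = of_bool (odd t)" by (metis square_mod_4)
    obtain l j where l: "u\<^sup>2 = 4 * l + j" "j = of_bool (odd u)" by (metis square_mod_4)
    define D r where "D = d div 4" and "r = d mod 4"
    have dD: "d = 4 * D + r" by (simp add: D_def r_def)
    have r: "r = 2 \<or> r = 3" unfolding r_def using False squarefree_mod_4 by presburger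
    have "i - r * j = 4 * (z - k + 4 * D * l + D * j + r * l)"
      using z unfolding k(1) l(1) dD by (simp add: algebra_simps)
    then obtain w where w: "i - r * j = 4 * w" by blast
    have "even t \<and> even u"
      using w r k(2) l(2) by (cases "odd t"; cases "odd u"; elim disjE; simp; presburger)
    then obtain t' u' where tu': "t = 2 * t'" "u = 2 * u'" by (auto elim!: evenE)
    have "x = of_int t' + of_int u' * \<theta>"
      using False unfolding x2 tu' \<theta>_def by simp
    then show ?thesis by blast
  qed
qed

lemma theta_independent:
  fixes m n m' n' :: int
  assumes "of_int m + of_int n * \<theta> = of_int m' + of_int n' * \<theta>"
  shows "m = m' \<and> n = n'"
proof (cases "d mod 4 = 1")
  case True
  have e: "of_int m + of_int n * \<theta> = elt (of_int m + of_int n / 2) (of_int n / 2)" for m n :: int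
  proof -
    have "U + V * ((1 + S) / 2) = (U + V / 2) + V / 2 * S" for U V S :: complex
      by (simp add: add_divide_distrib distrib_left)
    from this[of "of_int m" "of_int n" s] show ?thesis
      unfolding \<theta>_def if_P[OF True] by (simp add: of_rat_add of_rat_divide)
  qed
  show ?thesis using assms unfolding e elt_eq_iff by simp
next
  case False
  have e: "of_int m + of_int n * \<theta> = elt (of_int m) (of_int n)" for m n :: int
    using False by (simp add: \<theta>_def)
  show ?thesis using assms unfolding e elt_eq_iff by simp
qed

lemma sum_lessThan_2: "(\<Sum>i<(2::nat). f i) = f 0 + f 1"
  by (simp add: numeral_2_eq_2)

lemma integral_basis_theta: "integral_basis K 2 (\<lambda>i. if i = 0 then 1 else \<theta>)"
  unfolding integral_basis_def
proof (intro conjI allI impI ballI)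
  fix i :: nat assume "i < 2"
  show "(if i = 0 then 1 else \<theta>) \<in> ring_of_integers K"
    using theta_in_K algebraic_int_theta of_int_in_K[of 1] by (simp add: ring_of_integers_def int_imp_algebraic_int)
next
  fix x assume "x \<in> ring_of_integers K"
  then obtain m n :: int where x: "x = of_int m + of_int n * \<theta>"
    using integer_representation unfolding ring_of_integers_def by blast
  show "\<exists>!c. c \<in> {..<2::nat} \<rightarrow>\<^sub>E (UNIV :: int set) \<and> x = (\<Sum>i<2. of_int (c i) * (if i = 0 then 1 else \<theta>))"
  proof (rule ex1I[of _ "\<lambda>i\<in>{..<2::nat}. if i = 0 then m else n"])
    show "(\<lambda>i\<in>{..<2::nat}. if i = 0 then m else n) \<in> {..<2} \<rightarrow>\<^sub>E UNIV \<and>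
        x = (\<Sum>i<2. of_int ((\<lambda>i\<in>{..<2::nat}. if i = 0 then m else n) i) * (if i = 0 then 1 else \<theta>))"
      unfolding sum_lessThan_2 x by simp
  next
    fix c :: "nat \<Rightarrow> int"
    assume c: "c \<in> {..<2} \<rightarrow>\<^sub>E UNIV \<and> x = (\<Sum>i<2. of_int (c i) * (if i = 0 then 1 else \<theta>))"
    then have "of_int (c 0) + of_int (c 1) * \<theta> = of_int m + of_int n * \<theta>"
      unfolding x by (simp add: sum_lessThan_2)
    then have "c 0 = m" "c 1 = n" using theta_independent by auto
    then show "c = (\<lambda>i\<in>{..<2::nat}. if i = 0 then m else n)"
      using c by (intro extensionalityI[of _ "{..<2}"]) (auto simp: less_2_cases_iff PiE_def)
  qed
qed

text \<open>
  The square of this expression is the discriminant of the basis, and \<open>k\<close> is the determinant of the integral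
  matrix that expresses \<open>\<omega>'\<close> in terms of \<open>\<omega>\<close>.
\<close>
lemma integral_basis_change:
  assumes b: "integral_basis K 2 \<omega>" and b': "\<And>i. i < (2::nat) \<Longrightarrow> \<omega>' i \<in> ring_of_integers K"
  shows "\<exists>k::int. \<omega>' 0 * conjugate (\<omega>' 1) - \<omega>' 1 * conjugate (\<omega>' 0) = of_int k * (\<omega> 0 * conjugate (\<omega> 1) - \<omega> 1 * conjugate (\<omega> 0))"
proof -
  have wK: "\<omega> 0 \<in> K" "\<omega> 1 \<in> K" using b by (auto simp: integral_basis_def ring_of_integers_def)
  have "\<exists>m n :: int. y = of_int m * \<omega> 0 + of_int n * \<omega> 1" if "y \<in> ring_of_integers K" for y
    using b that unfolding integral_basis_def sum_lessThan_2 by blast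
  moreover have "\<omega>' 0 \<in> ring_of_integers K" "\<omega>' 1 \<in> ring_of_integers K" by (rule b', simp)+
  ultimately obtain a b c e :: int
    where eq: "\<omega>' 0 = of_int a * \<omega> 0 + of_int b * \<omega> 1" "\<omega>' 1 = of_int c * \<omega> 0 + of_int e * \<omega> 1"
    by metis
  then have "\<omega>' 0 * conjugate (\<omega>' 1) - \<omega>' 1 * conjugate (\<omega>' 0) = of_int (a * e - b * c) * (\<omega> 0 * conjugate (\<omega> 1) - \<omega> 1 * conjugate (\<omega> 0))"
    unfolding eq conjugate_int_combination[OF wK] by (simp add: algebra_simps)
  then show ?thesis by blast
qed

text \<open>
  Any two integral bases are integral combinations of each other, so their discriminants are
  multiples of each other by squares of integers; being nonzero, they agree.
\<close>
theorem discriminant_K: "discriminant K = (if d mod 4 = 1 then d else 4 * d)"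
proof -
  define \<omega>0 where "\<omega>0 = (\<lambda>i::nat. if i = 0 then 1 else \<theta>)"
  define \<Delta> where "\<Delta> = (if d mod 4 = 1 then d else 4 * d)"
  define G where "G = (\<lambda>\<omega>. \<omega> 0 * conjugate (\<omega> (1::nat)) - \<omega> 1 * conjugate (\<omega> 0))"
  have basisK: "\<omega> 0 \<in> K" "\<omega> 1 \<in> K" if "integral_basis K 2 \<omega>" for \<omega>
    using that by (auto simp: integral_basis_def ring_of_integers_def)
  have b0: "integral_basis K 2 \<omega>0" unfolding \<omega>0_def by (rule integral_basis_theta)
  have "(G \<omega>0)\<^sup>2 = (conjugate \<theta> - \<theta>)\<^sup>2" using conjugate_of_int[of 1] by (simp add: G_def \<omega>0_def)
  also have "\<dots> = of_int \<Delta>"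
  proof (cases "d mod 4 = 1")
    case True
    then have "conjugate \<theta> - \<theta> = - s" unfolding theta_elt if_P[OF True] conjugate_elt by (simp add: of_rat_minus of_rat_divide field_simps)
    then show ?thesis using True s_square by (simp add: \<Delta>_def power2_eq_square)
  next
    case False
    then have "conjugate \<theta> - \<theta> = - (2 * s)" by (simp add: \<theta>_def conjugate_s)
    then have "(conjugate \<theta> - \<theta>)\<^sup>2 = 4 * (s * s)" by (simp add: power2_eq_square)
    then show ?thesis using False by (simp add: \<Delta>_def s_square)
  qed
  finally have G0: "(G \<omega>0)\<^sup>2 = of_int \<Delta>" .
  have "d \<noteq> 0" using sf by auto
  then have \<Delta>0: "\<Delta> \<noteq> 0" by (simp add: \<Delta>_def)
  have char: "(\<exists>\<omega>. let n = card (embeddings K) in integral_basis K n \<omega> \<and>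
      of_int D = Determinant.det (Matrix.mat n n (\<lambda>(i, j). field_trace K (\<omega> i * \<omega> j)))) \<longleftrightarrow>
      (\<exists>\<omega>. integral_basis K 2 \<omega> \<and> of_int D = (G \<omega>)\<^sup>2)" for D
    unfolding card_embeddings Let_def G_def using discriminant_matrix basisK by metis
  show ?thesis
    unfolding discriminant_def char \<Delta>_def[symmetric]
  proof (rule the_equality)
    show "\<exists>\<omega>. integral_basis K 2 \<omega> \<and> of_int \<Delta> = (G \<omega>)\<^sup>2" using b0 G0 by metis
  next
    fix D assume "\<exists>\<omega>. integral_basis K 2 \<omega> \<and> of_int D = (G \<omega>)\<^sup>2"
    then obtain \<omega> where w: "integral_basis K 2 \<omega>" "of_int D = (G \<omega>)\<^sup>2" by blast
    obtain k :: int where k: "G \<omega> = of_int k * G \<omega>0"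
      using integral_basis_change[OF b0, of \<omega>] w(1) unfolding G_def integral_basis_def by blast
    obtain k' :: int where k': "G \<omega>0 = of_int k' * G \<omega>"
      using integral_basis_change[OF w(1), of \<omega>0] b0 unfolding G_def integral_basis_def by blast
    have "(of_int D :: complex) = of_int (k\<^sup>2 * \<Delta>)" using w(2) k G0 by (simp add: power_mult_distrib)
    then have D: "D = k\<^sup>2 * \<Delta>" using of_int_eq_iff by blast
    have "(of_int \<Delta> :: complex) = of_int (k'\<^sup>2 * D)" using w(2) k' G0 by (simp add: power_mult_distrib)
    then have "\<Delta> = k'\<^sup>2 * D" using of_int_eq_iff by blast
    then have "(k'\<^sup>2 * k\<^sup>2) * \<Delta> = 1 * \<Delta>" by (simp add: D)
    then have "k'\<^sup>2 * k\<^sup>2 = 1" using \<Delta>0 by simp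
    then have "k\<^sup>2 dvd 1" by (metis dvd_triv_right)
    then have "k\<^sup>2 = 1" by (simp add: zdvd1_eq abs_if split: if_splits)
    then show "D = \<Delta>" by (simp add: D)
  qed
qed

lemma Legendre_discriminant:
  assumes "prime (l::nat)" "l \<noteq> 2"
  shows "Legendre (discriminant K) (int l) = Legendre d (int l)"
proof (cases "d mod 4 = 1")
  case False
  have l2: "2 < l" using assms prime_ge_2_nat[of l] by simp
  have "\<not> int l dvd 2" using l2 by (auto dest: zdvd_imp_le)
  then have "Legendre (2 * 2) (int l) = 1"
    using assms(1) by (intro Legendre_square[of _ 2]) (auto simp: power2_eq_square)
  then show ?thesis using False Legendre_mult[OF assms(1) l2, of 4 d] by (simp add: discriminant_K)
qed (simp add: discriminant_K)

end

theorem theorem9: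
  fixes d :: int and p q :: nat
  assumes "squarefree d" and "d \<noteq> 1"
    and "prime p" and "prime q"
  defines "K \<equiv> quadratic_field d"
  defines "\<Delta> \<equiv> discriminant K"
  shows "is_division_algebra
           (quaternion_algebra (subfield_ring K) (of_nat p) (of_nat q)) \<longleftrightarrow>
      (odd p \<and> odd q \<and> p \<noteq> q \<and> ([p = 1] (mod 4) \<or> [q = 1] (mod 4)) \<and>
        Legendre (int p) (int q) = -1 \<and>
        (Legendre \<Delta> (int p) = 1 \<or> Legendre \<Delta> (int q) = 1))
    \<or> (q = 2 \<and> ([p = 3] (mod 8) \<or> [p = 5] (mod 8)) \<and>
        (Legendre \<Delta> (int p) = 1 \<or> [d = 1] (mod 8)))
    \<or> (p = 2 \<and> ([q = 3] (mod 8) \<or> [q = 5] (mod 8)) \<and>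
        (Legendre \<Delta> (int q) = 1 \<or> [d = 1] (mod 8)))
    \<or> (odd p \<and> odd q \<and> [p = 3] (mod 4) \<and> [q = 3] (mod 4) \<and>
        ((Legendre (int q) (int p) \<noteq> 1 \<and>
            (Legendre \<Delta> (int p) = 1 \<or> [d = 1] (mod 8))) \<or>
         (Legendre (int p) (int q) \<noteq> 1 \<and>
            (Legendre \<Delta> (int q) = 1 \<or> [d = 1] (mod 8)))))"
proof -
  interpret quadratic d using assms by unfold_locales
  have "is_division_algebra (quaternion_algebra (subfield_ring K) (of_nat p) (of_nat q)) \<longleftrightarrow>
      (\<exists>l. prime l \<and> hilbert l (int p) (int q) = -1 \<and> local_square l d)"
    unfolding K_def division_algebra_iff_quaternary[OF assms(3,4)]
      quaternary_isotropic_iff[OF assms(3,4,1)] by blast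
  also note ramified_split_conditions[OF assms(3,4,1) Legendre_discriminant]
  finally show ?thesis unfolding \<Delta>_def K_def .
qed

end
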